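(* Let $\tau=\tau_n\in(0,1)$ be a deterministic sequence with $\tau\to0$, and let $k_S>0$, $k_M<1$, $k_L>1$ be positive constants and $f_\tau$ numbers with $f_\tau\uparrow\infty$ as $\tau\to0$. Define $$\mathcal S=\{1\le i\le n:|\theta_{0,i}|\le k_S\tau\},\quad \mathcal M=\{1\le i\le n: f_\tau\tau\le|\theta_{0,i}|\le k_M\zeta_\tau\},\quad \mathcal L=\{1\le i\le n: k_L\zeta_\tau\le|\theta_{0,i}|\}.$$ Then for any sequence $\gamma_n\to c$ for some $0\le c\le 1/2$, satisfying $\zeta_{\gamma_n}\ll\zeta_\tau$, $$P_{\theta_0}\Bigl(\tfrac1{|\mathcal S|}\bigl|\{i\in\mathcal S:\theta_{0,i}\in\hat C_{ni}(L_S,\tau)\}\bigr|\ge1-\gamma_n\Bigr)\to1,$$ $$P_{\theta_0}\bigl(\theta_{0,i}\notin\hat C_{ni}(L,\tau)\bigr)\to1,\quad\text{for any }L>0\text{ and } i\in\mathcal M,$$ $$P_{\theta_0}\Bigl(\tfrac1{|\mathcal L|}\bigl|\{i\in\mathcal L:\theta_{0,i}\in\hat C_{ni}(L_L,\tau)\}\bigr|\ge1-\gamma_n\Bigr)\to1,$$ where $L_S=(2.1/z_\alpha)\bigl[k_S+(2/\gamma_n)\zeta_{\gamma_n/2}\bigr]$ and $L_L=(1.1/z_\alpha)\zeta_{\gamma_n/2}$.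
   Context: Model: for each $n$ one observes $Y^n=(Y_1,\dots,Y_n)$ with $Y_i=\theta_{0,i}+\varepsilon_i$, $\varepsilon_i$ i.i.d. $N(0,1)$; $P_{\theta_0}$ is the law of $Y^n$, where $\theta_0=\theta_0^{(n)}\in\mathbb R^n$ has $p_n$ nonzero coordinates, $p_n\to\infty$, $p_n=o(n)$. Limits are as $n\to\infty$. Horseshoe prior given $\tau>0$: independently over $i$, $\theta_i\mid\lambda_i,\tau\sim N(0,\lambda_i^2\tau^2)$ with $\lambda_i$ standard half-Cauchy (density $\frac{2}{\pi(1+\lambda^2)}$ on $(0,\infty)$). In the Bayesian model $Y_i\mid\theta_i\sim N(\theta_i,1)$ independently; $\Pi(\cdot\mid Y^n,\tau)$ is the posterior of $\theta$, and its $i$th marginal depends only on $Y_i$. Marginal credible interval: for fixed $0<\alpha\le1/2$, $\hat\theta_i(\tau)=E(\theta_i\mid Y_i,\tau)$ is the posterior mean, $\hat r_i(\alpha,\tau)$ is determined by $\Pi(\theta_i:|\theta_i-\hat\theta_i(\tau)|\le\hat r_i(\alpha,\tau)\mid Y_i,\tau)=1-\alpha$, and for $L>0$, $\hat C_{ni}(L,\tau)=\{\theta_i:|\theta_i-\hat\theta_i(\tau)|\le L\,\hat r_i(\alpha,\tau)\}$. Notation: $\zeta_t=\sqrt{2\log(1/t)}$; $z_\alpha$ is the upper $\alpha$-quantile of the standard normal distribution; $|\cdot|$ of a set is its cardinality; $a_n\ll b_n$ means $a_n/b_n\to0$.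
   Formalization: The third claim (for the set L) is proved when c = 0 or |L| → ∞; for c > 0 and, e.g., |L| = 1 with α < 1/2 it is false, as the single interval misses with probability bounded away from 0. γ_n > 0 is assumed; an empty L counts as covered; for α = 1/2 the factors L_S, L_L are infinite. *)

theory Defs
  imports "HOL-Probability.Probability"
begin

definition normal :: "real \<Rightarrow> real \<Rightarrow> real measure" where
  "normal \<mu> \<sigma> = density lborel (\<lambda>x. ennreal (normal_density \<mu> \<sigma> x))"

text \<open>The law of the observation vector with mean \<open>\<theta>\<close>. Vectors are indexed by \<open>{1..n}\<close>.\<close>

definition obs_law :: "nat \<Rightarrow> (nat \<Rightarrow> real) \<Rightarrow> (nat \<Rightarrow> real) measure" where
  "obs_law n \<theta> = PiM {1..n} (\<lambda>i. normal (\<theta> i) 1)"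

definition half_cauchy :: "real measure" where
  "half_cauchy = density lborel
     (\<lambda>l. ennreal (indicator {0<..} l * (2 / (pi * (1 + l\<^sup>2)))))"

text \<open>The prior of one coordinate: \<open>\<lambda>\<close> is half-Cauchy and, given \<open>\<lambda>\<close>, the coordinate is centred
  normal with standard deviation \<open>\<lambda> * \<tau>\<close>.\<close>

definition horseshoe :: "real \<Rightarrow> real measure" where
  "horseshoe \<tau> = half_cauchy \<bind> (\<lambda>l. normal 0 (l * \<tau>))"

text \<open>Bayes' formula for one coordinate. Under the prior the pairs \<open>(\<theta>\<^sub>i, Y\<^sub>i)\<close> are independent over
  \<open>i\<close>, so \<open>posterior \<tau> (Y i)\<close> is the \<open>i\<close>th marginal of the posterior of the whole vector.\<close>

definition evidence :: "real \<Rightarrow> real \<Rightarrow> ennreal" where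
  "evidence \<tau> y = (\<integral>\<^sup>+ \<theta>. ennreal (normal_density \<theta> 1 y) \<partial>horseshoe \<tau>)"

definition posterior :: "real \<Rightarrow> real \<Rightarrow> real measure" where
  "posterior \<tau> y = density (horseshoe \<tau>) (\<lambda>\<theta>. ennreal (normal_density \<theta> 1 y) / evidence \<tau> y)"

definition post_mean :: "real \<Rightarrow> real \<Rightarrow> real" where
  "post_mean \<tau> y = (\<integral>\<theta>. \<theta> \<partial>posterior \<tau> y)"

definition radius :: "real \<Rightarrow> real \<Rightarrow> real \<Rightarrow> real" where
  "radius \<alpha> \<tau> y =
     (THE r. measure (posterior \<tau> y) {\<theta>. \<bar>\<theta> - post_mean \<tau> y\<bar> \<le> r} = 1 - \<alpha>)"

text \<open>The blow-up factor \<open>L\<close> is extended real: for \<open>\<alpha> = 1/2\<close> the quantile \<open>z_upper \<alpha>\<close> is \<open>0\<close>, the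
  factors used in the theorem are \<open>\<infinity>\<close>, and the interval is the whole line. (With real division
  \<open>x / 0\<close> would be \<open>0\<close> instead.)\<close>

definition credible_interval :: "real \<Rightarrow> real \<Rightarrow> ereal \<Rightarrow> real \<Rightarrow> real set" where
  "credible_interval \<alpha> \<tau> L y =
     {\<theta>. ereal \<bar>\<theta> - post_mean \<tau> y\<bar> \<le> L * ereal (radius \<alpha> \<tau> y)}"

definition zeta :: "real \<Rightarrow> real" where
  "zeta t = sqrt (2 * ln (1 / t))"

definition z_upper :: "real \<Rightarrow> real" where
  "z_upper \<alpha> = (THE z. measure (normal 0 1) {z<..} = \<alpha>)"

definition set_S :: "real \<Rightarrow> real \<Rightarrow> nat \<Rightarrow> (nat \<Rightarrow> real) \<Rightarrow> nat set" where
  "set_S kS \<tau> n \<theta> = {i \<in> {1..n}. \<bar>\<theta> i\<bar> \<le> kS * \<tau>}"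

definition set_M :: "(real \<Rightarrow> real) \<Rightarrow> real \<Rightarrow> real \<Rightarrow> nat \<Rightarrow> (nat \<Rightarrow> real) \<Rightarrow> nat set" where
  "set_M f kM \<tau> n \<theta> = {i \<in> {1..n}. f \<tau> * \<tau> \<le> \<bar>\<theta> i\<bar> \<and> \<bar>\<theta> i\<bar> \<le> kM * zeta \<tau>}"

definition set_L :: "real \<Rightarrow> real \<Rightarrow> nat \<Rightarrow> (nat \<Rightarrow> real) \<Rightarrow> nat set" where
  "set_L kL \<tau> n \<theta> = {i \<in> {1..n}. kL * zeta \<tau> \<le> \<bar>\<theta> i\<bar>}"

text \<open>The fraction of the coordinates in \<open>A\<close> covered by their interval; an empty \<open>A\<close> counts as fully
  covered.\<close>

definition coverage ::
    "real \<Rightarrow> real \<Rightarrow> ereal \<Rightarrow> (nat \<Rightarrow> real) \<Rightarrow> nat set \<Rightarrow> (nat \<Rightarrow> real) \<Rightarrow> real" where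
  "coverage \<alpha> \<tau> L \<theta> A Y =
     (if A = {} then 1
      else real (card {i \<in> A. \<theta> i \<in> credible_interval \<alpha> \<tau> L (Y i)}) / real (card A))"

definition L_S :: "real \<Rightarrow> real \<Rightarrow> real \<Rightarrow> ereal" where
  "L_S \<alpha> kS \<gamma> = ereal 2.1 / ereal (z_upper \<alpha>) * ereal (kS + (2 / \<gamma>) * zeta (\<gamma> / 2))"

definition L_L :: "real \<Rightarrow> real \<Rightarrow> ereal" where
  "L_L \<alpha> \<gamma> = ereal 1.1 / ereal (z_upper \<alpha>) * ereal (zeta (\<gamma> / 2))"

end

theory Submission
  imports Defs "HOL-Real_Asymp.Real_Asymp"
begin

text \<open>
  Given \<open>Y = y\<close> and the local scale \<open>l\<close>, the parameter is normal with mean \<open>k * y\<close> and variance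
  \<open>k = (l * \<tau>)\<^sup>2 / (1 + (l * \<tau>)\<^sup>2)\<close>, and \<open>l\<close> has density proportional to
  \<open>exp (y\<^sup>2 / 2 * k) / sqrt (1 + (l * \<tau>)\<^sup>2)\<close> with respect to the half-Cauchy law; the posterior mean is
  \<open>y\<close> times the mean of \<open>k\<close>. For \<open>\<bar>y\<bar> < zeta \<tau>\<close> the mean of \<open>k\<close> is at most about
  \<open>\<tau> * exp (y\<^sup>2 / 2)\<close>, for \<open>\<bar>y\<bar>\<close> beyond \<open>zeta \<tau>\<close> it differs from \<open>1\<close> by \<open>o (1 / \<bar>y\<bar>)\<close>. The mass
  of the interval is at most that of centred normal intervals; since \<open>l > 1\<close> has posterior
  probability at least about \<open>1 / 2\<close>, the radius is at least about \<open>z_upper \<alpha> * \<tau>\<close> always, and at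
  least about \<open>z_upper \<alpha>\<close> beyond the threshold. Hence in both regimes a coordinate is covered as soon
  as its noise is at most \<open>zeta (\<gamma> / 2)\<close>, and by Mills' inequality this fails with probability at most
  \<open>\<gamma> / (2 * zeta (\<gamma> / 2))\<close>; Markov's inequality (\<open>c = 0\<close>) or Hoeffding's (\<open>c > 0\<close>) bounds the fraction
  of failures. Intermediate signals are missed because mean and radius are both \<open>O \<tau>\<close> for bounded
  observations and \<open>o 1\<close> below the threshold.
\<close>

section \<open>The half-Cauchy distribution\<close>

text \<open>The quantile \<open>z_upper \<alpha>\<close>, rather than the one at
  \<open>\<alpha> / 2\<close>, arises because only about half of the mixture is known to be wide: a
  wide component leaves \<open>2 * upper_tail\<close> outside an interval, and the factor one half
  cancels the 2. The interval is centred at the posterior mean, not at the component means, but a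
  wrong centre only lowers the mass captured, so lower bounds on the radius need no information on
  the centre. The term \<open>2 / \<gamma> * zeta (\<gamma> / 2)\<close> in \<open>L_S\<close> is
  \<open>exp (Z\<^sup>2 / 2) * Z\<close> at \<open>Z = zeta (\<gamma> / 2)\<close>, the factor by
  which noise of size \<open>Z\<close> inflates a posterior mean of order \<open>\<tau>\<close>. The
  delicate observations are those only slightly beyond \<open>zeta \<tau>\<close>: unshrunk scales
  carry prior mass of order \<open>\<tau>\<close> up to powers of \<open>\<bar>y\<bar>\<close>,
  which has to be compensated while still gaining a rate \<open>o (1 / \<bar>y\<bar>)\<close>. The
  one-coordinate estimates are deterministic and uniform in the observation within its regime, so
  randomness enters only through the size of the noise.\<close>

lemma sets_half_cauchy [measurable_cong, simp]: "sets half_cauchy = sets borel"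
  and space_half_cauchy [simp]: "space half_cauchy = UNIV"
  by (simp_all add: half_cauchy_def)

lemma emeasure_half_cauchy_greaterThan:
  assumes "0 \<le> \<Lambda>"
  shows "emeasure half_cauchy {\<Lambda><..} = ennreal (1 - 2 / pi * arctan \<Lambda>)"
proof -
  have lim: "((\<lambda>x. 2 / pi * arctan x) \<longlongrightarrow> 2 / pi * (pi / 2)) at_top"
    by (intro tendsto_intros tendsto_arctan_at_top)
  have "emeasure half_cauchy {\<Lambda><..}
      = (\<integral>\<^sup>+ l. ennreal (indicator {0<..} l * (2 / (pi * (1 + l\<^sup>2)))) * indicator {\<Lambda><..} l \<partial>lborel)"
    unfolding half_cauchy_def by (rule emeasure_density) measurable
  also have "\<dots> = (\<integral>\<^sup>+ l. ennreal (2 / (pi * (1 + l\<^sup>2))) * indicator {\<Lambda>..} l \<partial>lborel)"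
  proof (rule nn_integral_cong_AE, rule AE_mp[OF AE_lborel_singleton[of \<Lambda>]], rule AE_I2, rule impI)
    fix l :: real
    assume "l \<noteq> \<Lambda>"
    then show "ennreal (indicator {0<..} l * (2 / (pi * (1 + l\<^sup>2)))) * indicator {\<Lambda><..} l
        = ennreal (2 / (pi * (1 + l\<^sup>2))) * indicator {\<Lambda>..} l"
      using assms by (cases "\<Lambda> < l") auto
  qed
  also have "\<dots> = ennreal (2 / pi * (pi / 2) - 2 / pi * arctan \<Lambda>)"
  proof (rule nn_integral_FTC_atLeast[OF _ _ _ lim])
    fix x :: real
    show "((\<lambda>x. 2 / pi * arctan x) has_real_derivative 2 / (pi * (1 + x\<^sup>2))) (at x)"
      by (auto intro!: derivative_eq_intros simp: inverse_eq_divide)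
    show "0 \<le> 2 / (pi * (1 + x\<^sup>2))"
      by (simp add: add_nonneg_nonneg)
  qed auto
  finally show ?thesis by simp
qed

interpretation half_cauchy: prob_space half_cauchy
proof
  have "emeasure half_cauchy {..0} = 0"
    unfolding half_cauchy_def
    by (subst emeasure_density) (auto simp: indicator_def nn_integral_0_iff_AE)
  then have "emeasure half_cauchy ({..0} \<union> {0<..}) = 1"
    by (subst plus_emeasure[symmetric]) (auto simp: emeasure_half_cauchy_greaterThan)
  also have "{..0} \<union> {0<..} = (UNIV :: real set)" by auto
  finally show "emeasure half_cauchy (space half_cauchy) = 1" by simp
qed

lemma AE_half_cauchy_pos: "AE l in half_cauchy. 0 < l"
  unfolding half_cauchy_def by (subst AE_density) (auto simp: indicator_def)

lemma measure_half_cauchy_greaterThan: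
  "0 \<le> \<Lambda> \<Longrightarrow> measure half_cauchy {\<Lambda><..} = 1 - 2 / pi * arctan \<Lambda>"
  using emeasure_half_cauchy_greaterThan[of \<Lambda>] arctan_bounded[of \<Lambda>]
  by (simp add: half_cauchy.emeasure_eq_measure field_simps)

lemma half_cauchy_median: "measure half_cauchy {..1} = 1 / 2"
proof -
  have "measure half_cauchy {..1} = 1 - measure half_cauchy {1<..}"
    using half_cauchy.prob_compl[of "{1<..}"] by (auto simp: Compl_eq_Diff_UNIV[symmetric])
  then show ?thesis
    by (simp add: measure_half_cauchy_greaterThan arctan_one)
qed

text \<open>The inversion formula for the arctangent turns the tail at \<Lambda> into an arctangent
  at \<open>1 / \<Lambda>\<close>.\<close>

lemma half_cauchy_tail_le:
  assumes "0 < \<Lambda>"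
  shows "measure half_cauchy {\<Lambda><..} \<le> 1 / \<Lambda>"
proof -
  have "1 - 2 / pi * arctan \<Lambda> = 2 / pi * arctan (1 / \<Lambda>)"
    using arctan_inverse[of \<Lambda>] assms by (simp add: field_simps)
  also have "\<dots> \<le> 2 / pi * (1 / \<Lambda>)"
    using assms by (intro mult_left_mono arctan_le_self) auto
  also have "\<dots> \<le> 1 * (1 / \<Lambda>)"
    using assms pi_ge_two by (intro mult_right_mono) auto
  finally show ?thesis
    using assms by (simp add: measure_half_cauchy_greaterThan)
qed

text \<open>On the block the density is of order \<open>1 / \<Lambda>\<^sup>2\<close> and the length
  is \<Lambda>. This heavy tail later gives the scales with \<open>l * \<tau>\<close> of order
  \<open>\<bar>y\<bar>\<close> a prior mass of order \<open>\<tau> / \<bar>y\<bar>\<close>.\<close>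

lemma half_cauchy_dyadic_ge:
  assumes "1 \<le> \<Lambda>"
  shows "1 / (10 * \<Lambda>) \<le> measure half_cauchy {\<Lambda><..2 * \<Lambda>}"
proof -
  have "\<exists>z. \<Lambda> < z \<and> z < 2 * \<Lambda> \<and> arctan (2 * \<Lambda>) - arctan \<Lambda> = (2 * \<Lambda> - \<Lambda>) * inverse (1 + z\<^sup>2)"
    using assms by (intro MVT2) (auto intro!: derivative_eq_intros)
  then obtain z where z: "\<Lambda> < z" "z < 2 * \<Lambda>"
      "arctan (2 * \<Lambda>) - arctan \<Lambda> = \<Lambda> / (1 + z\<^sup>2)"
    by (auto simp: field_simps)
  have "z\<^sup>2 \<le> (2 * \<Lambda>)\<^sup>2" using z assms by (intro power_mono) auto
  moreover have "1 \<le> \<Lambda>\<^sup>2" using assms by simp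
  ultimately have "1 + z\<^sup>2 \<le> 5 * \<Lambda>\<^sup>2" by (simp add: power2_eq_square)
  then have "\<Lambda> / (5 * \<Lambda>\<^sup>2) \<le> \<Lambda> / (1 + z\<^sup>2)"
    using assms by (intro divide_left_mono) (auto intro!: mult_pos_pos add_pos_nonneg)
  then have "1 / (5 * \<Lambda>) \<le> arctan (2 * \<Lambda>) - arctan \<Lambda>"
    using assms z by (simp add: power2_eq_square)
  moreover have "1 / 2 \<le> 2 / pi" using pi_less_4 by (simp add: field_simps)
  ultimately have "1 / 2 * (1 / (5 * \<Lambda>)) \<le> 2 / pi * (arctan (2 * \<Lambda>) - arctan \<Lambda>)"
    using assms by (intro mult_mono) auto
  moreover have "measure half_cauchy {\<Lambda><..2 * \<Lambda>}
      = measure half_cauchy ({\<Lambda><..} - {2 * \<Lambda><..})"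
    by (rule arg_cong[where f = "measure half_cauchy"]) auto
  then have "measure half_cauchy {\<Lambda><..2 * \<Lambda>} = 2 / pi * (arctan (2 * \<Lambda>) - arctan \<Lambda>)"
    using assms by (subst (asm) half_cauchy.finite_measure_Diff)
      (auto simp: measure_half_cauchy_greaterThan algebra_simps)
  ultimately show ?thesis by simp
qed

text \<open>The Cauchy density absorbs \<open>l\<^sup>2\<close>, and what is left is a constant
  times \<open>1 + (l * \<tau>)\<^sup>2\<close> to the power -3/2, which has an explicit
  antiderivative. The heavy tail makes the result linear in \<tau> although the integrand starts
  like \<open>\<tau>\<^sup>2\<close>. This is the factor \<tau> in the bound on the posterior
  mean.\<close>

lemma nn_integral_half_cauchy_shrink:
  assumes "0 < \<tau>"
  shows "(\<integral>\<^sup>+ l. ennreal ((l * \<tau>)\<^sup>2 / (1 + (l * \<tau>)\<^sup>2) / sqrt (1 + (l * \<tau>)\<^sup>2)) \<partial>half_cauchy)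
    \<le> ennreal (2 / pi * \<tau>)"
proof -
  define S where "S l = sqrt (1 + (l * \<tau>)\<^sup>2)" for l
  define f where "f l = 2 / pi * \<tau>\<^sup>2 / (S l * S l * S l)" for l
  have pos: "0 < 1 + (l * \<tau>)\<^sup>2" for l by (intro add_pos_nonneg) auto
  have S: "0 < S l" "S l * S l = 1 + (l * \<tau>)\<^sup>2" for l
    using pos[of l] by (auto simp: S_def)
  have [measurable]: "S \<in> borel_measurable borel" "f \<in> borel_measurable borel"
    unfolding S_def[abs_def] f_def[abs_def] by measurable
  have "((\<lambda>l. 2 / pi * (l * \<tau>\<^sup>2) / S l) \<longlongrightarrow> 2 * \<tau>\<^sup>2 * inverse \<bar>\<tau>\<bar> / pi) at_top"
    unfolding S_def using assms by real_asymp
  also have "2 * \<tau>\<^sup>2 * inverse \<bar>\<tau>\<bar> / pi = 2 / pi * \<tau>"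
    using assms by (simp add: power2_eq_square)
  finally have lim: "((\<lambda>l. 2 / pi * (l * \<tau>\<^sup>2) / S l) \<longlongrightarrow> 2 / pi * \<tau>) at_top" .
  have "(\<integral>\<^sup>+ l. ennreal ((l * \<tau>)\<^sup>2 / (S l * S l) / S l) \<partial>half_cauchy)
     = (\<integral>\<^sup>+ l. ennreal (indicator {0<..} l * (2 / (pi * (1 + l\<^sup>2)))) *
          ennreal ((l * \<tau>)\<^sup>2 / (S l * S l) / S l) \<partial>lborel)"
    unfolding half_cauchy_def by (rule nn_integral_density) measurable
  also have "\<dots> \<le> (\<integral>\<^sup>+ l. ennreal (f l) * indicator {0..} l \<partial>lborel)"
  proof (rule nn_integral_mono)
    fix l :: real
    show "ennreal (indicator {0<..} l * (2 / (pi * (1 + l\<^sup>2)))) *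
          ennreal ((l * \<tau>)\<^sup>2 / (S l * S l) / S l) \<le> ennreal (f l) * indicator {0..} l"
    proof (cases "0 < l")
      case True
      have f: "0 \<le> f l" using S[of l] by (simp add: f_def)
      have "2 / (pi * (1 + l\<^sup>2)) * ((l * \<tau>)\<^sup>2 / (S l * S l) / S l) = (l\<^sup>2 / (1 + l\<^sup>2)) * f l"
        by (simp add: f_def power_mult_distrib mult_ac)
      also have "\<dots> \<le> 1 * f l"
        using f by (intro mult_right_mono) (auto simp: add_pos_nonneg)
      finally have "ennreal (2 / (pi * (1 + l\<^sup>2)) * ((l * \<tau>)\<^sup>2 / (S l * S l) / S l)) \<le> ennreal (f l)"
        by (intro ennreal_leI) simp
      moreover have "ennreal (2 / (pi * (1 + l\<^sup>2)) * ((l * \<tau>)\<^sup>2 / (S l * S l) / S l))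
         = ennreal (2 / (pi * (1 + l\<^sup>2))) * ennreal ((l * \<tau>)\<^sup>2 / (S l * S l) / S l)"
        using S(1)[of l] by (intro ennreal_mult) (auto intro: add_nonneg_nonneg)
      ultimately show ?thesis using True by simp
    qed simp
  qed
  also have "\<dots> = ennreal (2 / pi * \<tau> - 2 / pi * (0 * \<tau>\<^sup>2) / S 0)"
  proof (rule nn_integral_FTC_atLeast[OF _ _ _ lim])
    fix l :: real
    have dS: "(S has_real_derivative l * \<tau> * \<tau> / S l) (at l)"
      unfolding S_def using pos[of l]
      by (auto intro!: derivative_eq_intros simp: power2_eq_square) (simp add: inverse_eq_divide)
    \<comment> \<open>In the numerator of the quotient rule
      \<open>S l * S l - (l * \<tau>)\<^sup>2\<close> equals 1, so the derivative collapses to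
      \<open>f l\<close>.\<close>
    have "(2 / pi * \<tau>\<^sup>2 * S l - 2 / pi * (l * \<tau>\<^sup>2) * (l * \<tau> * \<tau> / S l)) * S l
         = 2 / pi * \<tau>\<^sup>2 * (S l * S l - (l * \<tau>)\<^sup>2)"
      using S(1)[of l] by (simp add: left_diff_distrib right_diff_distrib power2_eq_square mult_ac)
    then have "(2 / pi * \<tau>\<^sup>2 * S l - 2 / pi * (l * \<tau>\<^sup>2) * (l * \<tau> * \<tau> / S l)) * S l = 2 / pi * \<tau>\<^sup>2"
      by (simp only: S(2) add_diff_cancel_right' mult_1_right)
    then have num: "2 / pi * \<tau>\<^sup>2 * S l - 2 / pi * (l * \<tau>\<^sup>2) * (l * \<tau> * \<tau> / S l) = 2 / pi * \<tau>\<^sup>2 / S l"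
      using S(1)[of l] by (intro eq_divide_imp) auto
    have "((\<lambda>l. 2 / pi * (l * \<tau>\<^sup>2)) has_real_derivative 2 / pi * \<tau>\<^sup>2) (at l)"
      by (auto intro!: derivative_eq_intros)
    from DERIV_divide[OF this dS]
    have "((\<lambda>l. 2 / pi * (l * \<tau>\<^sup>2) / S l) has_real_derivative
        (2 / pi * \<tau>\<^sup>2 * S l - 2 / pi * (l * \<tau>\<^sup>2) * (l * \<tau> * \<tau> / S l)) / (S l * S l)) (at l)"
      using S(1)[of l] by simp
    then show "((\<lambda>l. 2 / pi * (l * \<tau>\<^sup>2) / S l) has_real_derivative f l) (at l)"
      unfolding num by (simp add: f_def mult_ac)
    show "0 \<le> f l"
      using S(1)[of l] by (simp add: f_def)
  qed measurable
  finally show ?thesis by (simp add: S(2)) (simp add: S_def)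
qed

section \<open>The posterior as a normal mixture\<close>

text \<open>One minus the usual shrinkage coefficient: values near 1 mean that the observation is
  kept.\<close>

definition shrink :: "real \<Rightarrow> real \<Rightarrow> real" where
  "shrink \<tau> l = (l * \<tau>)\<^sup>2 / (1 + (l * \<tau>)\<^sup>2)"

text \<open>The likelihood ratio at \<open>y\<close> of the law of the observation given
  \<open>l\<close>, centred normal with variance \<open>1 + (l * \<tau>)\<^sup>2\<close>, against
  the standard normal. With this normalisation the total weight is bounded below by nearly 1 for all
  \<open>y\<close> at once.\<close>

definition wt :: "real \<Rightarrow> real \<Rightarrow> real \<Rightarrow> real" where
  "wt \<tau> y l = exp (y\<^sup>2 / 2 * shrink \<tau> l) / sqrt (1 + (l * \<tau>)\<^sup>2)"

definition wt_total :: "real \<Rightarrow> real \<Rightarrow> real" where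
  "wt_total \<tau> y = (\<integral>l. wt \<tau> y l \<partial>half_cauchy)"

definition mixing :: "real \<Rightarrow> real \<Rightarrow> real measure" where
  "mixing \<tau> y = density half_cauchy (\<lambda>l. ennreal (wt \<tau> y l / wt_total \<tau> y))"

lemma one_plus_square_pos [simp]: "0 < 1 + (x::real)\<^sup>2"
  by (intro add_pos_nonneg) auto

lemma shrink_nonneg: "0 \<le> shrink \<tau> l"
  by (simp add: shrink_def)

lemma shrink_pos: "0 < l \<Longrightarrow> 0 < \<tau> \<Longrightarrow> 0 < shrink \<tau> l"
  by (simp add: shrink_def)

lemma shrink_less_1: "shrink \<tau> l < 1"
  by (simp add: shrink_def)

lemma shrink_mono: "0 < \<tau> \<Longrightarrow> 0 \<le> l \<Longrightarrow> l \<le> l' \<Longrightarrow> shrink \<tau> l \<le> shrink \<tau> l'"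
proof -
  assume a: "0 < \<tau>" "0 \<le> l" "l \<le> l'"
  have eq: "shrink \<tau> x = 1 - 1 / (1 + (x * \<tau>)\<^sup>2)" for x
    using one_plus_square_pos[of "x * \<tau>"] by (simp add: shrink_def field_simps)
  have "(l * \<tau>)\<^sup>2 \<le> (l' * \<tau>)\<^sup>2" using a by (intro power_mono mult_right_mono) auto
  then show ?thesis
    unfolding eq by (intro diff_left_mono divide_left_mono) auto
qed

lemma shrink_measurable [measurable]: "shrink \<tau> \<in> borel_measurable borel"
  unfolding shrink_def[abs_def] by measurable

lemma wt_measurable [measurable]: "wt \<tau> y \<in> borel_measurable borel"
  unfolding wt_def[abs_def] by measurable

lemma wt_pos: "0 < wt \<tau> y l"
  by (simp add: wt_def)

lemma wt_nonneg: "0 \<le> wt \<tau> y l"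
  using wt_pos[of \<tau> y l] by simp

lemma wt_le: "wt \<tau> y l \<le> exp (y\<^sup>2 / 2)"
proof -
  have "y\<^sup>2 / 2 * shrink \<tau> l \<le> y\<^sup>2 / 2 * 1"
    using shrink_less_1[of \<tau> l] by (intro mult_left_mono) auto
  moreover have "1 \<le> sqrt (1 + (l * \<tau>)\<^sup>2)" by simp
  ultimately have "exp (y\<^sup>2 / 2 * shrink \<tau> l) / sqrt (1 + (l * \<tau>)\<^sup>2) \<le> exp (y\<^sup>2 / 2) / 1"
    by (intro frac_le) auto
  then show ?thesis by (simp add: wt_def)
qed

lemma integrable_wt_mult:
  assumes [measurable]: "g \<in> borel_measurable borel" and b: "\<And>l. \<bar>g l\<bar> \<le> B"
  shows "integrable half_cauchy (\<lambda>l. wt \<tau> y l * g l)"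
proof (rule half_cauchy.integrable_const_bound[where B = "exp (y\<^sup>2 / 2) * B"])
  show "AE l in half_cauchy. norm (wt \<tau> y l * g l) \<le> exp (y\<^sup>2 / 2) * B"
    using wt_nonneg[of \<tau> y] wt_le[of \<tau> y] b
    by (auto simp: abs_mult intro!: mult_mono AE_I2)
qed measurable

lemma integrable_wt: "integrable half_cauchy (wt \<tau> y)"
  using integrable_wt_mult[of "\<lambda>_. 1" 1] by simp

lemma wt_total_pos: "0 < wt_total \<tau> y"
proof -
  have "wt_total \<tau> y \<noteq> 0"
  proof
    assume "wt_total \<tau> y = 0"
    then have "AE l in half_cauchy. wt \<tau> y l = 0"
      using integral_nonneg_eq_0_iff_AE[OF integrable_wt[of \<tau> y]] wt_nonneg by (simp add: wt_total_def)
    then have "AE l in half_cauchy. False"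
      by eventually_elim (metis wt_pos less_irrefl)
    then show False
      by (simp add: half_cauchy.AE_False)
  qed
  moreover have "0 \<le> wt_total \<tau> y"
    unfolding wt_total_def using wt_nonneg by (intro integral_nonneg_AE) auto
  ultimately show ?thesis by simp
qed

lemma sets_mixing [measurable_cong, simp]: "sets (mixing \<tau> y) = sets borel"
  and space_mixing [simp]: "space (mixing \<tau> y) = UNIV"
  by (simp_all add: mixing_def)

lemma prob_space_mixing: "prob_space (mixing \<tau> y)"
proof
  have "integrable half_cauchy (\<lambda>l. wt \<tau> y l / wt_total \<tau> y)"
    using integrable_wt by simp
  then have "(\<integral>\<^sup>+ l. ennreal (wt \<tau> y l / wt_total \<tau> y) \<partial>half_cauchy)
      = ennreal (\<integral>l. wt \<tau> y l / wt_total \<tau> y \<partial>half_cauchy)"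
    using wt_nonneg wt_total_pos[of \<tau> y]
    by (intro nn_integral_eq_integral) (auto intro!: divide_nonneg_pos)
  also have "\<dots> = 1"
    using wt_total_pos[of \<tau> y] by (simp add: wt_total_def[symmetric])
  finally show "emeasure (mixing \<tau> y) (space (mixing \<tau> y)) = 1"
    unfolding mixing_def by (subst emeasure_density) auto
qed

lemma integral_mixing:
  assumes [measurable]: "g \<in> borel_measurable borel"
  shows "(\<integral>l. g l \<partial>mixing \<tau> y) = (\<integral>l. wt \<tau> y l * g l \<partial>half_cauchy) / wt_total \<tau> y"
  unfolding mixing_def
  by (subst integral_density) (auto simp: wt_nonneg wt_total_pos less_imp_le)

lemma measure_mixing:
  assumes [measurable]: "A \<in> sets borel"
  shows "measure (mixing \<tau> y) A = (\<integral>l. wt \<tau> y l * indicator A l \<partial>half_cauchy) / wt_total \<tau> y"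
  using integral_mixing[of "indicator A" \<tau> y] by simp

lemma AE_mixing_pos: "AE l in mixing \<tau> y. 0 < l"
  unfolding mixing_def using AE_half_cauchy_pos by (subst AE_density) auto

section \<open>Conjugacy: from the horseshoe prior to a mixture of normal laws\<close>

lemma sets_normal [measurable_cong, simp]: "sets (normal \<mu> \<sigma>) = sets borel"
  and space_normal [simp]: "space (normal \<mu> \<sigma>) = UNIV"
  by (simp_all add: normal_def)

lemma prob_space_normal: "0 < \<sigma> \<Longrightarrow> prob_space (normal \<mu> \<sigma>)"
  unfolding normal_def by (rule prob_space_normal_density)

interpretation std_normal: prob_space "normal 0 1"
  by (rule prob_space_normal) simp

lemma emeasure_normal:
  "A \<in> sets borel \<Longrightarrow>
    emeasure (normal \<mu> \<sigma>) A = (\<integral>\<^sup>+ x. ennreal (normal_density \<mu> \<sigma> x) * indicator A x \<partial>lborel)"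
  unfolding normal_def by (rule emeasure_density) auto

lemma normal_affine:
  assumes "0 < \<sigma>"
  shows "distr (normal 0 1) borel (\<lambda>z. \<mu> + \<sigma> * z) = normal \<mu> \<sigma>"
proof -
  have "distributed (normal 0 1) lborel (\<lambda>x. x) (normal_density 0 1)"
    unfolding distributed_def normal_def by (auto simp: distr_id2)
  from std_normal.normal_density_affine[OF this, of \<sigma> \<mu>] assms
  have "distr (normal 0 1) lborel (\<lambda>z. \<mu> + \<sigma> * z) = density lborel (normal_density \<mu> \<sigma>)"
    by (simp add: distributed_def)
  moreover have "distr (normal 0 1) borel (\<lambda>z. \<mu> + \<sigma> * z) = distr (normal 0 1) lborel (\<lambda>z. \<mu> + \<sigma> * z)"
    by (rule distr_cong) auto
  ultimately show ?thesis
    by (simp add: normal_def)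
qed

lemma normal_density_measurable_scale [measurable]:
  "(\<lambda>p. normal_density 0 (fst p * \<tau>) (snd p)) \<in> borel_measurable (borel \<Otimes>\<^sub>M borel)"
  unfolding normal_density_def by measurable

lemma normal_kernel: "(\<lambda>l. normal 0 (l * \<tau>)) \<in> half_cauchy \<rightarrow>\<^sub>M subprob_algebra borel"
proof (rule measurable_subprob_algebra)
  fix l :: real
  show "subprob_space (normal 0 (l * \<tau>))"
  \<comment> \<open>The kernel must make sense on the whole line, although the half-Cauchy law
    charges only positive scales. At scale 0 the density is 0, since division by zero gives 0, so
    the kernel is the null measure there and only a subprobability. The density depends on the
    square of the scale, so negative scales are harmless.\<close>
  proof (cases "l * \<tau> = 0")
    case True
    then have "normal 0 (l * \<tau>) = null_measure lborel"
      by (intro measure_eqI) (auto simp: normal_def emeasure_density normal_density_def)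
    then show ?thesis by (auto intro: subprob_spaceI)
  next
    case False
    then have "normal 0 (l * \<tau>) = normal 0 \<bar>l * \<tau>\<bar>"
      by (simp add: normal_def normal_density_def)
    then show ?thesis
      using prob_space_normal[of "\<bar>l * \<tau>\<bar>" 0] False by (simp add: prob_space_imp_subprob_space)
  qed
next
  fix A :: "real set" assume [measurable]: "A \<in> sets borel"
  have "(\<lambda>l. \<integral>\<^sup>+ x. ennreal (normal_density 0 (fst (l, x) * \<tau>) (snd (l, x))) * indicator A x \<partial>lborel)
      \<in> borel_measurable borel"
    by measurable
  then show "(\<lambda>l. emeasure (normal 0 (l * \<tau>)) A) \<in> borel_measurable half_cauchy"
    by (subst emeasure_normal) (auto cong: measurable_cong_sets)
qed simp

lemma sets_horseshoe [measurable_cong, simp]: "sets (horseshoe \<tau>) = sets borel"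
  and space_horseshoe [simp]: "space (horseshoe \<tau>) = UNIV"
proof -
  show *: "sets (horseshoe \<tau>) = sets borel"
    unfolding horseshoe_def using normal_kernel[of \<tau>] by (subst sets_bind[where N=borel]) auto
  show "space (horseshoe \<tau>) = UNIV"
    using sets_eq_imp_space_eq[OF *] by simp
qed

lemma nn_integral_horseshoe:
  assumes [measurable]: "g \<in> borel_measurable borel"
  shows "(\<integral>\<^sup>+ \<theta>. g \<theta> \<partial>horseshoe \<tau>)
    = (\<integral>\<^sup>+ l. \<integral>\<^sup>+ \<theta>. ennreal (normal_density 0 (l * \<tau>) \<theta>) * g \<theta> \<partial>lborel \<partial>half_cauchy)"
  unfolding horseshoe_def
  by (subst nn_integral_bind[OF assms normal_kernel]) (simp add: normal_def nn_integral_density)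

text \<open>Completing the square in \<theta>: precisions add,
  \<open>1 / k = 1 / s\<^sup>2 + 1\<close>, and the part free of \<theta> is the standard normal
  density at \<open>y\<close> times \<open>wt\<close> for \<open>s = l * \<tau>\<close>.\<close>

lemma normal_conjugate:
  assumes "0 < s"
  defines "k \<equiv> s\<^sup>2 / (1 + s\<^sup>2)"
  shows "normal_density 0 s \<theta> * normal_density \<theta> 1 y
    = std_normal_density y * (exp (y\<^sup>2 / 2 * k) / sqrt (1 + s\<^sup>2)) * normal_density (k * y) (sqrt k) \<theta>"
proof -
  have k: "0 < k" using assms by (simp add: k_def)
  have ks: "k * (1 + s\<^sup>2) = s\<^sup>2" by (simp add: k_def less_imp_neq[THEN not_sym])
  have e: "- (\<theta>\<^sup>2 / (2 * s\<^sup>2)) - (y - \<theta>)\<^sup>2 / 2 = - y\<^sup>2 / 2 + y\<^sup>2 / 2 * k - (\<theta> - k * y)\<^sup>2 / (2 * k)"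
  proof -
    have inv: "1 / s\<^sup>2 = 1 / k - 1"
      using k assms ks by (simp add: field_simps)
    have "(\<theta> - k * y)\<^sup>2 / (2 * k) = \<theta>\<^sup>2 / 2 * (1 / k) - \<theta> * y + y\<^sup>2 / 2 * k"
      using k by (simp add: field_simps power2_eq_square)
    moreover have "\<theta>\<^sup>2 / (2 * s\<^sup>2) = \<theta>\<^sup>2 / 2 * (1 / k - 1)"
      unfolding inv[symmetric] by simp
    ultimately show ?thesis
      by (simp add: power2_eq_square algebra_simps add_divide_distrib diff_divide_distrib)
  qed
  have "sqrt (2 * pi * s\<^sup>2) = sqrt (2 * pi * k) * sqrt (1 + s\<^sup>2)"
    by (subst real_sqrt_mult[symmetric]) (simp add: ks mult.assoc)
  then have p: "1 / sqrt (2 * pi * s\<^sup>2) * (1 / sqrt (2 * pi))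
      = 1 / sqrt (2 * pi) * (1 / sqrt (1 + s\<^sup>2)) * (1 / sqrt (2 * pi * k))"
    by simp
  have "normal_density 0 s \<theta> * normal_density \<theta> 1 y
      = 1 / sqrt (2 * pi * s\<^sup>2) * (1 / sqrt (2 * pi)) * exp (- (\<theta>\<^sup>2 / (2 * s\<^sup>2)) - (y - \<theta>)\<^sup>2 / 2)"
  proof -
    have "normal_density 0 s \<theta> = 1 / sqrt (2 * pi * s\<^sup>2) * exp (- (\<theta>\<^sup>2 / (2 * s\<^sup>2)))"
      and "normal_density \<theta> 1 y = 1 / sqrt (2 * pi) * exp (- ((y - \<theta>)\<^sup>2 / 2))"
      by (simp_all add: normal_density_def)
    moreover have "exp (- (\<theta>\<^sup>2 / (2 * s\<^sup>2))) * exp (- ((y - \<theta>)\<^sup>2 / 2))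
        = exp (- (\<theta>\<^sup>2 / (2 * s\<^sup>2)) - (y - \<theta>)\<^sup>2 / 2)"
      by (simp only: exp_add[symmetric] diff_conv_add_uminus)
    ultimately show ?thesis
      by (simp only: mult_ac)
  qed
  also have "\<dots> = 1 / sqrt (2 * pi) * (1 / sqrt (1 + s\<^sup>2)) * (1 / sqrt (2 * pi * k)) *
      (exp (- y\<^sup>2 / 2) * exp (y\<^sup>2 / 2 * k) * exp (- ((\<theta> - k * y)\<^sup>2 / (2 * k))))"
    unfolding p e by (simp add: exp_add[symmetric] exp_diff[symmetric])
  also have "\<dots> = std_normal_density y * (exp (y\<^sup>2 / 2 * k) / sqrt (1 + s\<^sup>2)) *
      normal_density (k * y) (sqrt k) \<theta>"
    using k by (simp add: normal_density_def mult_ac)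
  finally show ?thesis .
qed

lemma evidence_eq:
  assumes "0 < \<tau>"
  shows "evidence \<tau> y = ennreal (std_normal_density y * wt_total \<tau> y)"
proof -
  have "evidence \<tau> y = (\<integral>\<^sup>+ l. \<integral>\<^sup>+ \<theta>. ennreal (normal_density 0 (l * \<tau>) \<theta>) *
      ennreal (normal_density \<theta> 1 y) \<partial>lborel \<partial>half_cauchy)"
    unfolding evidence_def by (rule nn_integral_horseshoe) (simp add: normal_density_def[abs_def])
  also have "\<dots> = (\<integral>\<^sup>+ l. ennreal (std_normal_density y * wt \<tau> y l) \<partial>half_cauchy)"
    using AE_half_cauchy_pos
  proof (intro nn_integral_cong_AE, eventually_elim)
    case (elim l)
    have "(\<integral>\<^sup>+ \<theta>. ennreal (normal_density 0 (l * \<tau>) \<theta>) * ennreal (normal_density \<theta> 1 y) \<partial>lborel)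
       = (\<integral>\<^sup>+ \<theta>. ennreal (std_normal_density y * wt \<tau> y l) *
          ennreal (normal_density (shrink \<tau> l * y) (sqrt (shrink \<tau> l)) \<theta>) \<partial>lborel)"
      using normal_conjugate[of "l * \<tau>" _ y] elim assms
      by (intro nn_integral_cong)
        (simp add: ennreal_mult[symmetric] wt_def shrink_def)
    also have "\<dots> = ennreal (std_normal_density y * wt \<tau> y l) *
        emeasure (normal (shrink \<tau> l * y) (sqrt (shrink \<tau> l))) UNIV"
      by (subst nn_integral_cmult) (auto simp: emeasure_normal)
    also have "\<dots> = ennreal (std_normal_density y * wt \<tau> y l)"
      using prob_space.emeasure_space_1[OF prob_space_normal[of "sqrt (shrink \<tau> l)"]] shrink_pos[of l \<tau>] elim assms
      by simp
    finally show ?case .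
  qed
  also have "\<dots> = ennreal (\<integral>l. std_normal_density y * wt \<tau> y l \<partial>half_cauchy)"
    using integrable_wt wt_nonneg by (intro nn_integral_eq_integral) auto
  finally show ?thesis by (simp add: wt_total_def)
qed

lemma sets_posterior [measurable_cong, simp]: "sets (posterior \<tau> y) = sets borel"
  and space_posterior [simp]: "space (posterior \<tau> y) = UNIV"
  by (simp_all add: posterior_def)

lemma emeasure_posterior:
  assumes "0 < \<tau>" and A [measurable]: "A \<in> sets borel"
  shows "emeasure (posterior \<tau> y) A
    = (\<integral>\<^sup>+ l. emeasure (normal (shrink \<tau> l * y) (sqrt (shrink \<tau> l))) A \<partial>mixing \<tau> y)"
proof -
  define C where "C = std_normal_density y * wt_total \<tau> y"
  have C: "0 < C" by (simp add: C_def wt_total_pos normal_density_pos)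
  have "(\<lambda>\<theta>. normal_density \<theta> 1 y) \<in> borel_measurable borel"
    by (simp add: normal_density_def[abs_def])
  note [measurable] = this
  have [measurable]: "(\<lambda>l. \<integral>\<^sup>+ \<theta>. ennreal (normal_density (shrink \<tau> l * y) (sqrt (shrink \<tau> l)) \<theta>) * indicator A \<theta> \<partial>lborel)
      \<in> borel_measurable borel"
    unfolding normal_density_def by measurable
  have "emeasure (posterior \<tau> y) A
      = (\<integral>\<^sup>+ \<theta>. ennreal (normal_density \<theta> 1 y) / ennreal C * indicator A \<theta> \<partial>horseshoe \<tau>)"
    unfolding posterior_def evidence_eq[OF assms(1)] C_def by (rule emeasure_density) measurable
  also have "\<dots> = (\<integral>\<^sup>+ l. \<integral>\<^sup>+ \<theta>. ennreal (normal_density 0 (l * \<tau>) \<theta>) *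
      (ennreal (normal_density \<theta> 1 y) / ennreal C * indicator A \<theta>) \<partial>lborel \<partial>half_cauchy)"
    by (rule nn_integral_horseshoe) measurable
  also have "\<dots> = (\<integral>\<^sup>+ l. ennreal (wt \<tau> y l / wt_total \<tau> y) *
      emeasure (normal (shrink \<tau> l * y) (sqrt (shrink \<tau> l))) A \<partial>half_cauchy)"
    using AE_half_cauchy_pos
  proof (intro nn_integral_cong_AE, eventually_elim)
    case (elim l)
    \<comment> \<open>The standard normal density at \<open>y\<close> occurs both in
      \<open>C\<close> and in \<open>normal_conjugate\<close> and cancels.\<close>
    have *: "normal_density 0 (l * \<tau>) \<theta> * normal_density \<theta> 1 y / C
       = wt \<tau> y l * normal_density (shrink \<tau> l * y) (sqrt (shrink \<tau> l)) \<theta> / wt_total \<tau> y" for \<theta>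
    proof -
      have "normal_density 0 (l * \<tau>) \<theta> * normal_density \<theta> 1 y
         = std_normal_density y * wt \<tau> y l * normal_density (shrink \<tau> l * y) (sqrt (shrink \<tau> l)) \<theta>"
        using normal_conjugate[of "l * \<tau>" \<theta> y] elim assms unfolding wt_def shrink_def by simp
      moreover have "std_normal_density y \<noteq> 0"
        using normal_density_pos[of 1 0 y] by simp
      ultimately show ?thesis
        by (simp add: C_def)
    qed
    have "(\<integral>\<^sup>+ \<theta>. ennreal (normal_density 0 (l * \<tau>) \<theta>) *
        (ennreal (normal_density \<theta> 1 y) / ennreal C * indicator A \<theta>) \<partial>lborel)
       = (\<integral>\<^sup>+ \<theta>. ennreal (wt \<tau> y l / wt_total \<tau> y) *
          (ennreal (normal_density (shrink \<tau> l * y) (sqrt (shrink \<tau> l)) \<theta>) * indicator A \<theta>) \<partial>lborel)"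
      using C wt_nonneg[of \<tau> y l] wt_total_pos[of \<tau> y]
      by (intro nn_integral_cong)
        (simp add: mult.assoc[symmetric] divide_ennreal ennreal_mult[symmetric] *)
    also have "\<dots> = ennreal (wt \<tau> y l / wt_total \<tau> y) *
        emeasure (normal (shrink \<tau> l * y) (sqrt (shrink \<tau> l))) A"
      by (subst nn_integral_cmult) (auto simp: emeasure_normal)
    finally show ?case .
  qed
  also have "\<dots> = (\<integral>\<^sup>+ l. emeasure (normal (shrink \<tau> l * y) (sqrt (shrink \<tau> l))) A \<partial>mixing \<tau> y)"
    unfolding mixing_def by (subst nn_integral_density) (simp_all add: emeasure_normal)
  finally show ?thesis .
qed

text \<open>Conditionally on the local scale the posterior is normal, so it is the image of the
  posterior of the local scale and an independent standard normal variable.\<close>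

lemma posterior_eq_distr:
  assumes "0 < \<tau>"
  shows "posterior \<tau> y = distr (mixing \<tau> y \<Otimes>\<^sub>M normal 0 1) borel
    (\<lambda>p. shrink \<tau> (fst p) * y + sqrt (shrink \<tau> (fst p)) * snd p)" (is "_ = distr ?P borel ?T")
proof (rule measure_eqI)
  fix A assume "A \<in> sets (posterior \<tau> y)"
  then have [measurable]: "A \<in> sets borel" by simp
  interpret M: prob_space "mixing \<tau> y" by (rule prob_space_mixing)
  interpret P: pair_prob_space "mixing \<tau> y" "normal 0 1" ..
  have [measurable]: "?T \<in> borel_measurable ?P"
    by measurable
  have "emeasure (distr ?P borel ?T) A = emeasure ?P (?T -` A \<inter> space ?P)"
    by (rule emeasure_distr) measurable
  also have "\<dots> = (\<integral>\<^sup>+ l. emeasure (normal 0 1) (Pair l -` (?T -` A \<inter> space ?P)) \<partial>mixing \<tau> y)"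
    by (rule std_normal.emeasure_pair_measure_alt) measurable
  also have "\<dots> = (\<integral>\<^sup>+ l. emeasure (normal (shrink \<tau> l * y) (sqrt (shrink \<tau> l))) A \<partial>mixing \<tau> y)"
    using AE_mixing_pos
  proof (intro nn_integral_cong_AE, eventually_elim)
    case (elim l)
    have "normal (shrink \<tau> l * y) (sqrt (shrink \<tau> l))
        = distr (normal 0 1) borel (\<lambda>z. shrink \<tau> l * y + sqrt (shrink \<tau> l) * z)"
      using shrink_pos[of l \<tau>] elim assms by (intro normal_affine[symmetric]) simp
    then have "emeasure (normal (shrink \<tau> l * y) (sqrt (shrink \<tau> l))) A
        = emeasure (normal 0 1) ((\<lambda>z. shrink \<tau> l * y + sqrt (shrink \<tau> l) * z) -` A \<inter> space (normal 0 1))"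
      by (simp only:) (rule emeasure_distr, measurable)
    then show ?case
      by (simp add: vimage_def space_pair_measure)
  qed
  also have "\<dots> = emeasure (posterior \<tau> y) A"
    using assms by (simp add: emeasure_posterior)
  finally show "emeasure (posterior \<tau> y) A = emeasure (distr ?P borel ?T) A" ..
qed simp

section \<open>The standard normal distribution\<close>

lemma normal_reflect: "distr (normal 0 1) borel uminus = normal 0 1"
proof -
  have "distributed (normal 0 1) lborel (\<lambda>x. x) (normal_density 0 1)"
    unfolding distributed_def normal_def by (auto simp: distr_id2)
  from std_normal.normal_density_affine[OF this, of "-1" 0]
  have "distr (normal 0 1) lborel uminus = density lborel (normal_density 0 1)"
    by (simp add: distributed_def)
  moreover have "distr (normal 0 1) borel uminus = distr (normal 0 1) lborel uminus"
    by (rule distr_cong) auto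
  ultimately show ?thesis
    by (simp add: normal_def)
qed

lemma normal_singleton: "emeasure (normal \<mu> \<sigma>) {x} = 0"
proof -
  have "(\<integral>\<^sup>+ z. ennreal (normal_density \<mu> \<sigma> z) * indicator {x} z \<partial>lborel) = (\<integral>\<^sup>+ (z::real). 0 \<partial>lborel)"
    using AE_lborel_singleton[of x] by (intro nn_integral_cong_AE, eventually_elim) auto
  then show ?thesis
    by (simp add: emeasure_normal)
qed

lemma normal_interval_pos:
  assumes "0 < \<sigma>" "a < b"
  shows "0 < emeasure (normal \<mu> \<sigma>) {a<..<b}"
proof (rule ccontr)
  assume "\<not> 0 < emeasure (normal \<mu> \<sigma>) {a<..<b}"
  then have "(\<integral>\<^sup>+ x. ennreal (normal_density \<mu> \<sigma> x) * indicator {a<..<b} x \<partial>lborel) = 0"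
    by (simp add: emeasure_normal)
  then have "AE x in lborel. ennreal (normal_density \<mu> \<sigma> x) * indicator {a<..<b} x = 0"
    by (subst (asm) nn_integral_0_iff_AE) auto
  then have "AE x in lborel. x \<notin> {a<..<b}"
  proof eventually_elim
    case (elim x)
    then show ?case
      using normal_density_pos[OF assms(1), of \<mu> x] by (auto simp: indicator_def ennreal_eq_0_iff split: if_splits)
  qed
  then have "emeasure lborel {a<..<b} = 0"
    by (subst (asm) AE_iff_measurable[of "{a<..<b}"]) auto
  then show False
    using assms by simp
qed

definition upper_tail :: "real \<Rightarrow> real" where
  "upper_tail x = measure (normal 0 1) {x<..}"

lemma upper_tail_strict_anti:
  assumes "x < x'"
  shows "upper_tail x' < upper_tail x"
proof -
  have "upper_tail x' + measure (normal 0 1) {x<..x'} = upper_tail x"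
    unfolding upper_tail_def using assms
    by (subst std_normal.finite_measure_Union[symmetric]) (auto intro!: arg_cong[where f = "measure (normal 0 1)"])
  moreover have "0 < measure (normal 0 1) {x<..<x'}"
    using normal_interval_pos[of 1 x x' 0] assms by (simp add: std_normal.emeasure_eq_measure)
  moreover have "measure (normal 0 1) {x<..<x'} \<le> measure (normal 0 1) {x<..x'}"
    by (intro std_normal.finite_measure_mono) auto
  ultimately show ?thesis by simp
qed

lemma upper_tail_less_iff: "upper_tail x < upper_tail x' \<longleftrightarrow> x' < x"
  by (metis upper_tail_strict_anti less_asym linorder_neqE_linordered_idom less_irrefl)

lemma upper_tail_anti: "x \<le> x' \<Longrightarrow> upper_tail x' \<le> upper_tail x"
  using upper_tail_less_iff[of x x'] by (simp add: not_le[symmetric])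

lemma normal_lower_tail: "measure (normal 0 1) {..<- x} = upper_tail x"
proof -
  have "measure (normal 0 1) {x<..} = measure (distr (normal 0 1) borel uminus) {x<..}"
    by (simp add: normal_reflect)
  also have "\<dots> = measure (normal 0 1) (uminus -` {x<..} \<inter> space (normal 0 1))"
    by (rule measure_distr) auto
  also have "uminus -` {x<..} \<inter> space (normal 0 1) = {..<- x}" by auto
  finally show ?thesis by (simp add: upper_tail_def)
qed

lemma normal_two_sided:
  assumes "0 \<le> x"
  shows "measure (normal 0 1) {z. \<bar>z\<bar> > x} = 2 * upper_tail x"
    and "measure (normal 0 1) {z. \<bar>z\<bar> \<le> x} = 1 - 2 * upper_tail x"
proof -
  have "{z::real. \<bar>z\<bar> > x} = {..<- x} \<union> {x<..}" using assms by auto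
  then show *: "measure (normal 0 1) {z. \<bar>z\<bar> > x} = 2 * upper_tail x"
    using assms
    by (simp add: std_normal.finite_measure_Union normal_lower_tail upper_tail_def[symmetric] disjoint_iff)
  have "{z. \<bar>z\<bar> \<le> x} = space (normal 0 1) - {z. \<bar>z\<bar> > x}" by auto
  then show "measure (normal 0 1) {z. \<bar>z\<bar> \<le> x} = 1 - 2 * upper_tail x"
    using * std_normal.prob_compl[of "{z. \<bar>z\<bar> > x}"] by simp
qed

lemma upper_tail_0: "upper_tail 0 = 1 / 2"
proof -
  have "measure (normal 0 1) {z. \<bar>z\<bar> \<le> 0} = measure (normal 0 1) {0}"
    by (rule arg_cong[where f = "measure (normal 0 1)"]) auto
  also have "\<dots> = 0" by (simp add: measure_def normal_singleton)
  finally show ?thesis using normal_two_sided(2)[of 0] by simp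
qed

text \<open>On the tail \<open>z / x\<close> is at least 1, and
  \<open>z * std_normal_density z\<close> integrates in closed form. Bounding
  \<open>1 / sqrt (2 * pi)\<close> by one half pays for the second side.\<close>

lemma mills:
  assumes "0 < x"
  shows "2 * upper_tail x \<le> exp (- x\<^sup>2 / 2) / x"
proof -
  have lim: "((\<lambda>z. - std_normal_density z / x) \<longlongrightarrow> 0) at_top"
    using assms unfolding std_normal_density_def by real_asymp
  have "emeasure (normal 0 1) {x<..} = (\<integral>\<^sup>+ z. ennreal (std_normal_density z) * indicator {x<..} z \<partial>lborel)"
    by (simp add: emeasure_normal)
  also have "\<dots> \<le> (\<integral>\<^sup>+ z. ennreal (z * std_normal_density z / x) * indicator {x..} z \<partial>lborel)"
  proof (rule nn_integral_mono)
    fix z :: real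
    have "std_normal_density z \<le> z * std_normal_density z / x" if "x < z"
      using that assms by (simp add: pos_le_divide_eq mult.commute mult_right_mono)
    then show "ennreal (std_normal_density z) * indicator {x<..} z
        \<le> ennreal (z * std_normal_density z / x) * indicator {x..} z"
      by (auto simp: indicator_def intro: ennreal_leI)
  qed
  also have "\<dots> = ennreal (0 - (- std_normal_density x / x))"
  proof (rule nn_integral_FTC_atLeast[OF _ _ _ lim])
    fix z :: real assume "x \<le> z"
    then show "0 \<le> z * std_normal_density z / x"
      using assms by simp
    show "((\<lambda>z. - std_normal_density z / x) has_real_derivative z * std_normal_density z / x) (at z)"
      unfolding std_normal_density_def using assms
      by (auto intro!: derivative_eq_intros simp: power2_eq_square)
  qed measurable
  finally have "upper_tail x \<le> std_normal_density x / x"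
    using assms by (simp add: upper_tail_def std_normal.emeasure_eq_measure)
  also have "\<dots> \<le> (1 / 2) * exp (- x\<^sup>2 / 2) / x"
  proof -
    have "sqrt 4 \<le> sqrt (2 * pi)"
      using pi_ge_two by (intro real_sqrt_le_mono) simp
    then have "1 / sqrt (2 * pi) \<le> 1 / 2"
      by (intro divide_left_mono) auto
    then show ?thesis
      unfolding std_normal_density_def using assms by (intro divide_right_mono mult_right_mono) auto
  qed
  finally show ?thesis by simp
qed

text \<open>Reflecting \<open>z\<close> to \<open>a - z\<close> exchanges the two intervals; after averaging both sides with
  their reflections the comparison holds pointwise.\<close>

lemma normal_centered_interval_largest:
  "measure (normal 0 1) {z. \<bar>z - a\<bar> \<le> t} \<le> measure (normal 0 1) {z. \<bar>z\<bar> \<le> t}"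
proof -
  define I J where "I = {z::real. \<bar>z\<bar> \<le> t}" and "J = {z::real. \<bar>z - a\<bar> \<le> t}"
  have [measurable]: "I \<in> sets borel" "J \<in> sets borel"
    by (auto simp: I_def J_def)
  have refl: "(\<integral>\<^sup>+ z. ennreal (std_normal_density z) * indicator A z \<partial>lborel)
     = (\<integral>\<^sup>+ z. ennreal (std_normal_density (a - z)) * indicator A (a - z) \<partial>lborel)"
    if [measurable]: "A \<in> sets borel" for A
    using nn_integral_real_affine[of "\<lambda>z. ennreal (std_normal_density z) * indicator A z" "-1" a] by simp
  have e: "emeasure (normal 0 1) A + emeasure (normal 0 1) A
     = (\<integral>\<^sup>+ z. ennreal (std_normal_density z) * indicator A z
            + ennreal (std_normal_density (a - z)) * indicator A (a - z) \<partial>lborel)"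
    if [measurable]: "A \<in> sets borel" for A
    by (subst nn_integral_add) (auto simp: emeasure_normal refl[symmetric])
  have swap: "indicator I (a - z) = (indicator J z :: ennreal)" "indicator J (a - z) = (indicator I z :: ennreal)" for z
    by (auto simp: I_def J_def indicator_def)
  have phi: "std_normal_density u \<le> std_normal_density v" if "\<bar>v\<bar> \<le> \<bar>u\<bar>" for u v
    using that unfolding std_normal_density_def
    by (intro mult_left_mono) (auto simp: abs_le_square_iff)
  have "emeasure (normal 0 1) J + emeasure (normal 0 1) J \<le> emeasure (normal 0 1) I + emeasure (normal 0 1) I"
    unfolding e[OF \<open>I \<in> sets borel\<close>] e[OF \<open>J \<in> sets borel\<close>] swap
  proof (rule nn_integral_mono)
    fix z
    show "ennreal (std_normal_density z) * indicator J z + ennreal (std_normal_density (a - z)) * indicator I z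
      \<le> ennreal (std_normal_density z) * indicator I z + ennreal (std_normal_density (a - z)) * indicator J z"
    proof (cases "z \<in> I \<longleftrightarrow> z \<in> J")
      case False
      then show ?thesis
        using phi[of z "a - z"] phi[of "a - z" z]
        by (auto simp: I_def J_def indicator_def intro!: ennreal_leI)
    qed (auto simp: indicator_def add.commute)
  qed
  then show ?thesis
    by (simp add: std_normal.emeasure_eq_measure I_def J_def ennreal_plus[symmetric] del: ennreal_plus)
qed

text \<open>In the application \<open>d\<close> is the gap between the mean of a mixture component
  and the posterior mean. It is not controlled; recentring gives a bound free of it.\<close>

lemma normal_affine_interval_le:
  assumes "0 < s" "0 \<le> x"
  shows "measure (normal 0 1) {z. \<bar>d + s * z\<bar> \<le> x} \<le> 1 - 2 * upper_tail (x / s)"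
proof -
  have "\<bar>d + s * z\<bar> \<le> x \<longleftrightarrow> \<bar>z - (- d / s)\<bar> \<le> x / s" for z
  proof -
    have "d + s * z = s * (z - (- d / s))" using assms by (simp add: field_simps)
    then have "\<bar>d + s * z\<bar> = s * \<bar>z - (- d / s)\<bar>" using assms by (simp add: abs_mult)
    then show ?thesis using assms by (simp add: pos_le_divide_eq mult.commute)
  qed
  then show ?thesis
    using normal_centered_interval_largest[of "- d / s" "x / s"] normal_two_sided(2)[of "x / s"] assms
    by simp
qed

lemma std_normal_moments:
  shows "integrable (normal 0 1) (\<lambda>z. z)" and "(\<integral>z. z \<partial>normal 0 1) = 0"
    and "integrable (normal 0 1) (\<lambda>z. z\<^sup>2)" and "(\<integral>z. z\<^sup>2 \<partial>normal 0 1) = 1"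
  using integrable_std_normal_moment[of 1] integral_std_normal_moment_odd[of 0]
    integrable_std_normal_moment[of 2] integral_std_normal_moment_even[of 1]
  unfolding normal_def
  by (simp_all add: integrable_density integral_density)

lemma isCont_cdf_std_normal: "isCont (cdf (normal 0 1)) x"
proof -
  interpret real_distribution "normal 0 1" by standard auto
  show ?thesis by (simp add: isCont_cdf measure_def normal_singleton)
qed

lemma upper_tail_cdf: "upper_tail x = 1 - cdf (normal 0 1) x"
proof -
  have "{x<..} = space (normal 0 1) - {..x}" by auto
  then show ?thesis
    using std_normal.prob_compl[of "{..x}"] by (simp add: upper_tail_def cdf_def)
qed

text \<open>The description in \<open>z_upper\<close> denotes: continuity of the distribution
  function gives existence by the intermediate value theorem, strict decrease of the tail gives
  uniqueness.\<close>

lemma upper_tail_z_upper: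
  assumes "0 < \<alpha>" "\<alpha> < 1"
  shows "upper_tail (z_upper \<alpha>) = \<alpha>"
proof -
  interpret D: real_distribution "normal 0 1" by standard auto
  have "eventually (\<lambda>x. cdf (normal 0 1) x > 1 - \<alpha>) at_top"
    using assms by (intro order_tendstoD(1)[OF D.cdf_lim_at_top_prob]) simp
  then obtain b0 where b0: "\<And>x. x \<ge> b0 \<Longrightarrow> cdf (normal 0 1) x > 1 - \<alpha>"
    by (auto simp: eventually_at_top_linorder)
  have "eventually (\<lambda>x. cdf (normal 0 1) x < 1 - \<alpha>) at_bot"
    using assms by (intro order_tendstoD(2)[OF D.cdf_lim_at_bot]) simp
  then obtain a0 where a0: "\<And>x. x \<le> a0 \<Longrightarrow> cdf (normal 0 1) x < 1 - \<alpha>"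
    by (auto simp: eventually_at_bot_linorder)
  have "\<exists>x\<ge>min a0 b0. x \<le> max a0 b0 \<and> cdf (normal 0 1) x = 1 - \<alpha>"
    using a0[of "min a0 b0"] b0[of "max a0 b0"] isCont_cdf_std_normal by (intro IVT) auto
  then obtain x where "cdf (normal 0 1) x = 1 - \<alpha>"
    by blast
  then have x: "upper_tail x = \<alpha>"
    by (simp add: upper_tail_cdf)
  then have "y = x" if "upper_tail y = \<alpha>" for y
    using that upper_tail_strict_anti[of x y] upper_tail_strict_anti[of y x]
    by (cases x y rule: linorder_cases) auto
  with x have "(THE z. upper_tail z = \<alpha>) = x"
    by (rule the_equality)
  then show ?thesis
    using x by (simp add: z_upper_def upper_tail_def)
qed

lemma z_upper_half: "z_upper (1 / 2) = 0"
  using upper_tail_z_upper[of "1 / 2"] upper_tail_0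
    upper_tail_less_iff[of 0 "z_upper (1 / 2)"] upper_tail_less_iff[of "z_upper (1 / 2)" 0] by simp

lemma z_upper_pos: "0 < \<alpha> \<Longrightarrow> \<alpha> < 1 / 2 \<Longrightarrow> 0 < z_upper \<alpha>"
  using upper_tail_z_upper[of \<alpha>] upper_tail_0 upper_tail_less_iff[of "z_upper \<alpha>" 0] by simp

section \<open>Posterior mean and radius\<close>

lemma measurable_normal_section:
  assumes [measurable]: "A \<in> sets borel"
  shows "(\<lambda>l. measure (normal 0 1) {z. shrink \<tau> l * y + sqrt (shrink \<tau> l) * z \<in> A}) \<in> borel_measurable borel"
proof -
  have "(\<lambda>l. \<integral>z. indicat_real A (shrink \<tau> l * y + sqrt (shrink \<tau> l) * z) \<partial>normal 0 1) \<in> borel_measurable borel"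
    by (rule std_normal.borel_measurable_lebesgue_integral) measurable
  moreover have "(\<integral>z. indicat_real A (shrink \<tau> l * y + sqrt (shrink \<tau> l) * z) \<partial>normal 0 1)
      = measure (normal 0 1) {z. shrink \<tau> l * y + sqrt (shrink \<tau> l) * z \<in> A}" for l
  proof -
    have "(\<integral>z. indicat_real A (shrink \<tau> l * y + sqrt (shrink \<tau> l) * z) \<partial>normal 0 1)
      = (\<integral>z. indicator {z. shrink \<tau> l * y + sqrt (shrink \<tau> l) * z \<in> A} z \<partial>normal 0 1 :: real)"
      by (intro Bochner_Integration.integral_cong) (auto simp: indicator_def)
    then show ?thesis by simp
  qed
  ultimately show ?thesis by simp
qed

lemma measure_posterior:
  assumes "0 < \<tau>" and [measurable]: "A \<in> sets borel"
  shows "measure (posterior \<tau> y) A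
    = (\<integral>l. measure (normal 0 1) {z. shrink \<tau> l * y + sqrt (shrink \<tau> l) * z \<in> A} \<partial>mixing \<tau> y)"
proof -
  interpret M: prob_space "mixing \<tau> y" by (rule prob_space_mixing)
  let ?P = "mixing \<tau> y \<Otimes>\<^sub>M normal 0 1"
  let ?T = "\<lambda>p. shrink \<tau> (fst p) * y + sqrt (shrink \<tau> (fst p)) * snd p"
  let ?N = "\<lambda>l. measure (normal 0 1) {z. shrink \<tau> l * y + sqrt (shrink \<tau> l) * z \<in> A}"
  have meas: "?N \<in> borel_measurable (mixing \<tau> y)"
    using measurable_normal_section[OF assms(2)] by (simp cong: measurable_cong_sets)
  have [measurable]: "?T \<in> borel_measurable ?P"
    by measurable
  have "emeasure (posterior \<tau> y) A = emeasure ?P (?T -` A \<inter> space ?P)"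
    unfolding posterior_eq_distr[OF assms(1)] by (rule emeasure_distr) measurable
  also have "\<dots> = (\<integral>\<^sup>+ l. emeasure (normal 0 1) (Pair l -` (?T -` A \<inter> space ?P)) \<partial>mixing \<tau> y)"
    by (rule std_normal.emeasure_pair_measure_alt) measurable
  also have "\<dots> = (\<integral>\<^sup>+ l. ennreal (?N l) \<partial>mixing \<tau> y)"
    by (intro nn_integral_cong) (simp add: vimage_def space_pair_measure std_normal.emeasure_eq_measure)
  also have "\<dots> = ennreal (\<integral>l. ?N l \<partial>mixing \<tau> y)"
    using meas by (intro nn_integral_eq_integral M.integrable_const_bound[where B = 1]) auto
  finally show ?thesis
    by (simp add: measure_def integral_nonneg_AE)
qed

lemma prob_space_posterior: "0 < \<tau> \<Longrightarrow> prob_space (posterior \<tau> y)"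
proof -
  assume "0 < \<tau>"
  interpret M: prob_space "mixing \<tau> y" by (rule prob_space_mixing)
  interpret P: pair_prob_space "mixing \<tau> y" "normal 0 1" ..
  show ?thesis
    unfolding posterior_eq_distr[OF \<open>0 < \<tau>\<close>] by (rule P.prob_space_distr) measurable
qed

definition mean_shrink :: "real \<Rightarrow> real \<Rightarrow> real" where
  "mean_shrink \<tau> y = (\<integral>l. shrink \<tau> l \<partial>mixing \<tau> y)"

lemma integrable_shrink: "integrable (mixing \<tau> y) (shrink \<tau>)"
proof -
  interpret M: prob_space "mixing \<tau> y" by (rule prob_space_mixing)
  show ?thesis
    using shrink_nonneg[of \<tau>] shrink_less_1[of \<tau>]
    by (intro M.integrable_const_bound[where B = 1]) (auto intro: less_imp_le)
qed

lemma mean_shrink_nonneg: "0 \<le> mean_shrink \<tau> y"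
  unfolding mean_shrink_def using shrink_nonneg by (intro integral_nonneg_AE) auto

text \<open>Fubini in the representation by a scale and an independent standard normal variable,
  whose part averages to zero. Integrability comes from the bound
  \<open>\<bar>y\<bar> + \<bar>z\<bar>\<close>, as \<open>shrink\<close> is below 1.\<close>

lemma post_mean_eq:
  assumes "0 < \<tau>"
  shows "post_mean \<tau> y = mean_shrink \<tau> y * y"
proof -
  interpret M: prob_space "mixing \<tau> y" by (rule prob_space_mixing)
  interpret P: pair_prob_space "mixing \<tau> y" "normal 0 1" ..
  let ?P = "mixing \<tau> y \<Otimes>\<^sub>M normal 0 1"
  let ?T = "\<lambda>p. shrink \<tau> (fst p) * y + sqrt (shrink \<tau> (fst p)) * snd p"
  have [measurable]: "?T \<in> borel_measurable ?P"
    by measurable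
  have "integrable ?P snd"
    using integrable_abs[OF std_normal_moments(1)] std_normal_moments(1)
    by (intro P.Fubini_integrable) auto
  then have int: "integrable ?P ?T"
  proof (rule Bochner_Integration.integrable_bound[OF Bochner_Integration.integrable_add[OF P.integrable_const[of "\<bar>y\<bar>"] integrable_abs]])
    show "AE p in ?P. norm (?T p) \<le> norm (\<bar>y\<bar> + \<bar>snd p\<bar>)"
    proof (rule AE_I2)
      fix p
      have "\<bar>?T p\<bar> \<le> shrink \<tau> (fst p) * \<bar>y\<bar> + sqrt (shrink \<tau> (fst p)) * \<bar>snd p\<bar>"
        using shrink_nonneg[of \<tau> "fst p"]
        by (intro order_trans[OF abs_triangle_ineq]) (simp add: abs_mult)
      also have "\<dots> \<le> 1 * \<bar>y\<bar> + 1 * \<bar>snd p\<bar>"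
        using shrink_less_1[of \<tau> "fst p"] by (intro add_mono mult_right_mono) auto
      finally show "norm (?T p) \<le> norm (\<bar>y\<bar> + \<bar>snd p\<bar>)" by simp
    qed
  qed measurable
  have "post_mean \<tau> y = (\<integral>p. ?T p \<partial>?P)"
    unfolding post_mean_def posterior_eq_distr[OF assms] by (subst integral_distr) auto
  also have "\<dots> = (\<integral>l. \<integral>z. ?T (l, z) \<partial>normal 0 1 \<partial>mixing \<tau> y)"
    by (rule P.integral_fst'[OF int, symmetric])
  also have "\<dots> = (\<integral>l. shrink \<tau> l * y \<partial>mixing \<tau> y)"
    using std_normal_moments(1,2) by (intro Bochner_Integration.integral_cong) (simp_all add: std_normal.prob_space[simplified])
  also have "\<dots> = mean_shrink \<tau> y * y"
    by (simp add: mean_shrink_def)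
  finally show ?thesis .
qed

text \<open>Positive mass on intervals makes the central mass strictly increasing, and the absence
  of atoms shown next makes it continuous; together they make \<open>radius\<close> well
  defined.\<close>

lemma posterior_interval_pos:
  assumes "0 < \<tau>" "a < b"
  shows "0 < measure (posterior \<tau> y) {a<..<b}"
proof -
  interpret M: prob_space "mixing \<tau> y" by (rule prob_space_mixing)
  interpret Q: prob_space "posterior \<tau> y" by (rule prob_space_posterior[OF assms(1)])
  have [measurable]: "(\<lambda>l. emeasure (normal (shrink \<tau> l * y) (sqrt (shrink \<tau> l))) {a<..<b}) \<in> borel_measurable borel"
    unfolding emeasure_normal[OF borel_open[OF open_greaterThanLessThan]] normal_density_def by measurable
  have "emeasure (posterior \<tau> y) {a<..<b} \<noteq> 0"
  proof
    assume "emeasure (posterior \<tau> y) {a<..<b} = 0"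
    then have "AE l in mixing \<tau> y. emeasure (normal (shrink \<tau> l * y) (sqrt (shrink \<tau> l))) {a<..<b} = 0"
      using assms(1) by (subst (asm) emeasure_posterior) (auto simp: nn_integral_0_iff_AE)
    with AE_mixing_pos have "AE l in mixing \<tau> y. False"
    proof eventually_elim
      case (elim l)
      then show ?case
        using normal_interval_pos[of "sqrt (shrink \<tau> l)" a b "shrink \<tau> l * y"] shrink_pos[of l \<tau>] assms by simp
    qed
    then show False by (simp add: M.AE_False)
  qed
  then show ?thesis
    by (simp add: Q.emeasure_eq_measure zero_less_measure_iff)
qed

lemma posterior_singleton:
  assumes "0 < \<tau>"
  shows "measure (posterior \<tau> y) {x} = 0"
  using assms by (simp add: measure_def emeasure_posterior normal_singleton)

definition central_mass :: "real \<Rightarrow> real \<Rightarrow> real \<Rightarrow> real" where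
  "central_mass \<tau> y r = measure (posterior \<tau> y) {\<theta>. \<bar>\<theta> - post_mean \<tau> y\<bar> \<le> r}"

lemma central_mass_mono: "0 < \<tau> \<Longrightarrow> r \<le> r' \<Longrightarrow> central_mass \<tau> y r \<le> central_mass \<tau> y r'"
  unfolding central_mass_def
  by (intro finite_measure.finite_measure_mono prob_space.finite_measure prob_space_posterior) auto

lemma central_mass_strict_mono:
  assumes "0 < \<tau>" "0 \<le> r" "r < r'"
  shows "central_mass \<tau> y r < central_mass \<tau> y r'"
proof -
  interpret Q: prob_space "posterior \<tau> y" by (rule prob_space_posterior[OF assms(1)])
  let ?m = "post_mean \<tau> y"
  have "central_mass \<tau> y r < central_mass \<tau> y r + measure (posterior \<tau> y) {?m + r<..<?m + r'}"
    using posterior_interval_pos[of \<tau> "?m + r" "?m + r'" y] assms by simp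
  also have "\<dots> = measure (posterior \<tau> y) ({\<theta>. \<bar>\<theta> - ?m\<bar> \<le> r} \<union> {?m + r<..<?m + r'})"
    unfolding central_mass_def by (rule Q.finite_measure_Union[symmetric]) (auto simp: disjoint_iff)
  also have "\<dots> \<le> central_mass \<tau> y r'"
    unfolding central_mass_def using assms by (intro Q.finite_measure_mono) auto
  finally show ?thesis .
qed

lemma central_mass_nonpos:
  assumes "0 < \<tau>" "r \<le> 0"
  shows "central_mass \<tau> y r = 0"
proof -
  interpret Q: prob_space "posterior \<tau> y" by (rule prob_space_posterior[OF assms(1)])
  have "central_mass \<tau> y r \<le> measure (posterior \<tau> y) {post_mean \<tau> y}"
    unfolding central_mass_def using assms by (intro Q.finite_measure_mono) auto
  then show ?thesis
    using posterior_singleton[OF assms(1)] by (simp add: central_mass_def antisym)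
qed

lemma central_mass_attained:
  assumes "0 < \<tau>" "0 < \<beta>" "\<beta> < 1"
  shows "\<exists>r. central_mass \<tau> y r = \<beta>"
proof -
  interpret Q: prob_space "posterior \<tau> y" by (rule prob_space_posterior[OF assms(1)])
  let ?m = "post_mean \<tau> y"
  \<comment> \<open>The central mass, as a function of the half-width, is the distribution function
    of the distance to the posterior mean; continuity and the limit at infinity are read off from
    there.\<close>
  define D where "D = distr (posterior \<tau> y) borel (\<lambda>\<theta>. \<bar>\<theta> - ?m\<bar>)"
  interpret D: real_distribution D
    unfolding D_def by (intro Q.real_distribution_distr) measurable
  have cdf: "cdf D r = central_mass \<tau> y r" for r
    unfolding cdf_def central_mass_def D_def
    by (subst measure_distr) (auto intro!: arg_cong[where f = "measure (posterior \<tau> y)"])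
  have cont: "isCont (cdf D) r" for r
  proof -
    have "measure D {r} = measure (posterior \<tau> y) {\<theta>. \<bar>\<theta> - ?m\<bar> = r}"
      unfolding D_def by (subst measure_distr) (auto intro!: arg_cong[where f = "measure (posterior \<tau> y)"])
    also have "\<dots> \<le> measure (posterior \<tau> y) ({?m + r} \<union> {?m - r})"
      by (intro Q.finite_measure_mono) auto
    also have "\<dots> \<le> measure (posterior \<tau> y) {?m + r} + measure (posterior \<tau> y) {?m - r}"
      by (intro measure_Un_le) auto
    also have "\<dots> = 0"
      using posterior_singleton[OF assms(1)] by simp
    finally show ?thesis
      by (simp add: D.isCont_cdf antisym)
  qed
  have "eventually (\<lambda>x. cdf D x > \<beta>) at_top"
    using assms by (intro order_tendstoD(1)[OF D.cdf_lim_at_top_prob]) simp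
  then obtain b where b: "\<And>x. x \<ge> b \<Longrightarrow> cdf D x > \<beta>"
    by (auto simp: eventually_at_top_linorder)
  have "\<exists>r\<ge>0. r \<le> max 0 b \<and> cdf D r = \<beta>"
  proof (rule IVT)
    show "cdf D 0 \<le> \<beta>"
      using assms by (simp add: cdf central_mass_nonpos)
    show "\<beta> \<le> cdf D (max 0 b)"
      using b[of "max 0 b"] by simp
  qed (use cont in auto)
  then show ?thesis by (auto simp: cdf)
qed

lemma central_mass_radius:
  assumes "0 < \<tau>" "0 < \<alpha>" "\<alpha> < 1"
  shows "central_mass \<tau> y (radius \<alpha> \<tau> y) = 1 - \<alpha>"
proof -
  obtain r where r: "central_mass \<tau> y r = 1 - \<alpha>"
    using central_mass_attained[of \<tau> "1 - \<alpha>" y] assms by auto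
  \<comment> \<open>Strict monotonicity is known only for nonnegative half-widths, so the others
    have to be excluded before uniqueness.\<close>
  have pos: "0 < s" if "central_mass \<tau> y s = 1 - \<alpha>" for s
    using that central_mass_nonpos[OF assms(1), of s y] assms by (cases "s \<le> 0") auto
  have "s = r" if "central_mass \<tau> y s = 1 - \<alpha>" for s
    using that r pos[OF that] pos[OF r] central_mass_strict_mono[OF assms(1), of r s y]
      central_mass_strict_mono[OF assms(1), of s r y]
    by (cases r s rule: linorder_cases) auto
  with r have "(THE r. central_mass \<tau> y r = 1 - \<alpha>) = r"
    by (rule the_equality)
  with r show ?thesis
    by (simp add: radius_def central_mass_def)
qed

text \<open>Trades the definite description for an inequality on the central mass. The bounds on the
  radius and its measurability all go through this equivalence.\<close>

lemma radius_le_iff: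
  assumes "0 < \<tau>" "0 < \<alpha>" "\<alpha> < 1"
  shows "radius \<alpha> \<tau> y \<le> x \<longleftrightarrow> 1 - \<alpha> \<le> central_mass \<tau> y x"
proof
  assume "radius \<alpha> \<tau> y \<le> x"
  then show "1 - \<alpha> \<le> central_mass \<tau> y x"
    using central_mass_mono[OF assms(1), of _ x y] central_mass_radius[OF assms] by metis
next
  assume x: "1 - \<alpha> \<le> central_mass \<tau> y x"
  show "radius \<alpha> \<tau> y \<le> x"
  proof (rule ccontr)
    assume less: "\<not> radius \<alpha> \<tau> y \<le> x"
    have "0 \<le> x"
      using x central_mass_nonpos[OF assms(1), of x y] assms by (cases "x \<le> 0") auto
    then show False
      using central_mass_strict_mono[OF assms(1), of x "radius \<alpha> \<tau> y" y] less x central_mass_radius[OF assms, of y]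
      by simp
  qed
qed

lemma radius_pos:
  assumes "0 < \<tau>" "0 < \<alpha>" "\<alpha> < 1"
  shows "0 < radius \<alpha> \<tau> y"
  using radius_le_iff[OF assms, of y 0] central_mass_nonpos[OF assms(1), of 0 y] assms by simp

text \<open>A component of variance at least \<open>k\<close> leaves at least
  \<open>2 * upper_tail (x / sqrt k)\<close> outside any interval of half-width \<open>x\<close>,
  wherever it is centred; for the other components the trivial bound is used. If the loss exceeds
  \<alpha>, the half-width \<open>x\<close> is too small.\<close>

lemma radius_greater:
  assumes "0 < \<tau>" "0 < \<alpha>" "\<alpha> < 1" "0 \<le> x" "0 < k"
    and mass: "\<alpha> < measure (mixing \<tau> y) {l. k \<le> shrink \<tau> l} * (2 * upper_tail (x / sqrt k))"
  shows "x < radius \<alpha> \<tau> y"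
proof -
  interpret M: prob_space "mixing \<tau> y" by (rule prob_space_mixing)
  let ?m = "post_mean \<tau> y" and ?S = "{l. k \<le> shrink \<tau> l}"
  let ?A = "{\<theta>. \<bar>\<theta> - ?m\<bar> \<le> x}"
  let ?N = "\<lambda>l. measure (normal 0 1) {z. shrink \<tau> l * y + sqrt (shrink \<tau> l) * z \<in> ?A}"
  have [measurable]: "?S \<in> sets borel" "?A \<in> sets borel" by measurable
  have "central_mass \<tau> y x = (\<integral>l. ?N l \<partial>mixing \<tau> y)"
    unfolding central_mass_def by (rule measure_posterior[OF assms(1)]) simp
  also have "\<dots> \<le> (\<integral>l. 1 - indicator ?S l * (2 * upper_tail (x / sqrt k)) \<partial>mixing \<tau> y)"
  proof (rule integral_mono_AE)
    show "integrable (mixing \<tau> y) ?N"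
      using measurable_normal_section[of ?A \<tau> y]
      by (intro M.integrable_const_bound[where B = 1]) (auto cong: measurable_cong_sets)
    show "integrable (mixing \<tau> y) (\<lambda>l. 1 - indicator ?S l * (2 * upper_tail (x / sqrt k)))"
      by (intro Bochner_Integration.integrable_diff M.integrable_const integrable_mult_left
          integrable_real_indicator) (auto simp: M.emeasure_eq_measure)
    show "AE l in mixing \<tau> y. ?N l \<le> 1 - indicator ?S l * (2 * upper_tail (x / sqrt k))"
      using AE_mixing_pos
    proof eventually_elim
      case (elim l)
      show ?case
      proof (cases "k \<le> shrink \<tau> l")
        case True
        have s: "0 < sqrt (shrink \<tau> l)" using shrink_pos[of l \<tau>] elim assms by simp
        have "?N l = measure (normal 0 1) {z. \<bar>(shrink \<tau> l * y - ?m) + sqrt (shrink \<tau> l) * z\<bar> \<le> x}"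
          by (simp add: algebra_simps)
        also have "\<dots> \<le> 1 - 2 * upper_tail (x / sqrt (shrink \<tau> l))"
          using s assms by (intro normal_affine_interval_le) auto
        also have "\<dots> \<le> 1 - 2 * upper_tail (x / sqrt k)"
        proof -
          have "x / sqrt (shrink \<tau> l) \<le> x / sqrt k"
            using True assms s by (intro divide_left_mono) auto
          then show ?thesis using upper_tail_anti by simp
        qed
        finally show ?thesis using True by simp
      qed auto
    qed
  qed
  also have "\<dots> = 1 - measure (mixing \<tau> y) ?S * (2 * upper_tail (x / sqrt k))"
  proof -
    have "integrable (mixing \<tau> y) (\<lambda>l. indicator ?S l * (2 * upper_tail (x / sqrt k)))"
      by (intro integrable_mult_left integrable_real_indicator) (auto simp: M.emeasure_eq_measure)
    then show ?thesis
      by (subst Bochner_Integration.integral_diff) (auto simp: M.prob_space[simplified])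
  qed
  also have "\<dots> < 1 - \<alpha>" using mass by simp
  finally show ?thesis
    using radius_le_iff[OF assms(1-3), of y x] by auto
qed

text \<open>Chebyshev's inequality around 0: the second moment of a component is
  \<open>k'\<^sup>2 * y\<^sup>2 + k'\<close> with \<open>k' = shrink \<tau> l < 1\<close>, hence at
  most \<open>k * (1 + y\<^sup>2)\<close> if \<open>k' \<le> k\<close>. Moving the centre from 0 to
  the posterior mean costs the last summand.\<close>

lemma radius_le:
  assumes "0 < \<tau>" "0 < \<alpha>" "\<alpha> < 1" "0 < x" "0 \<le> k"
    and mass: "measure (mixing \<tau> y) {l. k < shrink \<tau> l} + k * (1 + y\<^sup>2) / x\<^sup>2 \<le> \<alpha>"
  shows "radius \<alpha> \<tau> y \<le> x + \<bar>post_mean \<tau> y\<bar>"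
proof -
  interpret M: prob_space "mixing \<tau> y" by (rule prob_space_mixing)
  interpret Q: prob_space "posterior \<tau> y" by (rule prob_space_posterior[OF assms(1)])
  let ?m = "post_mean \<tau> y" and ?S = "{l. k < shrink \<tau> l}"
  let ?A = "{\<theta>. x < \<bar>\<theta>\<bar>}"
  let ?N = "\<lambda>l. measure (normal 0 1) {z. shrink \<tau> l * y + sqrt (shrink \<tau> l) * z \<in> ?A}"
  have [measurable]: "?S \<in> sets borel" "?A \<in> sets borel" by measurable
  have "measure (posterior \<tau> y) ?A = (\<integral>l. ?N l \<partial>mixing \<tau> y)"
    by (rule measure_posterior[OF assms(1)]) simp
  also have "\<dots> \<le> (\<integral>l. indicator ?S l + k * (1 + y\<^sup>2) / x\<^sup>2 \<partial>mixing \<tau> y)"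
  proof (rule integral_mono)
    show "integrable (mixing \<tau> y) ?N"
      using measurable_normal_section[of ?A \<tau> y]
      by (intro M.integrable_const_bound[where B = 1]) (auto cong: measurable_cong_sets)
    show "integrable (mixing \<tau> y) (\<lambda>l. indicator ?S l + k * (1 + y\<^sup>2) / x\<^sup>2)"
      by (intro Bochner_Integration.integrable_add M.integrable_const
          integrable_real_indicator) (auto simp: M.emeasure_eq_measure)
    fix l
    show "?N l \<le> indicator ?S l + k * (1 + y\<^sup>2) / x\<^sup>2"
    proof (cases "l \<in> ?S")
      case True
      have "?N l \<le> 1" by simp
      also have "1 \<le> indicator ?S l + k * (1 + y\<^sup>2) / x\<^sup>2"
        using True assms by (simp add: divide_nonneg_pos)
      finally show ?thesis .
    next
      case False
      let ?k = "shrink \<tau> l" and ?T = "\<lambda>z. shrink \<tau> l * y + sqrt (shrink \<tau> l) * z"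
      have T: "(?T z)\<^sup>2 = ?k\<^sup>2 * y\<^sup>2 + 2 * ?k * y * sqrt ?k * z + ?k * z\<^sup>2" for z
        using shrink_nonneg[of \<tau> l] by (simp add: power2_sum power_mult_distrib)
      have int: "integrable (normal 0 1) (\<lambda>z. (?T z)\<^sup>2)"
        unfolding T using std_normal_moments by auto
      have "?N l = (\<integral>z. indicator {z. ?T z \<in> ?A} z \<partial>normal 0 1)"
        by simp
      also have "\<dots> \<le> (\<integral>z. (?T z)\<^sup>2 / x\<^sup>2 \<partial>normal 0 1)"
      proof (rule integral_mono)
        show "integrable (normal 0 1) (indicat_real {z. ?T z \<in> ?A})"
          by (intro integrable_real_indicator) (auto simp: std_normal.emeasure_eq_measure)
        show "integrable (normal 0 1) (\<lambda>z. (?T z)\<^sup>2 / x\<^sup>2)"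
          using int by simp
        fix z
        have "x\<^sup>2 \<le> (?T z)\<^sup>2" if "x < \<bar>?T z\<bar>"
          using that assms by (intro abs_le_square_iff[THEN iffD1]) auto
        then show "indicator {z. ?T z \<in> ?A} z \<le> (?T z)\<^sup>2 / x\<^sup>2"
          using assms by (auto simp: indicator_def)
      qed
      also have "\<dots> = (?k\<^sup>2 * y\<^sup>2 + ?k) / x\<^sup>2"
        unfolding T using std_normal_moments std_normal.prob_space by simp
      also have "\<dots> \<le> (k * y\<^sup>2 + k) / x\<^sup>2"
      proof (intro divide_right_mono add_mono mult_right_mono)
        have "?k\<^sup>2 \<le> 1 * ?k"
          unfolding power2_eq_square using shrink_less_1[of \<tau> l] shrink_nonneg[of \<tau> l]
          by (intro mult_right_mono) auto
        then show "?k\<^sup>2 \<le> k" using False by simp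
      qed (use False in auto)
      finally show ?thesis
        using False by (simp add: algebra_simps)
    qed
  qed
  also have "\<dots> = measure (mixing \<tau> y) ?S + k * (1 + y\<^sup>2) / x\<^sup>2"
  proof -
    have "integrable (mixing \<tau> y) (indicat_real ?S)"
      by (intro integrable_real_indicator) (auto simp: M.emeasure_eq_measure)
    then show ?thesis
      by (subst Bochner_Integration.integral_add) (auto simp: M.prob_space[simplified])
  qed
  finally have "measure (posterior \<tau> y) ?A \<le> \<alpha>"
    using mass by simp
  then have "1 - \<alpha> \<le> measure (posterior \<tau> y) (space (posterior \<tau> y) - ?A)"
    by (subst Q.prob_compl) auto
  also have "\<dots> \<le> central_mass \<tau> y (x + \<bar>?m\<bar>)"
    unfolding central_mass_def by (intro Q.finite_measure_mono) auto
  finally show ?thesis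
    using radius_le_iff[OF assms(1-3)] by simp
qed

section \<open>The posterior of the local scale\<close>

text \<open>Keeping only scales up to \<open>1 / sqrt \<tau>\<close> loses prior mass at most
  \<open>sqrt \<tau>\<close>; there the exponential is at least 1 and the root at most
  \<open>sqrt (1 + \<tau>)\<close>. The bound does not involve \<open>y\<close> and tends to
  1.\<close>

lemma wt_total_ge:
  assumes "0 < \<tau>"
  shows "(1 - sqrt \<tau>) / sqrt (1 + \<tau>) \<le> wt_total \<tau> y"
proof -
  define \<Lambda> where "\<Lambda> = 1 / sqrt \<tau>"
  have \<Lambda>: "0 < \<Lambda>" "(\<Lambda> * \<tau>)\<^sup>2 = \<tau>"
    using assms by (auto simp: \<Lambda>_def power_divide power_mult_distrib power2_eq_square)
  have "(1 - sqrt \<tau>) / sqrt (1 + \<tau>) \<le> measure half_cauchy {..\<Lambda>} / sqrt (1 + \<tau>)"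
  proof (intro divide_right_mono)
    have "measure half_cauchy {..\<Lambda>} = 1 - measure half_cauchy {\<Lambda><..}"
      using half_cauchy.prob_compl[of "{\<Lambda><..}"] by (auto simp: Compl_eq_Diff_UNIV[symmetric])
    then show "1 - sqrt \<tau> \<le> measure half_cauchy {..\<Lambda>}"
      using half_cauchy_tail_le[OF \<Lambda>(1)] by (simp add: \<Lambda>_def)
  qed (use assms in auto)
  also have "\<dots> = (\<integral>l. indicator {..\<Lambda>} l / sqrt (1 + \<tau>) \<partial>half_cauchy)"
    by simp
  also have "\<dots> \<le> wt_total \<tau> y"
    unfolding wt_total_def
  proof (rule integral_mono_AE)
    show "integrable half_cauchy (\<lambda>l. indicator {..\<Lambda>} l / sqrt (1 + \<tau>))"
      by (intro integrable_divide integrable_real_indicator) (auto simp: half_cauchy.emeasure_eq_measure)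
    show "AE l in half_cauchy. indicator {..\<Lambda>} l / sqrt (1 + \<tau>) \<le> wt \<tau> y l"
      using AE_half_cauchy_pos
    proof eventually_elim
      case (elim l)
      show ?case
      proof (cases "l \<le> \<Lambda>")
        case True
        then have "(l * \<tau>)\<^sup>2 \<le> (\<Lambda> * \<tau>)\<^sup>2"
          using elim assms by (intro power_mono mult_right_mono) auto
        then have "sqrt (1 + (l * \<tau>)\<^sup>2) \<le> sqrt (1 + \<tau>)"
          using \<Lambda> by simp
        moreover have "1 \<le> exp (y\<^sup>2 / 2 * shrink \<tau> l)"
          using shrink_nonneg[of \<tau> l] by simp
        ultimately have "1 / sqrt (1 + \<tau>) \<le> exp (y\<^sup>2 / 2 * shrink \<tau> l) / sqrt (1 + (l * \<tau>)\<^sup>2)"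
          by (intro frac_le) auto
        then show ?thesis using True by (simp add: wt_def)
      qed (simp add: wt_nonneg)
    qed
  qed (rule integrable_wt)
  finally show ?thesis .
qed

text \<open>Replacing the exponential by its supremum separates the observation from the scale. The
  loss is harmless as long as \<open>exp (y\<^sup>2 / 2)\<close> stays well below
  \<open>1 / \<tau>\<close>, that is below the threshold.\<close>

lemma mean_shrink_le:
  assumes "0 < \<tau>"
  shows "mean_shrink \<tau> y \<le> exp (y\<^sup>2 / 2) * (2 / pi * \<tau>) / wt_total \<tau> y"
proof -
  let ?g = "\<lambda>l. (l * \<tau>)\<^sup>2 / (1 + (l * \<tau>)\<^sup>2) / sqrt (1 + (l * \<tau>)\<^sup>2)"
  have g: "0 \<le> ?g l" "?g l = shrink \<tau> l / sqrt (1 + (l * \<tau>)\<^sup>2)" for l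
    by (auto simp: shrink_def)
  have "integrable half_cauchy (\<lambda>l. wt \<tau> 0 l * shrink \<tau> l)"
    using shrink_nonneg[of \<tau>] shrink_less_1[of \<tau>]
    by (intro integrable_wt_mult[where B = 1]) (auto intro: less_imp_le)
  then have int: "integrable half_cauchy ?g"
    unfolding g(2) by (simp add: wt_def)
  then have "ennreal (\<integral>l. ?g l \<partial>half_cauchy) = (\<integral>\<^sup>+ l. ennreal (?g l) \<partial>half_cauchy)"
    using g(1) by (intro nn_integral_eq_integral[symmetric]) auto
  also have "\<dots> \<le> ennreal (2 / pi * \<tau>)"
    by (rule nn_integral_half_cauchy_shrink[OF assms])
  finally have G: "(\<integral>l. ?g l \<partial>half_cauchy) \<le> 2 / pi * \<tau>"
    using assms by (simp add: ennreal_le_iff)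
  have "(\<integral>l. wt \<tau> y l * shrink \<tau> l \<partial>half_cauchy) \<le> (\<integral>l. exp (y\<^sup>2 / 2) * ?g l \<partial>half_cauchy)"
  proof (rule integral_mono)
    show "integrable half_cauchy (\<lambda>l. wt \<tau> y l * shrink \<tau> l)"
      using shrink_nonneg[of \<tau>] shrink_less_1[of \<tau>]
      by (intro integrable_wt_mult[where B = 1]) (auto intro: less_imp_le)
    show "integrable half_cauchy (\<lambda>l. exp (y\<^sup>2 / 2) * ?g l)"
      by (rule integrable_mult_right[OF int])
    fix l
    have "y\<^sup>2 / 2 * shrink \<tau> l \<le> y\<^sup>2 / 2 * 1"
      using shrink_less_1[of \<tau> l] by (intro mult_left_mono) auto
    then have "exp (y\<^sup>2 / 2 * shrink \<tau> l) * ?g l \<le> exp (y\<^sup>2 / 2) * ?g l"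
      using g(1) by (intro mult_right_mono) auto
    then show "wt \<tau> y l * shrink \<tau> l \<le> exp (y\<^sup>2 / 2) * ?g l"
      unfolding g(2) by (simp add: wt_def)
  qed
  also have "\<dots> \<le> exp (y\<^sup>2 / 2) * (2 / pi * \<tau>)"
    unfolding integral_mult_right_zero using G by (intro mult_left_mono) auto
  finally show ?thesis
    unfolding mean_shrink_def integral_mixing[OF shrink_measurable]
    using wt_total_pos[of \<tau> y] by (intro divide_right_mono) auto
qed

lemma mixing_tail_le:
  assumes "0 < \<Lambda>"
  shows "measure (mixing \<tau> y) {\<Lambda><..} \<le> exp (y\<^sup>2 / 2) / (\<Lambda> * wt_total \<tau> y)"
proof -
  have "(\<integral>l. wt \<tau> y l * indicator {\<Lambda><..} l \<partial>half_cauchy) \<le> (\<integral>l. exp (y\<^sup>2 / 2) * indicator {\<Lambda><..} l \<partial>half_cauchy)"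
  proof (rule integral_mono)
    show "integrable half_cauchy (\<lambda>l. wt \<tau> y l * indicator {\<Lambda><..} l)"
      by (rule integrable_wt_mult[where B = 1]) (auto simp: indicator_def)
    show "integrable half_cauchy (\<lambda>l. exp (y\<^sup>2 / 2) * indicator {\<Lambda><..} l)"
      by (intro integrable_mult_right integrable_real_indicator) (auto simp: half_cauchy.emeasure_eq_measure)
  qed (auto simp: wt_le indicator_def)
  also have "\<dots> = exp (y\<^sup>2 / 2) * measure half_cauchy {\<Lambda><..}"
    by simp
  also have "\<dots> \<le> exp (y\<^sup>2 / 2) * (1 / \<Lambda>)"
    using half_cauchy_tail_le[OF assms] by (intro mult_left_mono) auto
  finally have "measure (mixing \<tau> y) {\<Lambda><..} \<le> exp (y\<^sup>2 / 2) * (1 / \<Lambda>) / wt_total \<tau> y"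
    unfolding measure_mixing[OF borel_open[OF open_greaterThan]]
    using wt_total_pos[of \<tau> y] by (intro divide_right_mono) auto
  then show ?thesis by simp
qed

text \<open>The likelihood of the local scale is increasing, so observing \<open>y\<close> shifts mass above its
  prior median.\<close>

lemma mixing_above_one:
  assumes "0 < \<tau>"
  shows "1 - 1 / (2 * wt_total \<tau> 0) \<le> measure (mixing \<tau> y) {1<..}"
proof -
  \<comment> \<open>By monotonicity \<open>E0\<close> bounds the exponential factor from below on
    scales above 1 and from above on the others, so it cancels when the two parts are
    compared.\<close>
  define E0 where "E0 = exp (y\<^sup>2 / 2 * shrink \<tau> 1)"
  define A where "A = (\<integral>l. wt \<tau> y l * indicator {1<..} l \<partial>half_cauchy)"
  define B where "B = (\<integral>l. wt \<tau> y l * indicator {..1} l \<partial>half_cauchy)"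
  have E0: "0 < E0" by (simp add: E0_def)
  have int: "integrable half_cauchy (\<lambda>l. wt \<tau> y' l * indicator S l)" if "S \<in> sets borel" for S y'
    using that by (intro integrable_wt_mult[where B = 1]) (auto simp: indicator_def)
  have split: "wt_total \<tau> y' = (\<integral>l. wt \<tau> y' l * indicator {1<..} l \<partial>half_cauchy)
      + (\<integral>l. wt \<tau> y' l * indicator {..1} l \<partial>half_cauchy)" for y'
    unfolding wt_total_def
    by (subst Bochner_Integration.integral_add[OF int int, symmetric])
      (auto intro!: Bochner_Integration.integral_cong simp: indicator_def)
  have wt0: "wt \<tau> y l = exp (y\<^sup>2 / 2 * shrink \<tau> l) * wt \<tau> 0 l" for l
    by (simp add: wt_def)
  have ind: "integrable half_cauchy (indicat_real {..1})"
    by (intro integrable_real_indicator) (auto simp: half_cauchy.emeasure_eq_measure)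
  have "(\<integral>l. wt \<tau> 0 l * indicator {..1} l \<partial>half_cauchy) \<le> (\<integral>l. indicator {..1} l \<partial>half_cauchy)"
    using wt_le[of \<tau> 0] by (intro integral_mono int ind) (auto simp: indicator_def)
  then have "wt_total \<tau> 0 - 1 / 2 \<le> (\<integral>l. wt \<tau> 0 l * indicator {1<..} l \<partial>half_cauchy)"
    using split[of 0] by (simp add: half_cauchy_median)
  then have "E0 * (wt_total \<tau> 0 - 1 / 2) \<le> (\<integral>l. E0 * (wt \<tau> 0 l * indicator {1<..} l) \<partial>half_cauchy)"
    using E0 by simp
  also have "\<dots> \<le> A"
    unfolding A_def
  proof (intro integral_mono int integrable_mult_right)
    fix l
    have "E0 \<le> exp (y\<^sup>2 / 2 * shrink \<tau> l)" if "1 < l"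
      unfolding E0_def using that shrink_mono[OF assms, of 1 l] by (simp add: mult_left_mono)
    then show "E0 * (wt \<tau> 0 l * indicator {1<..} l) \<le> wt \<tau> y l * indicator {1<..} l"
      using wt_nonneg[of \<tau> 0 l] by (auto simp: wt0[of l] indicator_def mult_right_mono)
  qed auto
  finally have A: "E0 * (wt_total \<tau> 0 - 1 / 2) \<le> A" .
  have "B \<le> (\<integral>l. E0 * indicator {..1} l \<partial>half_cauchy)"
    unfolding B_def
  proof (intro integral_mono_AE int integrable_mult_right ind)
    show "AE l in half_cauchy. wt \<tau> y l * indicator {..1} l \<le> E0 * indicator {..1} l"
      using AE_half_cauchy_pos
    proof eventually_elim
      case (elim l)
      have "wt \<tau> y l \<le> E0 * 1" if "l \<le> 1"
        unfolding wt0[of l] E0_def using that elim shrink_mono[OF assms, of l 1] wt_le[of \<tau> 0 l] wt_nonneg[of \<tau> 0 l]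
        by (intro mult_mono) (auto simp: mult_left_mono)
      then show ?case by (auto simp: indicator_def)
    qed
  qed auto
  then have B: "B \<le> E0 / 2"
    by (simp add: half_cauchy_median)
  have "0 \<le> A" "0 \<le> B"
    unfolding A_def B_def using wt_nonneg by (auto intro!: integral_nonneg_AE)
  have V: "wt_total \<tau> y = A + B" using split[of y] by (simp add: A_def B_def)
  have v0: "0 < wt_total \<tau> 0" "0 < A + B" using wt_total_pos[of \<tau> 0] wt_total_pos[of \<tau> y] V by auto
  \<comment> \<open>With \<open>v = wt_total \<tau> 0\<close>, the bounds
    \<open>E0 * (v - 1 / 2) \<le> A\<close> and \<open>B \<le> E0 / 2\<close> give
    \<open>(v - 1 / 2) * B \<le> A / 2\<close>. For \<open>v \<le> 1 / 2\<close> the left factor is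
    not positive and the claim is trivial.\<close>
  have "(1 - 1 / (2 * wt_total \<tau> 0)) * (A + B) \<le> A"
  proof (cases "wt_total \<tau> 0 \<le> 1 / 2")
    case True
    then have "(1 - 1 / (2 * wt_total \<tau> 0)) * (A + B) \<le> 0"
      using v0 by (intro mult_nonpos_nonneg) (auto simp: field_simps)
    then show ?thesis using \<open>0 \<le> A\<close> by simp
  next
    case False
    have "(wt_total \<tau> 0 - 1 / 2) * B \<le> (wt_total \<tau> 0 - 1 / 2) * (E0 / 2)"
      using False B by (intro mult_left_mono) auto
    also have "\<dots> \<le> A / 2" using A by (simp add: mult.commute)
    finally have "(2 * wt_total \<tau> 0 - 1) * (A + B) \<le> A * (2 * wt_total \<tau> 0)"
      by (simp add: algebra_simps)
    then have "(2 * wt_total \<tau> 0 - 1) / (2 * wt_total \<tau> 0) * (A + B) \<le> A"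
      using v0 by (simp add: pos_divide_le_eq)
    moreover have "(2 * wt_total \<tau> 0 - 1) / (2 * wt_total \<tau> 0) = 1 - 1 / (2 * wt_total \<tau> 0)"
      using v0 by (simp add: diff_divide_distrib)
    ultimately show ?thesis by simp
  qed
  then show ?thesis
    using v0 by (simp add: measure_mixing A_def[symmetric] V pos_le_divide_eq)
qed

section \<open>Observations beyond the threshold\<close>

lemma zeta_nonneg: "0 < t \<Longrightarrow> t \<le> 1 \<Longrightarrow> 0 \<le> zeta t"
  by (simp add: zeta_def)

lemma zeta_square: "0 < t \<Longrightarrow> t \<le> 1 \<Longrightarrow> (zeta t)\<^sup>2 = 2 * ln (1 / t)"
  by (simp add: zeta_def)

lemma exp_half_zeta_square: "0 < t \<Longrightarrow> t \<le> 1 \<Longrightarrow> exp ((zeta t)\<^sup>2 / 2) = 1 / t"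
  by (simp add: zeta_square)

text \<open>The likelihood of the scale peaks where \<open>l * \<tau>\<close> is of order
  \<open>\<bar>y\<bar>\<close>, so one dyadic block there suffices. The exponential loses at most a
  factor 2, the root is at most \<open>3 * \<bar>y\<bar>\<close>, and the block has prior mass at
  least \<open>\<tau> / (10 * \<bar>y\<bar>)\<close>; hence 60.\<close>

lemma wt_total_lower_large:
  assumes "0 < \<tau>" "\<tau> < 1" "1 \<le> \<bar>y\<bar>"
  shows "\<tau> / (60 * y\<^sup>2) * exp (y\<^sup>2 / 2) \<le> wt_total \<tau> y"
proof -
  define \<Lambda> where "\<Lambda> = \<bar>y\<bar> / \<tau>"
  have \<Lambda>: "1 \<le> \<Lambda>" "\<Lambda> * \<tau> = \<bar>y\<bar>"
    using assms by (auto simp: \<Lambda>_def pos_le_divide_eq)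
  have y2: "1 \<le> y\<^sup>2" using assms by (simp add: abs_square_le_1 abs_le_square_iff[of 1 y, simplified])
  have "\<tau> / (60 * y\<^sup>2) * exp (y\<^sup>2 / 2) = exp (y\<^sup>2 / 2) / (6 * \<bar>y\<bar>) * (1 / (10 * \<Lambda>))"
    using assms by (simp add: \<Lambda>_def power2_eq_square)
  also have "\<dots> \<le> exp (y\<^sup>2 / 2) / (6 * \<bar>y\<bar>) * measure half_cauchy {\<Lambda><..2 * \<Lambda>}"
    using half_cauchy_dyadic_ge[OF \<Lambda>(1)] by (intro mult_left_mono) auto
  also have "\<dots> = (\<integral>l. exp (y\<^sup>2 / 2) / (6 * \<bar>y\<bar>) * indicator {\<Lambda><..2 * \<Lambda>} l \<partial>half_cauchy)"
    by simp
  also have "\<dots> \<le> wt_total \<tau> y"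
    unfolding wt_total_def
  proof (rule integral_mono)
    show "integrable half_cauchy (\<lambda>l. exp (y\<^sup>2 / 2) / (6 * \<bar>y\<bar>) * indicator {\<Lambda><..2 * \<Lambda>} l)"
      by (intro integrable_mult_right integrable_real_indicator) (auto simp: half_cauchy.emeasure_eq_measure)
    fix l
    show "exp (y\<^sup>2 / 2) / (6 * \<bar>y\<bar>) * indicator {\<Lambda><..2 * \<Lambda>} l \<le> wt \<tau> y l"
    proof (cases "l \<in> {\<Lambda><..2 * \<Lambda>}")
      case True
      then have s: "\<bar>y\<bar> \<le> l * \<tau>" "l * \<tau> \<le> 2 * \<bar>y\<bar>"
        using \<Lambda> mult_right_mono[of \<Lambda> l \<tau>] mult_right_mono[of l "2 * \<Lambda>" \<tau>] assms by (auto simp: mult.assoc)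
      have s2: "y\<^sup>2 \<le> (l * \<tau>)\<^sup>2" "(l * \<tau>)\<^sup>2 \<le> 4 * y\<^sup>2"
        using power_mono[OF s(1), of 2] power_mono[OF s(2), of 2] assms(3) s by (auto simp: power_mult_distrib)
      have eq: "shrink \<tau> l = 1 - 1 / (1 + (l * \<tau>)\<^sup>2)"
        using one_plus_square_pos[of "l * \<tau>"] by (simp add: shrink_def field_simps)
      have "y\<^sup>2 / 2 * (1 / (1 + (l * \<tau>)\<^sup>2)) \<le> 1 / 2"
        using s2 by (simp add: pos_divide_le_eq)
      then have "y\<^sup>2 / 2 - 1 / 2 \<le> y\<^sup>2 / 2 * shrink \<tau> l"
        unfolding eq by (simp add: right_diff_distrib)
      then have e: "exp (y\<^sup>2 / 2) * exp (- (1 / 2)) \<le> exp (y\<^sup>2 / 2 * shrink \<tau> l)"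
        by (simp add: exp_add[symmetric])
      have "1 / 2 \<le> exp (- (1 / 2 :: real))"
        using exp_ge_add_one_self[of "- (1 / 2 :: real)"] by simp
      then have "exp (y\<^sup>2 / 2) * (1 / 2) \<le> exp (y\<^sup>2 / 2) * exp (- (1 / 2))"
        by (intro mult_left_mono) auto
      with e have e': "exp (y\<^sup>2 / 2) * (1 / 2) \<le> exp (y\<^sup>2 / 2 * shrink \<tau> l)"
        by linarith
      have "sqrt (1 + (l * \<tau>)\<^sup>2) \<le> sqrt ((3 * \<bar>y\<bar>)\<^sup>2)"
        using s2 y2 by (intro real_sqrt_le_mono) (simp add: power_mult_distrib)
      then have "sqrt (1 + (l * \<tau>)\<^sup>2) \<le> 3 * \<bar>y\<bar>"
        unfolding real_sqrt_abs by (simp only: abs_mult abs_numeral abs_idempotent)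
      with e' have "exp (y\<^sup>2 / 2) * (1 / 2) / (3 * \<bar>y\<bar>) \<le> exp (y\<^sup>2 / 2 * shrink \<tau> l) / sqrt (1 + (l * \<tau>)\<^sup>2)"
        by (intro frac_le) auto
      then show ?thesis using True by (simp add: wt_def)
    qed (simp add: wt_nonneg)
  qed (rule integrable_wt)
  finally show ?thesis .
qed

text \<open>Here \<open>K\<close> stands for \<open>1 - shrink\<close>, which is split at \<open>\<bar>y\<bar> powr (-3/2)\<close>; above it the weight is negligible
  against \<open>wt_total_lower_large\<close>, since small local scales cost \<open>exp (- y\<^sup>2 / 2)\<close> up to a factor
  close to one in the exponent and \<open>\<bar>y\<bar>\<close> exceeds the threshold \<open>zeta \<tau>\<close>.\<close>

lemma unshrink_pointwise:
  fixes K t a :: real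
  assumes K: "0 < K" "K \<le> 1" and t: "0 < t"
  shows "t * K * (sqrt K * exp (- K * t\<^sup>2 / 2))
    \<le> t powr (- 1 / 2) * (sqrt K * exp (- K * t\<^sup>2 / 2)) + t * min (exp (- K * t\<^sup>2 / 2)) (exp (- sqrt t / 2))"
proof (cases "K \<le> t powr (- 3 / 2)")
  case True
  then have "t * K \<le> t * t powr (- 3 / 2)" using t by (intro mult_left_mono) auto
  also have "\<dots> = t powr (- 1 / 2)" using t powr_add[of t 1 "- 3 / 2"] by simp
  finally have "t * K \<le> t powr (- 1 / 2)" .
  then have "t * K * (sqrt K * exp (- K * t\<^sup>2 / 2)) \<le> t powr (- 1 / 2) * (sqrt K * exp (- K * t\<^sup>2 / 2))"
    using K by (intro mult_right_mono) auto
  then show ?thesis using t by (intro order_trans[OF _ add_increasing2[OF _ order_refl]]) auto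
next
  case False
  have "sqrt t = t powr (- 3 / 2) * t\<^sup>2"
  proof -
    have "t powr (- 3 / 2) * t\<^sup>2 = t powr (1 / 2)"
      using t powr_add[of t "- 3 / 2" 2] by (simp add: powr_numeral)
    then show ?thesis using t by (simp add: powr_half_sqrt)
  qed
  also have "\<dots> \<le> K * t\<^sup>2" using False by (intro mult_right_mono) auto
  finally have e: "exp (- K * t\<^sup>2 / 2) \<le> exp (- sqrt t / 2)" by simp
  have "K * sqrt K \<le> 1 * 1" using K by (intro mult_mono) auto
  then have "t * exp (- K * t\<^sup>2 / 2) * (K * sqrt K) \<le> t * exp (- K * t\<^sup>2 / 2) * 1"
    using t by (intro mult_left_mono) auto
  also have "\<dots> = t * min (exp (- K * t\<^sup>2 / 2)) (exp (- sqrt t / 2))"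
    using e by simp
  finally have "t * K * (sqrt K * exp (- K * t\<^sup>2 / 2)) \<le> t * min (exp (- K * t\<^sup>2 / 2)) (exp (- sqrt t / 2))"
    by (simp add: mult_ac)
  then show ?thesis using t K by (intro order_trans[OF _ add_increasing[OF _ order_refl]]) auto
qed

text \<open>Dividing by \<open>wt_total_lower_large\<close> produces a factor
  \<open>1 / \<tau>\<close>, which \<open>exp (- sqrt \<bar>y\<bar> / 2)\<close> cannot beat just
  beyond the threshold. Scales above \<open>a / \<tau>\<close> therefore use this bound together
  with their prior mass \<open>\<tau> / a\<close>, which cancels that factor. Smaller scales use the
  stronger \<open>exp (- y\<^sup>2 / (2 * (1 + a\<^sup>2)))\<close>, which has to beat
  \<open>1 / \<tau>\<close> by itself.\<close>

lemma mean_unshrink_le: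
  assumes \<tau>: "0 < \<tau>" "\<tau> < 1" and y: "1 \<le> \<bar>y\<bar>" and a: "0 < a"
  shows "\<bar>y\<bar> * (1 - mean_shrink \<tau> y) \<le> \<bar>y\<bar> powr (- 1 / 2)
    + 60 * \<bar>y\<bar> ^ 3 * (exp (- y\<^sup>2 / (2 * (1 + a\<^sup>2))) / \<tau> + exp (- sqrt \<bar>y\<bar> / 2) / a)"
proof -
  define t where "t = \<bar>y\<bar>"
  have t: "1 \<le> t" "y\<^sup>2 = t\<^sup>2" using y by (auto simp: t_def)
  define D where "D = wt_total \<tau> y"
  define p where "p = exp (- t\<^sup>2 / (2 * (1 + a\<^sup>2)))"
  define q where "q = exp (- sqrt t / 2)"
  define \<Lambda> where "\<Lambda> = a / \<tau>"
  have \<Lambda>: "0 < \<Lambda>" "\<Lambda> * \<tau> = a" using \<tau> a by (auto simp: \<Lambda>_def)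
  let ?I = "indicat_real {\<Lambda><..}"
  have D: "0 < D" by (simp add: D_def wt_total_pos)
  have bnd: "\<bar>1 - shrink \<tau> l\<bar> \<le> 1" for l
    using shrink_nonneg[of \<tau> l] shrink_less_1[of \<tau> l] by simp
  have i1: "integrable half_cauchy (\<lambda>l. wt \<tau> y l * (1 - shrink \<tau> l))"
    by (rule integrable_wt_mult[OF _ bnd]) measurable
  have i2: "integrable half_cauchy ?I"
    by (intro integrable_real_indicator) (auto simp: half_cauchy.emeasure_eq_measure)
  have "t * (\<integral>l. wt \<tau> y l * (1 - shrink \<tau> l) \<partial>half_cauchy) = (\<integral>l. t * (wt \<tau> y l * (1 - shrink \<tau> l)) \<partial>half_cauchy)"
    by simp
  also have "\<dots> \<le> (\<integral>l. t powr (- 1 / 2) * wt \<tau> y l + t * exp (t\<^sup>2 / 2) * (p + q * ?I l) \<partial>half_cauchy)"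
  proof (rule integral_mono_AE)
    show "integrable half_cauchy (\<lambda>l. t * (wt \<tau> y l * (1 - shrink \<tau> l)))"
      by (rule integrable_mult_right[OF i1])
    show "integrable half_cauchy (\<lambda>l. t powr (- 1 / 2) * wt \<tau> y l + t * exp (t\<^sup>2 / 2) * (p + q * ?I l))"
      by (intro Bochner_Integration.integrable_add integrable_mult_right integrable_wt i2) simp
    show "AE l in half_cauchy. t * (wt \<tau> y l * (1 - shrink \<tau> l))
        \<le> t powr (- 1 / 2) * wt \<tau> y l + t * exp (t\<^sup>2 / 2) * (p + q * ?I l)"
      using AE_half_cauchy_pos
    proof eventually_elim
      case (elim l)
      define K where "K = 1 / (1 + (l * \<tau>)\<^sup>2)"
      have K: "0 < K" "K \<le> 1" by (auto simp: K_def)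
      have eq: "shrink \<tau> l = 1 - K"
        using one_plus_square_pos[of "l * \<tau>"] by (simp add: shrink_def K_def field_simps)
      have e: "exp (y\<^sup>2 / 2 * (1 - K)) = exp (t\<^sup>2 / 2) * exp (- K * t\<^sup>2 / 2)"
        by (simp add: t(2) exp_add[symmetric] field_simps)
      have w: "wt \<tau> y l = exp (t\<^sup>2 / 2) * (sqrt K * exp (- K * t\<^sup>2 / 2))"
        unfolding wt_def eq e by (simp add: K_def real_sqrt_divide)
      have m: "min (exp (- K * t\<^sup>2 / 2)) (exp (- sqrt t / 2)) \<le> p + q * ?I l"
      proof (cases "l \<le> \<Lambda>")
        case True
        then have "(l * \<tau>)\<^sup>2 \<le> (\<Lambda> * \<tau>)\<^sup>2"
          using elim \<tau> by (intro power_mono mult_right_mono) auto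
        then have "1 / (1 + a\<^sup>2) \<le> K"
          unfolding K_def \<Lambda>(2) by (intro divide_left_mono) auto
        then have "1 / (1 + a\<^sup>2) * (t\<^sup>2 / 2) \<le> K * (t\<^sup>2 / 2)"
          by (intro mult_right_mono) auto
        then have "exp (- K * t\<^sup>2 / 2) \<le> p"
          by (simp add: p_def mult.commute)
        then show ?thesis using True by simp
      next
        case False
        have "0 \<le> p" by (simp add: p_def)
        then show ?thesis using False by (simp add: q_def)
      qed
      have "t * (wt \<tau> y l * (1 - shrink \<tau> l)) = exp (t\<^sup>2 / 2) * (t * K * (sqrt K * exp (- K * t\<^sup>2 / 2)))"
        unfolding w eq by simp
      also have "\<dots> \<le> exp (t\<^sup>2 / 2) * (t powr (- 1 / 2) * (sqrt K * exp (- K * t\<^sup>2 / 2)) + t * (p + q * ?I l))"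
      proof (rule mult_left_mono)
        have "t * min (exp (- K * t\<^sup>2 / 2)) (exp (- sqrt t / 2)) \<le> t * (p + q * ?I l)"
          using m t by (intro mult_left_mono) auto
        then show "t * K * (sqrt K * exp (- K * t\<^sup>2 / 2))
            \<le> t powr (- 1 / 2) * (sqrt K * exp (- K * t\<^sup>2 / 2)) + t * (p + q * ?I l)"
          using unshrink_pointwise[OF K, of t] t by linarith
      qed simp
      also have "\<dots> = t powr (- 1 / 2) * wt \<tau> y l + t * exp (t\<^sup>2 / 2) * (p + q * ?I l)"
        unfolding w by (simp add: algebra_simps)
      finally show ?case .
    qed
  qed
  also have "\<dots> = t powr (- 1 / 2) * D + t * exp (t\<^sup>2 / 2) * (p + q * measure half_cauchy {\<Lambda><..})"
  proof -
    have "(\<integral>l. p + q * ?I l \<partial>half_cauchy) = p + q * measure half_cauchy {\<Lambda><..}"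
      by (subst Bochner_Integration.integral_add[OF _ integrable_mult_right[OF i2]])
        (simp_all add: half_cauchy.prob_space[simplified])
    then show ?thesis
      unfolding D_def wt_total_def
      by (subst Bochner_Integration.integral_add[OF integrable_mult_right[OF integrable_wt]])
        (auto intro!: integrable_mult_right Bochner_Integration.integrable_add i2)
  qed
  also have "\<dots> \<le> t powr (- 1 / 2) * D + t * exp (t\<^sup>2 / 2) * (p + q * (\<tau> / a))"
    using half_cauchy_tail_le[OF \<Lambda>(1)] t
    by (intro add_left_mono mult_left_mono) (auto simp: q_def \<Lambda>_def)
  finally have main: "t * (\<integral>l. wt \<tau> y l * (1 - shrink \<tau> l) \<partial>half_cauchy)
      \<le> t powr (- 1 / 2) * D + t * exp (t\<^sup>2 / 2) * (p + q * (\<tau> / a))" .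
  interpret M: prob_space "mixing \<tau> y" by (rule prob_space_mixing)
  have "1 - mean_shrink \<tau> y = (\<integral>l. 1 - shrink \<tau> l \<partial>mixing \<tau> y)"
    unfolding mean_shrink_def
    by (subst Bochner_Integration.integral_diff) (auto simp: integrable_shrink M.prob_space[simplified])
  also have "\<dots> = (\<integral>l. wt \<tau> y l * (1 - shrink \<tau> l) \<partial>half_cauchy) / D"
    unfolding D_def by (rule integral_mixing) measurable
  finally have "t * (1 - mean_shrink \<tau> y) \<le> (t powr (- 1 / 2) * D + t * exp (t\<^sup>2 / 2) * (p + q * (\<tau> / a))) / D"
    using main D by (simp add: divide_right_mono)
  also have "\<dots> = t powr (- 1 / 2) + t * exp (t\<^sup>2 / 2) * (p + q * (\<tau> / a)) / D"
    using D by (simp add: add_divide_distrib)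
  also have "\<dots> \<le> t powr (- 1 / 2) + t * exp (t\<^sup>2 / 2) * (p + q * (\<tau> / a)) / (\<tau> / (60 * t\<^sup>2) * exp (t\<^sup>2 / 2))"
    using wt_total_lower_large[OF \<tau> y] D t \<tau> a
    by (intro add_left_mono divide_left_mono) (auto simp: D_def p_def q_def intro!: mult_nonneg_nonneg add_nonneg_nonneg mult_pos_pos divide_pos_pos)
  also have "\<dots> = t powr (- 1 / 2) + 60 * t ^ 3 * (p / \<tau> + q / a)"
    using \<tau> t a by (simp add: field_simps power2_eq_square power3_eq_cube)
  finally show ?thesis
    unfolding p_def q_def t_def by simp
qed

lemma unshrink_vanishes:
  assumes k: "1 < k" and e: "0 < e"
  shows "\<exists>T\<ge>1. \<forall>\<tau> y. 0 < \<tau> \<longrightarrow> \<tau> < 1 \<longrightarrow> T \<le> \<bar>y\<bar> \<longrightarrow> k * zeta \<tau> \<le> \<bar>y\<bar> \<longrightarrow>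
    \<bar>y\<bar> * (1 - mean_shrink \<tau> y) \<le> e"
proof -
  \<comment> \<open>This choice puts \<open>1 + a\<^sup>2\<close> strictly between 1 and
    \<open>k\<^sup>2\<close>. As \<open>1 / \<tau> \<le> exp (y\<^sup>2 / (2 * k\<^sup>2))\<close>
    once \<open>k * zeta \<tau> \<le> \<bar>y\<bar>\<close>, the term with \<open>1 / \<tau>\<close>
    is at most \<open>exp (- d * y\<^sup>2)\<close> with \<open>d > 0\<close>. Hence a
    \<open>T\<close> that does not depend on \<tau>.\<close>
  define a where "a = sqrt ((k\<^sup>2 - 1) / 2)"
  have k2: "1 < k\<^sup>2" using k by (simp add: one_less_power)
  have a: "0 < a" "1 + a\<^sup>2 = (1 + k\<^sup>2) / 2" using k2 by (auto simp: a_def field_simps)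
  define d where "d = 1 / (2 * (1 + a\<^sup>2)) - 1 / (2 * k\<^sup>2)"
  have d: "0 < d"
  proof -
    have "1 / (2 * k\<^sup>2) < 1 / (1 + k\<^sup>2)"
      using k2 by (intro divide_strict_left_mono mult_pos_pos add_pos_pos) auto
    moreover have "2 * ((1 + k\<^sup>2) / 2) = 1 + k\<^sup>2" by simp
    ultimately show ?thesis unfolding d_def a(2) by (simp only: diff_gt_0_iff_gt)
  qed
  have "((\<lambda>t. t powr (- 1 / 2) + 60 * t ^ 3 * (exp (- d * t\<^sup>2) + exp (- sqrt t / 2) / a)) \<longlongrightarrow> 0) at_top"
    using d a(1) by real_asymp
  then have "eventually (\<lambda>t. t powr (- 1 / 2) + 60 * t ^ 3 * (exp (- d * t\<^sup>2) + exp (- sqrt t / 2) / a) < e) at_top"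
    using e by (intro order_tendstoD(2)) auto
  then obtain T where T: "\<And>t. t \<ge> T \<Longrightarrow> t powr (- 1 / 2) + 60 * t ^ 3 * (exp (- d * t\<^sup>2) + exp (- sqrt t / 2) / a) < e"
    by (auto simp: eventually_at_top_linorder)
  show ?thesis
  proof (intro exI[of _ "max 1 T"] conjI allI impI)
    fix \<tau> y :: real
    assume \<tau>: "0 < \<tau>" "\<tau> < 1" and y: "max 1 T \<le> \<bar>y\<bar>" "k * zeta \<tau> \<le> \<bar>y\<bar>"
    have "(k * zeta \<tau>)\<^sup>2 \<le> \<bar>y\<bar>\<^sup>2"
      using y k zeta_nonneg[of \<tau>] \<tau> by (intro power_mono) auto
    then have "k\<^sup>2 * (2 * ln (1 / \<tau>)) \<le> y\<^sup>2"
      using \<tau> by (simp add: power_mult_distrib zeta_square)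
    then have "ln (1 / \<tau>) \<le> y\<^sup>2 / (2 * k\<^sup>2)"
      using k by (subst pos_le_divide_eq) (auto simp: mult_ac)
    then have "exp (ln (1 / \<tau>)) \<le> exp (y\<^sup>2 / (2 * k\<^sup>2))"
      by (simp only: exp_le_cancel_iff)
    then have "1 / \<tau> \<le> exp (y\<^sup>2 / (2 * k\<^sup>2))"
      using \<tau> by simp
    then have "exp (- y\<^sup>2 / (2 * (1 + a\<^sup>2))) * (1 / \<tau>) \<le> exp (- y\<^sup>2 / (2 * (1 + a\<^sup>2))) * exp (y\<^sup>2 / (2 * k\<^sup>2))"
      by (intro mult_left_mono) auto
    also have "\<dots> = exp (- d * \<bar>y\<bar>\<^sup>2)"
      by (simp add: exp_add[symmetric] d_def algebra_simps)
    finally have "60 * \<bar>y\<bar> ^ 3 * (exp (- y\<^sup>2 / (2 * (1 + a\<^sup>2))) / \<tau> + exp (- sqrt \<bar>y\<bar> / 2) / a)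
        \<le> 60 * \<bar>y\<bar> ^ 3 * (exp (- d * \<bar>y\<bar>\<^sup>2) + exp (- sqrt \<bar>y\<bar> / 2) / a)"
      by (intro mult_left_mono add_right_mono) auto
    then show "\<bar>y\<bar> * (1 - mean_shrink \<tau> y) \<le> e"
      using mean_unshrink_le[OF \<tau> _ a(1), of y] T[of "\<bar>y\<bar>"] y by linarith
  qed auto
qed

section \<open>Coverage of a single coordinate\<close>

lemma wt_total_near_one:
  assumes "v < 1"
  shows "eventually (\<lambda>\<tau>. \<forall>y. v \<le> wt_total \<tau> y) (at_right 0)"
proof -
  have "((\<lambda>\<tau>. (1 - sqrt \<tau>) / sqrt (1 + \<tau>)) \<longlongrightarrow> 1) (at_right 0)"
    by real_asymp
  then have "eventually (\<lambda>\<tau>. (1 - sqrt \<tau>) / sqrt (1 + \<tau>) > v) (at_right 0)"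
    using assms by (rule order_tendstoD(1))
  moreover have "eventually (\<lambda>\<tau>::real. 0 < \<tau>) (at_right 0)"
    by (rule eventually_at_right_less)
  ultimately show ?thesis
  proof eventually_elim
    case (elim \<tau>)
    show ?case
    proof
      fix y
      show "v \<le> wt_total \<tau> y"
        using wt_total_ge[of \<tau> y] elim by linarith
    qed
  qed
qed

lemma mean_shrink_le_simple:
  assumes "0 < \<tau>" "9 / 10 \<le> wt_total \<tau> y"
  shows "mean_shrink \<tau> y \<le> 10 / 9 * \<tau> * exp (y\<^sup>2 / 2)"
proof -
  have "2 / pi * \<tau> \<le> 1 * \<tau>"
    using assms pi_ge_two by (intro mult_right_mono) auto
  then have "exp (y\<^sup>2 / 2) * (2 / pi * \<tau>) / wt_total \<tau> y \<le> exp (y\<^sup>2 / 2) * (1 * \<tau>) / (9 / 10)"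
    using assms by (intro frac_le mult_left_mono) auto
  also have "\<dots> = 10 / 9 * \<tau> * exp (y\<^sup>2 / 2)"
    by simp
  finally show ?thesis
    using mean_shrink_le[OF assms(1), of y] by linarith
qed

lemma abs_post_mean: "0 < \<tau> \<Longrightarrow> \<bar>post_mean \<tau> y\<bar> = mean_shrink \<tau> y * \<bar>y\<bar>"
  using mean_shrink_nonneg[of \<tau> y] by (simp add: post_mean_eq abs_mult)

text \<open>Scales above 1 give standard deviations of at least about \<tau> and have posterior mass
  at least about one half, so \<open>radius_greater\<close> has limiting constant
  \<open>z_upper \<alpha>\<close>. Lowering it to 9/10 makes the inequality for \<alpha> strict;
  lowering it further to 4/5 pays for \<open>sqrt (1 + \<tau>\<^sup>2)\<close>.\<close>

lemma radius_ge_small: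
  assumes \<alpha>: "0 < \<alpha>" "\<alpha> < 1 / 2"
  shows "eventually (\<lambda>\<tau>. \<forall>y. 4 / 5 * z_upper \<alpha> * \<tau> \<le> radius \<alpha> \<tau> y) (at_right 0)"
proof -
  define z where "z = z_upper \<alpha>"
  have z: "0 < z" using z_upper_pos[OF \<alpha>] by (simp add: z_def)
  define b where "b = upper_tail (9 / 10 * z)"
  have b: "\<alpha> < b"
    using upper_tail_strict_anti[of "9 / 10 * z" z] upper_tail_z_upper[of \<alpha>] z \<alpha> by (simp add: b_def z_def)
  \<comment> \<open>At \<open>v = 1\<close> the product is \<open>b > \<alpha>\<close>, so some
    \<open>v < 1\<close> still works; \<open>wt_total\<close> eventually exceeds any such
    \<open>v\<close>.\<close>
  have "((\<lambda>v. (1 - 1 / (2 * v)) * (2 * b)) \<longlongrightarrow> (1 - 1 / (2 * 1)) * (2 * b)) (at_left (1::real))"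
    by (intro tendsto_intros) auto
  then have "eventually (\<lambda>v. (1 - 1 / (2 * v)) * (2 * b) > \<alpha>) (at_left 1)"
    using b by (intro order_tendstoD(1)) auto
  moreover have "eventually (\<lambda>v. v \<in> {0<..<1}) (at_left (1::real))"
    by (intro eventually_at_leftI[of 0]) auto
  ultimately have "eventually (\<lambda>v. (1 - 1 / (2 * v)) * (2 * b) > \<alpha> \<and> 0 < v \<and> v < 1) (at_left (1::real))"
    by eventually_elim auto
  then obtain v where v: "(1 - 1 / (2 * v)) * (2 * b) > \<alpha>" "0 < v" "v < 1"
    using eventually_happens'[OF trivial_limit_at_left_real] by blast
  have "((\<lambda>\<tau>. 4 / 5 * sqrt (1 + \<tau>\<^sup>2)) \<longlongrightarrow> 4 / 5) (at_right (0::real))"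
    by real_asymp
  then have "eventually (\<lambda>\<tau>. 4 / 5 * sqrt (1 + \<tau>\<^sup>2) < 9 / 10) (at_right (0::real))"
    by (rule order_tendstoD(2)) simp
  with wt_total_near_one[OF v(3)] eventually_at_right_less[of "0::real"]
  show ?thesis
  proof eventually_elim
    case (elim \<tau>)
    show ?case
    proof
      fix y
      interpret M: prob_space "mixing \<tau> y" by (rule prob_space_mixing)
      define k where "k = shrink \<tau> 1"
      have k: "0 < k" using elim by (simp add: k_def shrink_pos)
      have "sqrt k = \<tau> / sqrt (1 + \<tau>\<^sup>2)"
        using elim by (simp add: k_def shrink_def real_sqrt_divide)
      then have "4 / 5 * z * \<tau> / sqrt k = z * (4 / 5 * sqrt (1 + \<tau>\<^sup>2))"
        using elim by simp
      also have "\<dots> \<le> z * (9 / 10)"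
        using elim z by (intro mult_left_mono) auto
      finally have "b \<le> upper_tail (4 / 5 * z * \<tau> / sqrt k)"
        unfolding b_def by (intro upper_tail_anti) (simp add: mult.commute)
      moreover have "1 - 1 / (2 * v) \<le> measure (mixing \<tau> y) {l. k \<le> shrink \<tau> l}"
      proof -
        have "1 / (2 * wt_total \<tau> 0) \<le> 1 / (2 * v)"
          using elim v wt_total_pos[of \<tau> 0] by (intro divide_left_mono) auto
        then have "1 - 1 / (2 * v) \<le> measure (mixing \<tau> y) {1<..}"
          using mixing_above_one[of \<tau> y] elim by linarith
        also have "\<dots> \<le> measure (mixing \<tau> y) {l. k \<le> shrink \<tau> l}"
          using elim shrink_mono[of \<tau> 1] by (intro M.finite_measure_mono) (auto simp: k_def)
        finally show ?thesis .
      qed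
      ultimately have "(1 - 1 / (2 * v)) * (2 * b)
          \<le> measure (mixing \<tau> y) {l. k \<le> shrink \<tau> l} * (2 * upper_tail (4 / 5 * z * \<tau> / sqrt k))"
        using b \<alpha> by (intro mult_mono) auto
      then have "4 / 5 * z * \<tau> < radius \<alpha> \<tau> y"
        using v elim z \<alpha> k by (intro radius_greater[of _ _ _ k]) auto
      then show "4 / 5 * z_upper \<alpha> * \<tau> \<le> radius \<alpha> \<tau> y" by (simp add: z_def)
    qed
  qed
qed

lemma small_signal_covered:
  assumes \<alpha>: "0 < \<alpha>" "\<alpha> < 1 / 2" and kS: "0 < kS"
  shows "\<exists>\<eta>>0. eventually (\<lambda>\<tau>. \<forall>\<theta> y Z. 1 \<le> Z \<longrightarrow> \<tau> * Z < \<eta> \<longrightarrow> \<bar>\<theta>\<bar> \<le> kS * \<tau> \<longrightarrow> \<bar>y - \<theta>\<bar> \<le> Z \<longrightarrow>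
    \<bar>\<theta> - post_mean \<tau> y\<bar> \<le> 2.1 / z_upper \<alpha> * (kS + exp (Z\<^sup>2 / 2) * Z) * radius \<alpha> \<tau> y) (at_right 0)"
\<comment> \<open>The signal is at most \<open>d = kS * \<tau>\<close>, and this bound gives
  \<open>d * Z \<le> 1 / 20\<close>. With \<open>d \<le> 1 / 10\<close> the signal then raises
  \<open>y\<^sup>2 / 2\<close> above \<open>Z\<^sup>2 / 2\<close> by at most 0.055, and the
  exponential by at most a factor 11/10.\<close>
proof (intro exI[of _ "1 / (20 * kS)"] conjI)
  show "0 < 1 / (20 * kS)" using kS by simp
  have "((\<lambda>\<tau>. kS * \<tau>) \<longlongrightarrow> 0) (at_right (0::real))"
    by real_asymp
  then have "eventually (\<lambda>\<tau>. kS * \<tau> < 1 / 10) (at_right (0::real))"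
    by (rule order_tendstoD(2)) simp
  moreover have "eventually (\<lambda>\<tau>. \<forall>y. 9 / 10 \<le> wt_total \<tau> y) (at_right 0)"
    by (rule wt_total_near_one) simp
  ultimately show "eventually (\<lambda>\<tau>. \<forall>\<theta> y Z. 1 \<le> Z \<longrightarrow> \<tau> * Z < 1 / (20 * kS) \<longrightarrow> \<bar>\<theta>\<bar> \<le> kS * \<tau> \<longrightarrow> \<bar>y - \<theta>\<bar> \<le> Z \<longrightarrow>
    \<bar>\<theta> - post_mean \<tau> y\<bar> \<le> 2.1 / z_upper \<alpha> * (kS + exp (Z\<^sup>2 / 2) * Z) * radius \<alpha> \<tau> y) (at_right 0)"
    using radius_ge_small[OF \<alpha>] eventually_at_right_less[of "0::real"]
  proof eventually_elim
    case (elim \<tau>)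
    show ?case
    proof (intro allI impI)
      fix \<theta> y Z :: real
      assume Z: "1 \<le> Z" "\<tau> * Z < 1 / (20 * kS)" and \<theta>: "\<bar>\<theta>\<bar> \<le> kS * \<tau>" and y: "\<bar>y - \<theta>\<bar> \<le> Z"
      define z r E where "z = z_upper \<alpha>" and "r = radius \<alpha> \<tau> y" and "E = exp (Z\<^sup>2 / 2)"
      define d where "d = kS * \<tau>"
      have z: "0 < z" using z_upper_pos[OF \<alpha>] by (simp add: z_def)
      have r: "4 / 5 * z * \<tau> \<le> r" using elim by (simp add: r_def z_def)
      have \<tau>: "0 < \<tau>" using elim by simp
      have d: "0 \<le> d" "d \<le> 1 / 10" "d * Z \<le> 1 / 20"
        using elim kS Z by (auto simp: d_def field_simps)
      have ay: "\<bar>y\<bar> \<le> Z + d" using \<theta> y by (simp add: d_def)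
      have "y\<^sup>2 \<le> (Z + d)\<^sup>2"
        using ay abs_le_square_iff[of y "Z + d"] Z d by simp
      have "d\<^sup>2 \<le> 1 / 100"
        using power_mono[OF d(2,1), of 2] by (simp add: power2_eq_square)
      have "y\<^sup>2 / 2 \<le> Z\<^sup>2 / 2 + 55 / 1000"
      proof -
        have "(Z + d)\<^sup>2 = Z\<^sup>2 + 2 * (d * Z) + d\<^sup>2"
          by (simp add: power2_sum)
        then show ?thesis
          using \<open>y\<^sup>2 \<le> (Z + d)\<^sup>2\<close> \<open>d\<^sup>2 \<le> 1 / 100\<close> d(3) by linarith
      qed
      then have "exp (y\<^sup>2 / 2) \<le> E * exp (55 / 1000)"
        unfolding E_def by (simp add: exp_add[symmetric])
      also have "\<dots> \<le> E * (11 / 10)"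
        using exp_bound[of "55 / 1000"] by (intro mult_left_mono) (auto simp: E_def power2_eq_square)
      finally have e: "exp (y\<^sup>2 / 2) \<le> E * (11 / 10)" .
      have "mean_shrink \<tau> y \<le> 10 / 9 * \<tau> * exp (y\<^sup>2 / 2)"
        using elim by (intro mean_shrink_le_simple) auto
      also have "\<dots> \<le> 10 / 9 * \<tau> * (E * (11 / 10))"
        using e \<tau> by (intro mult_left_mono) auto
      finally have s: "mean_shrink \<tau> y \<le> 11 / 9 * (\<tau> * E)" by (simp add: mult.commute)
      have "\<bar>post_mean \<tau> y\<bar> = mean_shrink \<tau> y * \<bar>y\<bar>"
        using \<tau> by (rule abs_post_mean)
      also have "\<dots> \<le> 11 / 9 * (\<tau> * E) * (11 / 10 * Z)"
        using s ay d Z \<tau> mean_shrink_nonneg[of \<tau> y] by (intro mult_mono) (auto simp: E_def)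
      finally have m: "\<bar>post_mean \<tau> y\<bar> \<le> 121 / 90 * (\<tau> * (E * Z))" by (simp add: mult_ac)
      have EZ: "0 \<le> \<tau> * (E * Z)" using \<tau> Z by (simp add: E_def)
      have "\<bar>\<theta> - post_mean \<tau> y\<bar> \<le> kS * \<tau> + 121 / 90 * (\<tau> * (E * Z))"
        using m \<theta> by linarith
      \<comment> \<open>1.68 is 2.1 times the 4/5 from the bound on the radius, and it exceeds both
        1 and 121/90.\<close>
      also have "\<dots> \<le> 168 / 100 * (kS * \<tau>) + 168 / 100 * (\<tau> * (E * Z))"
        using EZ d(1) unfolding d_def by linarith
      also have "\<dots> = 2.1 / z * (kS + E * Z) * (4 / 5 * z * \<tau>)"
        using z by (simp add: field_simps)
      also have "\<dots> \<le> 2.1 / z * (kS + E * Z) * r"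
        using r z kS Z by (intro mult_left_mono) (auto simp: E_def)
      finally show "\<bar>\<theta> - post_mean \<tau> y\<bar> \<le> 2.1 / z_upper \<alpha> * (kS + exp (Z\<^sup>2 / 2) * Z) * radius \<alpha> \<tau> y"
        by (simp add: z_def r_def E_def)
    qed
  qed
qed

lemma posterior_scale_bounded_obs:
  assumes \<alpha>: "0 < \<alpha>" "\<alpha> < 1" and Y: "0 < Y"
  shows "\<exists>C>0. eventually (\<lambda>\<tau>. \<forall>y. \<bar>y\<bar> \<le> Y \<longrightarrow>
    \<bar>post_mean \<tau> y\<bar> \<le> C * \<tau> \<and> radius \<alpha> \<tau> y \<le> C * \<tau>) (at_right 0)"
proof -
  define E where "E = exp (Y\<^sup>2 / 2)"
  \<comment> \<open>The two terms in the hypothesis of \<open>radius_le\<close> get \<alpha>/2 each: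
    \<open>\<Lambda>\<close> bounds the posterior mass of larger scales, \<open>X\<close> the
    Chebyshev term, where \<tau> cancels because \<open>k\<close> and
    \<open>(X * \<tau>)\<^sup>2\<close> are both of order \<open>\<tau>\<^sup>2\<close>.\<close>
  define \<Lambda> where "\<Lambda> = 4 * E / \<alpha>"
  define X where "X = \<Lambda> * sqrt (2 * (1 + Y\<^sup>2) / \<alpha>)"
  have E: "0 < E" by (simp add: E_def)
  have \<Lambda>: "0 < \<Lambda>" using E \<alpha> by (simp add: \<Lambda>_def)
  have "0 < 2 * (1 + Y\<^sup>2) / \<alpha>"
    using \<alpha> by (intro divide_pos_pos mult_pos_pos one_plus_square_pos) auto
  then have X: "0 < X" "X\<^sup>2 = \<Lambda>\<^sup>2 * (2 * (1 + Y\<^sup>2) / \<alpha>)"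
    unfolding X_def power_mult_distrib using \<Lambda> by (simp_all only: mult_pos_pos real_sqrt_gt_zero real_sqrt_pow2 less_imp_le)
  show ?thesis
  proof (intro exI[of _ "X + 10 / 9 * E * Y"] conjI)
    show "0 < X + 10 / 9 * E * Y" using X E Y by (intro add_pos_pos) auto
    have "eventually (\<lambda>\<tau>. \<forall>y. 9 / 10 \<le> wt_total \<tau> y) (at_right 0)"
      by (rule wt_total_near_one) simp
    then show "eventually (\<lambda>\<tau>. \<forall>y. \<bar>y\<bar> \<le> Y \<longrightarrow>
        \<bar>post_mean \<tau> y\<bar> \<le> (X + 10 / 9 * E * Y) * \<tau> \<and> radius \<alpha> \<tau> y \<le> (X + 10 / 9 * E * Y) * \<tau>) (at_right 0)"
      using eventually_at_right_less[of "0::real"]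
    proof eventually_elim
      case (elim \<tau>)
      then have \<tau>: "0 < \<tau>" by simp
      show ?case
      proof (intro allI impI)
        fix y :: real assume y: "\<bar>y\<bar> \<le> Y"
        interpret M: prob_space "mixing \<tau> y" by (rule prob_space_mixing)
        have y2: "y\<^sup>2 \<le> Y\<^sup>2" using abs_le_square_iff[of y Y] y Y by simp
        then have e: "exp (y\<^sup>2 / 2) \<le> E" by (simp add: E_def)
        have "mean_shrink \<tau> y \<le> 10 / 9 * \<tau> * exp (y\<^sup>2 / 2)"
          using elim by (intro mean_shrink_le_simple) auto
        also have "\<dots> \<le> 10 / 9 * \<tau> * E"
          using e \<tau> by (intro mult_left_mono) auto
        finally have m: "\<bar>post_mean \<tau> y\<bar> \<le> 10 / 9 * \<tau> * E * Y"
          unfolding abs_post_mean[OF \<tau>] using y mean_shrink_nonneg[of \<tau> y] \<tau> E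
          by (intro mult_mono) auto
        define k where "k = shrink \<tau> \<Lambda>"
        have "(\<Lambda> * \<tau>)\<^sup>2 / (1 + (\<Lambda> * \<tau>)\<^sup>2) \<le> (\<Lambda> * \<tau>)\<^sup>2 / 1"
          by (intro divide_left_mono) auto
        then have k: "0 \<le> k" "k \<le> (\<Lambda> * \<tau>)\<^sup>2"
          using shrink_nonneg by (auto simp: k_def shrink_def)
        have "measure (mixing \<tau> y) {l. k < shrink \<tau> l} \<le> measure (mixing \<tau> y) {\<Lambda><..}"
        proof (rule M.finite_measure_mono_AE)
          show "AE l in mixing \<tau> y. l \<in> {l. k < shrink \<tau> l} \<longrightarrow> l \<in> {\<Lambda><..}"
            using AE_mixing_pos
          proof eventually_elim
            case (elim l)
            then show ?case
              using shrink_mono[OF \<tau>, of l \<Lambda>] by (auto simp: k_def not_less[symmetric])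
          qed
        qed auto
        also have "\<dots> \<le> exp (y\<^sup>2 / 2) / (\<Lambda> * wt_total \<tau> y)"
          by (rule mixing_tail_le[OF \<Lambda>])
        also have "\<dots> \<le> E / (\<Lambda> * (1 / 2))"
        proof (intro frac_le mult_left_mono)
          have "9 / 10 \<le> wt_total \<tau> y" using elim by simp
          then show "1 / 2 \<le> wt_total \<tau> y" by simp
        qed (use e \<Lambda> E in auto)
        also have "\<dots> = \<alpha> / 2"
          using E \<alpha> by (simp add: \<Lambda>_def)
        finally have t: "measure (mixing \<tau> y) {l. k < shrink \<tau> l} \<le> \<alpha> / 2" .
        have "k * (1 + y\<^sup>2) / (X * \<tau>)\<^sup>2 \<le> (\<Lambda> * \<tau>)\<^sup>2 * (1 + Y\<^sup>2) / (X * \<tau>)\<^sup>2"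
          using k y2 by (intro divide_right_mono mult_mono) auto
        also have "\<dots> = \<alpha> / 2"
        proof -
          have "(X * \<tau>)\<^sup>2 = (\<Lambda> * \<tau>)\<^sup>2 * (1 + Y\<^sup>2) * (2 / \<alpha>)"
            by (simp add: power_mult_distrib X(2))
          moreover have "(\<Lambda> * \<tau>)\<^sup>2 * (1 + Y\<^sup>2) \<noteq> 0"
            using \<Lambda> \<tau> one_plus_square_pos[of Y] by (simp del: one_plus_square_pos)
          moreover have "c / (c * (2 / \<alpha>)) = \<alpha> / 2" if "c \<noteq> 0" for c
            using that by simp
          ultimately show ?thesis by simp
        qed
        finally have "measure (mixing \<tau> y) {l. k < shrink \<tau> l} + k * (1 + y\<^sup>2) / (X * \<tau>)\<^sup>2 \<le> \<alpha>"
          using t by linarith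
        then have "radius \<alpha> \<tau> y \<le> X * \<tau> + \<bar>post_mean \<tau> y\<bar>"
          using X(1) \<tau> k \<alpha> by (intro radius_le) auto
        then show "\<bar>post_mean \<tau> y\<bar> \<le> (X + 10 / 9 * E * Y) * \<tau> \<and> radius \<alpha> \<tau> y \<le> (X + 10 / 9 * E * Y) * \<tau>"
        proof -
          have "(X + 10 / 9 * E * Y) * \<tau> = X * \<tau> + 10 / 9 * \<tau> * E * Y"
            by (simp add: algebra_simps)
          moreover have "0 < X * \<tau>" using X(1) \<tau> by simp
          ultimately show ?thesis
            using m \<open>radius \<alpha> \<tau> y \<le> X * \<tau> + \<bar>post_mean \<tau> y\<bar>\<close> by linarith
        qed
      qed
    qed
  qed
qed

lemma posterior_scale_subthreshold:
  assumes \<alpha>: "0 < \<alpha>" "\<alpha> < 1" and k: "0 < k" "k < 1" and e: "0 < e"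
  shows "eventually (\<lambda>\<tau>. \<forall>y. \<bar>y\<bar> \<le> k * zeta \<tau> \<longrightarrow>
    \<bar>post_mean \<tau> y\<bar> \<le> e \<and> radius \<alpha> \<tau> y \<le> e) (at_right 0)"
proof -
  \<comment> \<open>\<open>(q \<tau>)\<^sup>2\<close> bounds the mean of \<open>shrink\<close> in
    this range, so by Markov's inequality at level \<open>q \<tau>\<close> the mass above that level
    is at most \<open>q \<tau>\<close>. Being a positive power of \<tau>, it also beats the
    logarithmic size of \<open>y\<^sup>2\<close>.\<close>
  define q where "q \<tau> = sqrt (10 / 9 * \<tau> powr (1 - k\<^sup>2))" for \<tau>
  have k2: "0 < 1 - k\<^sup>2" using k by (simp add: power_less_one_iff)
  have "((\<lambda>\<tau>. q \<tau> + q \<tau> * (1 + k\<^sup>2 * (2 * ln (1 / \<tau>))) / (e / 2)\<^sup>2) \<longlongrightarrow> 0) (at_right 0)"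
    unfolding q_def using k2 e by real_asymp
  then have ev1: "eventually (\<lambda>\<tau>. q \<tau> + q \<tau> * (1 + k\<^sup>2 * (2 * ln (1 / \<tau>))) / (e / 2)\<^sup>2 < \<alpha>) (at_right 0)"
    using \<alpha> by (intro order_tendstoD(2)) auto
  have "((\<lambda>\<tau>. (10 / 9 * \<tau> powr (1 - k\<^sup>2)) * (k * sqrt (2 * ln (1 / \<tau>)))) \<longlongrightarrow> 0) (at_right 0)"
    using k2 k by real_asymp
  then have ev2: "eventually (\<lambda>\<tau>. (10 / 9 * \<tau> powr (1 - k\<^sup>2)) * (k * sqrt (2 * ln (1 / \<tau>))) < e / 2) (at_right 0)"
    using e by (intro order_tendstoD(2)) auto
  have ev3: "eventually (\<lambda>\<tau>. \<forall>y. 9 / 10 \<le> wt_total \<tau> y) (at_right 0)"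
    by (rule wt_total_near_one) simp
  have ev4: "eventually (\<lambda>\<tau>::real. \<tau> \<in> {0<..<1}) (at_right 0)"
    by (rule eventually_at_rightI[of 0 1]) auto
  show ?thesis
    using ev1 ev2 ev3 ev4
  proof eventually_elim
    case (elim \<tau>)
    then have \<tau>: "0 < \<tau>" "\<tau> < 1" by auto
    show ?case
    proof (intro allI impI)
      fix y :: real assume y: "\<bar>y\<bar> \<le> k * zeta \<tau>"
      interpret M: prob_space "mixing \<tau> y" by (rule prob_space_mixing)
      have "\<bar>y\<bar>\<^sup>2 \<le> (k * zeta \<tau>)\<^sup>2"
        using y by (intro power_mono) auto
      then have y2: "y\<^sup>2 \<le> k\<^sup>2 * (2 * ln (1 / \<tau>))"
        using \<tau> by (simp add: power_mult_distrib zeta_square)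
      then have "exp (y\<^sup>2 / 2) \<le> exp (k\<^sup>2 * ln (1 / \<tau>))" by simp
      also have "\<dots> = \<tau> powr (- k\<^sup>2)"
        using \<tau> by (simp add: powr_def ln_div)
      finally have ex: "exp (y\<^sup>2 / 2) \<le> \<tau> powr (- k\<^sup>2)" .
      have "mean_shrink \<tau> y \<le> 10 / 9 * \<tau> * exp (y\<^sup>2 / 2)"
        using elim by (intro mean_shrink_le_simple) auto
      also have "\<dots> \<le> 10 / 9 * \<tau> * \<tau> powr (- k\<^sup>2)"
        using ex \<tau> by (intro mult_left_mono) auto
      also have "\<dots> = 10 / 9 * \<tau> powr (1 - k\<^sup>2)"
        using \<tau> powr_add[of \<tau> 1 "- k\<^sup>2"] by simp
      finally have s: "mean_shrink \<tau> y \<le> 10 / 9 * \<tau> powr (1 - k\<^sup>2)" .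
      have "\<bar>post_mean \<tau> y\<bar> \<le> (10 / 9 * \<tau> powr (1 - k\<^sup>2)) * (k * zeta \<tau>)"
        unfolding abs_post_mean[OF \<tau>(1)] using s y mean_shrink_nonneg[of \<tau> y]
        by (intro mult_mono) auto
      then have m: "\<bar>post_mean \<tau> y\<bar> \<le> e / 2"
        using elim by (simp add: zeta_def)
      have q: "0 < q \<tau>" "(q \<tau>)\<^sup>2 = 10 / 9 * \<tau> powr (1 - k\<^sup>2)"
        using \<tau> by (auto simp: q_def)
      have "measure (mixing \<tau> y) {l. q \<tau> < shrink \<tau> l} \<le> measure (mixing \<tau> y) {l \<in> space (mixing \<tau> y). q \<tau> \<le> shrink \<tau> l}"
        by (intro M.finite_measure_mono) auto
      also have "\<dots> \<le> mean_shrink \<tau> y / q \<tau>"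
        unfolding mean_shrink_def
        using q integrable_shrink shrink_nonneg by (intro integral_Markov_inequality_measure[where A = "{}"]) auto
      also have "\<dots> \<le> (q \<tau>)\<^sup>2 / q \<tau>"
        using s q by (intro divide_right_mono) auto
      also have "\<dots> = q \<tau>" using q by (simp add: power2_eq_square)
      finally have t: "measure (mixing \<tau> y) {l. q \<tau> < shrink \<tau> l} \<le> q \<tau>" .
      have "q \<tau> * (1 + y\<^sup>2) / (e / 2)\<^sup>2 \<le> q \<tau> * (1 + k\<^sup>2 * (2 * ln (1 / \<tau>))) / (e / 2)\<^sup>2"
        using q y2 by (intro divide_right_mono mult_left_mono) auto
      then have "measure (mixing \<tau> y) {l. q \<tau> < shrink \<tau> l} + q \<tau> * (1 + y\<^sup>2) / (e / 2)\<^sup>2 \<le> \<alpha>"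
        using t elim(1) by linarith
      then have "radius \<alpha> \<tau> y \<le> e / 2 + \<bar>post_mean \<tau> y\<bar>"
        using q(1) \<tau> e \<alpha> by (intro radius_le) auto
      then show "\<bar>post_mean \<tau> y\<bar> \<le> e \<and> radius \<alpha> \<tau> y \<le> e"
        using m e by auto
    qed
  qed
qed

lemma large_signal_covered:
  assumes \<alpha>: "0 < \<alpha>" "\<alpha> < 1 / 2" and k: "1 < k"
  shows "\<exists>T. \<forall>\<tau> \<theta> y Z. 0 < \<tau> \<longrightarrow> \<tau> < 1 \<longrightarrow> T \<le> \<bar>y\<bar> \<longrightarrow> k * zeta \<tau> \<le> \<bar>y\<bar> \<longrightarrow> 1 \<le> Z \<longrightarrow>
    \<bar>y - \<theta>\<bar> \<le> Z \<longrightarrow> \<bar>\<theta> - post_mean \<tau> y\<bar> \<le> 1.1 / z_upper \<alpha> * Z * radius \<alpha> \<tau> y"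
proof -
  obtain T where T: "1 \<le> T" "\<And>\<tau> y. 0 < \<tau> \<Longrightarrow> \<tau> < 1 \<Longrightarrow> T \<le> \<bar>y\<bar> \<Longrightarrow> k * zeta \<tau> \<le> \<bar>y\<bar> \<Longrightarrow>
      \<bar>y\<bar> * (1 - mean_shrink \<tau> y) \<le> 3 / 100"
    using unshrink_vanishes[OF k, of "3 / 100"] by auto
  show ?thesis
  proof (intro exI[of _ T] allI impI)
    fix \<tau> \<theta> y Z :: real
    assume \<tau>: "0 < \<tau>" "\<tau> < 1" and y: "T \<le> \<bar>y\<bar>" "k * zeta \<tau> \<le> \<bar>y\<bar>" and Z: "1 \<le> Z" "\<bar>y - \<theta>\<bar> \<le> Z"
    interpret M: prob_space "mixing \<tau> y" by (rule prob_space_mixing)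
    define z r where "z = z_upper \<alpha>" and "r = radius \<alpha> \<tau> y"
    have z: "0 < z" "upper_tail z = \<alpha>"
      using z_upper_pos[OF \<alpha>] upper_tail_z_upper[of \<alpha>] \<alpha> by (auto simp: z_def)
    have s: "\<bar>y\<bar> * (1 - mean_shrink \<tau> y) \<le> 3 / 100"
      using T \<tau> y by simp
    have "mean_shrink \<tau> y \<le> (\<integral>l. 1 \<partial>mixing \<tau> y)"
      unfolding mean_shrink_def using shrink_less_1[of \<tau>]
      by (intro integral_mono integrable_shrink) (auto intro: less_imp_le)
    then have s0: "0 \<le> 1 - mean_shrink \<tau> y" by (simp add: M.prob_space[simplified])
    have "1 * (1 - mean_shrink \<tau> y) \<le> \<bar>y\<bar> * (1 - mean_shrink \<tau> y)"
      using T y s0 by (intro mult_right_mono) auto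
    then have s1: "1 - mean_shrink \<tau> y \<le> 3 / 100" using s by simp
    \<comment> \<open>\<open>1 - k0\<close> is about 0.093, so Markov's inequality with mean 3/100
      leaves more than half of the mass on variances at least \<open>k0\<close>. This yields the
      radius \<open>20 / 21 * z\<close>.\<close>
    define k0 :: real where "k0 = (20 / 21)\<^sup>2"
    have "measure (mixing \<tau> y) {l. shrink \<tau> l < k0} \<le> measure (mixing \<tau> y) {l \<in> space (mixing \<tau> y). 1 - k0 \<le> 1 - shrink \<tau> l}"
      by (intro M.finite_measure_mono) auto
    also have "\<dots> \<le> (\<integral>l. 1 - shrink \<tau> l \<partial>mixing \<tau> y) / (1 - k0)"
      using shrink_less_1[of \<tau>] integrable_shrink
      by (intro integral_Markov_inequality_measure[where A = "{}"]) (auto simp: k0_def power2_eq_square intro: less_imp_le)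
    also have "(\<integral>l. 1 - shrink \<tau> l \<partial>mixing \<tau> y) = 1 - mean_shrink \<tau> y"
      unfolding mean_shrink_def
      by (subst Bochner_Integration.integral_diff) (auto simp: integrable_shrink M.prob_space[simplified])
    also have "(1 - mean_shrink \<tau> y) / (1 - k0) \<le> (3 / 100) / (1 - k0)"
      using s1 by (intro divide_right_mono) (auto simp: k0_def power2_eq_square)
    also have "\<dots> < 1 / 2" by (simp add: k0_def power2_eq_square)
    finally have "measure (mixing \<tau> y) {l. shrink \<tau> l < k0} < 1 / 2" .
    moreover have "{l. k0 \<le> shrink \<tau> l} = space (mixing \<tau> y) - {l. shrink \<tau> l < k0}" by auto
    then have "measure (mixing \<tau> y) {l. k0 \<le> shrink \<tau> l} = 1 - measure (mixing \<tau> y) {l. shrink \<tau> l < k0}"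
      by (simp only:) (rule M.prob_compl, measurable)
    ultimately have "1 / 2 < measure (mixing \<tau> y) {l. k0 \<le> shrink \<tau> l}" by simp
    then have "1 / 2 * (2 * \<alpha>) < measure (mixing \<tau> y) {l. k0 \<le> shrink \<tau> l} * (2 * \<alpha>)"
      using \<alpha> by (intro mult_strict_right_mono) auto
    moreover have "20 / 21 * z / sqrt k0 = z" by (simp add: k0_def)
    ultimately have r: "20 / 21 * z < r"
      unfolding r_def using \<tau> \<alpha> z by (intro radius_greater[of _ _ _ k0]) (auto simp: k0_def)
    have "y - post_mean \<tau> y = y * (1 - mean_shrink \<tau> y)"
      by (simp add: post_mean_eq[OF \<tau>(1)] algebra_simps)
    then have "\<bar>y - post_mean \<tau> y\<bar> \<le> 3 / 100"
      using s s0 by (simp add: abs_mult)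
    then have "\<bar>\<theta> - post_mean \<tau> y\<bar> \<le> Z + 3 / 100" using Z by linarith
    \<comment> \<open>22/21 is the blow-up 1.1 times 20/21; it covers 1 + 3/100 since
      \<open>Z\<close> is at least 1.\<close>
    also have "\<dots> \<le> 22 / 21 * Z" using Z by simp
    also have "\<dots> = 1.1 / z * Z * (20 / 21 * z)" using z by (simp add: field_simps)
    also have "\<dots> \<le> 1.1 / z * Z * r" using r z Z by (intro mult_left_mono) auto
    finally show "\<bar>\<theta> - post_mean \<tau> y\<bar> \<le> 1.1 / z_upper \<alpha> * Z * radius \<alpha> \<tau> y"
      by (simp add: z_def r_def)
  qed
qed

section \<open>Measurability and the fraction of covered coordinates\<close>

lemma wt_measurable2 [measurable]:
  "(\<lambda>p. wt \<tau> (fst p) (snd p)) \<in> borel_measurable (borel \<Otimes>\<^sub>M borel)"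
  unfolding wt_def by measurable

lemma wt_total_measurable [measurable]: "wt_total \<tau> \<in> borel_measurable borel"
proof -
  have "(\<lambda>y. \<integral>l. wt \<tau> (fst (y, l)) (snd (y, l)) \<partial>half_cauchy) \<in> borel_measurable borel"
    by (rule half_cauchy.borel_measurable_lebesgue_integral) measurable
  then show ?thesis by (simp add: wt_total_def[abs_def])
qed

lemma post_mean_measurable:
  assumes "0 < \<tau>"
  shows "post_mean \<tau> \<in> borel_measurable borel"
proof -
  have [measurable]: "(\<lambda>y. \<integral>l. wt \<tau> (fst (y, l)) (snd (y, l)) * shrink \<tau> l \<partial>half_cauchy) \<in> borel_measurable borel"
    by (rule half_cauchy.borel_measurable_lebesgue_integral) measurable
  have "post_mean \<tau> = (\<lambda>y. (\<integral>l. wt \<tau> (fst (y, l)) (snd (y, l)) * shrink \<tau> l \<partial>half_cauchy) / wt_total \<tau> y * y)"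
    using assms by (auto simp: post_mean_eq mean_shrink_def integral_mixing)
  then show ?thesis by simp
qed

text \<open>The centre of the interval moves with \<open>y\<close>, so the mass is written as an
  iterated integral of an indicator jointly measurable in \<open>y\<close>, the scale and the normal
  variable.\<close>

lemma central_mass_measurable:
  assumes "0 < \<tau>"
  shows "(\<lambda>y. central_mass \<tau> y x) \<in> borel_measurable borel"
proof -
  note [measurable] = post_mean_measurable[OF assms]
  define s where "s y l z = shrink \<tau> l * y + sqrt (shrink \<tau> l) * z" for y l z
  define J where "J y l = (\<integral>z. indicat_real {..x} \<bar>s y l z - post_mean \<tau> y\<bar> \<partial>normal 0 1)" for y l
  have [measurable]: "(\<lambda>p. J (fst p) (snd p)) \<in> borel_measurable (borel \<Otimes>\<^sub>M borel)"
    unfolding J_def s_def by (rule std_normal.borel_measurable_lebesgue_integral) measurable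
  have [measurable]: "(\<lambda>y. \<integral>l. wt \<tau> (fst (y, l)) (snd (y, l)) * J (fst (y, l)) (snd (y, l)) \<partial>half_cauchy) \<in> borel_measurable borel"
    by (rule half_cauchy.borel_measurable_lebesgue_integral) measurable
  have J: "measure (normal 0 1) {z. s y l z \<in> {\<theta>. \<bar>\<theta> - post_mean \<tau> y\<bar> \<le> x}} = J y l" for y l
  proof -
    have "J y l = (\<integral>z. indicat_real {z. s y l z \<in> {\<theta>. \<bar>\<theta> - post_mean \<tau> y\<bar> \<le> x}} z \<partial>normal 0 1)"
      unfolding J_def by (intro Bochner_Integration.integral_cong) (auto simp: indicator_def)
    then show ?thesis by simp
  qed
  have "central_mass \<tau> y x = (\<integral>l. wt \<tau> y l * J y l \<partial>half_cauchy) / wt_total \<tau> y" for y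
  proof -
    have m: "J y \<in> borel_measurable borel"
      using measurable_normal_section[of "{\<theta>. \<bar>\<theta> - post_mean \<tau> y\<bar> \<le> x}" \<tau> y]
      unfolding J[symmetric] s_def by simp
    have "central_mass \<tau> y x = (\<integral>l. J y l \<partial>mixing \<tau> y)"
      unfolding central_mass_def J[symmetric] s_def by (rule measure_posterior[OF assms]) simp
    then show ?thesis by (simp add: integral_mixing[OF m])
  qed
  then have "(\<lambda>y. central_mass \<tau> y x) = (\<lambda>y. (\<integral>l. wt \<tau> (fst (y, l)) (snd (y, l)) * J (fst (y, l)) (snd (y, l)) \<partial>half_cauchy) / wt_total \<tau> y)"
    by simp
  then show ?thesis by simp
qed

text \<open>By \<open>radius_le_iff\<close> a sublevel set of the radius is a superlevel set of the
  central mass.\<close>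

lemma radius_measurable:
  assumes "0 < \<tau>" "0 < \<alpha>" "\<alpha> < 1"
  shows "radius \<alpha> \<tau> \<in> borel_measurable borel"
proof (rule borel_measurable_iff_le[THEN iffD2], rule allI)
  fix x
  note [measurable] = central_mass_measurable[OF assms(1)]
  have "{y \<in> space borel. 1 - \<alpha> \<le> central_mass \<tau> y x} \<in> sets borel"
    by measurable
  then show "{y \<in> space borel. radius \<alpha> \<tau> y \<le> x} \<in> sets borel"
    by (simp add: radius_le_iff[OF assms])
qed

lemma credible_interval_pred:
  assumes "0 < \<tau>" "0 < \<alpha>" "\<alpha> < 1"
  shows "Measurable.pred borel (\<lambda>y. \<theta> \<in> credible_interval \<alpha> \<tau> L y)"
proof -
  note [measurable] = post_mean_measurable[OF assms(1)] radius_measurable[OF assms]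
  show ?thesis
    unfolding credible_interval_def by measurable
qed

section \<open>The product law of the observations\<close>

lemma sets_obs_law [measurable_cong]: "sets (obs_law n \<theta>) = sets (PiM {1..n} (\<lambda>_. borel))"
  unfolding obs_law_def by (intro sets_PiM_cong) auto

lemma prob_space_obs_law: "prob_space (obs_law n \<theta>)"
  unfolding obs_law_def by (intro prob_space_PiM prob_space_normal) simp

lemma obs_component_measurable:
  "i \<in> {1..n} \<Longrightarrow> (\<lambda>Y. Y i) \<in> borel_measurable (obs_law n \<theta>)"
  using measurable_component_singleton[of i "{1..n}" "\<lambda>_. borel :: real measure"]
  by (simp cong: measurable_cong_sets add: sets_obs_law)

lemma obs_pred_measurable:
  assumes "i \<in> {1..n}" "Measurable.pred borel P"
  shows "Measurable.pred (obs_law n \<theta>) (\<lambda>Y. P (Y i))"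
  using measurable_compose[OF obs_component_measurable[OF assms(1)] assms(2)] .

lemma obs_component_prob:
  assumes i: "i \<in> {1..n}" and P: "Measurable.pred borel P"
  shows "measure (obs_law n \<theta>) {Y \<in> space (obs_law n \<theta>). P (Y i - \<theta> i)} = measure (normal 0 1) {z. P z}"
proof -
  have P' [measurable]: "Measurable.pred borel (\<lambda>y. P (y - \<theta> i))"
    using P by measurable
  have N: "distr (obs_law n \<theta>) (normal (\<theta> i) 1) (\<lambda>Y. Y i) = normal (\<theta> i) 1"
    unfolding obs_law_def using i by (intro distr_PiM_component prob_space_normal) auto
  have "measure (normal (\<theta> i) 1) {y. P (y - \<theta> i)} = measure (distr (obs_law n \<theta>) (normal (\<theta> i) 1) (\<lambda>Y. Y i)) {y. P (y - \<theta> i)}"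
    by (simp add: N)
  also have "\<dots> = measure (obs_law n \<theta>) ((\<lambda>Y. Y i) -` {y. P (y - \<theta> i)} \<inter> space (obs_law n \<theta>))"
    using obs_component_measurable[OF i] P'
    by (intro measure_distr) (auto cong: measurable_cong_sets simp: pred_def)
  also have "(\<lambda>Y. Y i) -` {y. P (y - \<theta> i)} \<inter> space (obs_law n \<theta>) = {Y \<in> space (obs_law n \<theta>). P (Y i - \<theta> i)}"
    by auto
  finally have "measure (obs_law n \<theta>) {Y \<in> space (obs_law n \<theta>). P (Y i - \<theta> i)}
      = measure (distr (normal 0 1) borel (\<lambda>z. \<theta> i + 1 * z)) {y. P (y - \<theta> i)}"
    by (subst normal_affine) auto
  also have "\<dots> = measure (normal 0 1) ((\<lambda>z. \<theta> i + 1 * z) -` {y. P (y - \<theta> i)} \<inter> space (normal 0 1))"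
    using P' by (intro measure_distr) (auto simp: pred_def)
  also have "(\<lambda>z. \<theta> i + 1 * z) -` {y. P (y - \<theta> i)} \<inter> space (normal 0 1) = {z. P z}"
    by auto
  finally show ?thesis .
qed

lemma obs_indep:
  assumes "A \<subseteq> {1..n}" "A \<noteq> {}"
  shows "prob_space.indep_vars (obs_law n \<theta>) (\<lambda>_. borel) (\<lambda>i Y. Y i) A"
proof -
  interpret P: prob_space "obs_law n \<theta>" by (rule prob_space_obs_law)
  have ne: "{1..n} \<noteq> {}" using assms by auto
  have "P.indep_vars (\<lambda>i. normal (\<theta> i) 1) (\<lambda>i Y. Y i) {1..n}"
  proof (rule P.indep_vars_iff_distr_eq_PiM'[OF ne, THEN iffD2])
    show "P.random_variable (normal (\<theta> i) 1) (\<lambda>Y. Y i)" if "i \<in> {1..n}" for i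
      using obs_component_measurable[OF that] by (auto cong: measurable_cong_sets)
    \<comment> \<open>Points of the product space are extensional, so the joint map of the
      coordinates is the identity and the joint law is the product measure itself.\<close>
    have "distr (obs_law n \<theta>) (\<Pi>\<^sub>M i\<in>{1..n}. normal (\<theta> i) 1) (\<lambda>Y. \<lambda>i\<in>{1..n}. Y i)
        = distr (obs_law n \<theta>) (obs_law n \<theta>) (\<lambda>Y. Y)"
    proof (intro distr_cong)
      fix Y assume "Y \<in> space (obs_law n \<theta>)"
      then show "(\<lambda>i\<in>{1..n}. Y i) = Y"
        unfolding obs_law_def space_PiM by (rule PiE_restrict)
    qed (auto simp: obs_law_def)
    also have "\<dots> = (\<Pi>\<^sub>M i\<in>{1..n}. distr (obs_law n \<theta>) (normal (\<theta> i) 1) (\<lambda>Y. Y i))"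
      unfolding obs_law_def distr_id
      by (intro PiM_cong refl distr_PiM_component[symmetric] prob_space_normal) auto
    finally show "distr (obs_law n \<theta>) (\<Pi>\<^sub>M i\<in>{1..n}. normal (\<theta> i) 1) (\<lambda>Y. \<lambda>i\<in>{1..n}. Y i)
      = (\<Pi>\<^sub>M i\<in>{1..n}. distr (obs_law n \<theta>) (normal (\<theta> i) 1) (\<lambda>Y. Y i))" .
  qed
  then have "P.indep_vars (\<lambda>_. borel) (\<lambda>i Y. Y i) {1..n}"
    by (rule P.indep_vars_compose2[where Y = "\<lambda>_ x. x"]) (auto cong: measurable_cong_sets)
  then show ?thesis
    using assms(1) by (rule P.indep_vars_subset)
qed

lemma coverage_measurable:
  assumes "0 < \<tau>" "0 < \<alpha>" "\<alpha> < 1" "A \<subseteq> {1..n}"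
  shows "(\<lambda>Y. coverage \<alpha> \<tau> L \<theta> A Y) \<in> borel_measurable (obs_law n \<theta>)"
proof -
  have fin: "finite A" using assms(4) finite_subset by blast
  have "real (card {i \<in> A. \<theta> i \<in> credible_interval \<alpha> \<tau> L (Y i)})
      = (\<Sum>i\<in>A. if \<theta> i \<in> credible_interval \<alpha> \<tau> L (Y i) then 1 else 0)" for Y
    using fin by (simp add: sum.If_cases Int_def)
  moreover have "(\<lambda>Y. \<Sum>i\<in>A. if \<theta> i \<in> credible_interval \<alpha> \<tau> L (Y i) then 1 else 0 :: real) \<in> borel_measurable (obs_law n \<theta>)"
  proof (intro borel_measurable_sum measurable_If)
    fix i assume "i \<in> A"
    then have "Measurable.pred (obs_law n \<theta>) (\<lambda>Y. \<theta> i \<in> credible_interval \<alpha> \<tau> L (Y i))"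
      using assms(4) by (intro obs_pred_measurable credible_interval_pred assms) auto
    then show "{Y \<in> space (obs_law n \<theta>). \<theta> i \<in> credible_interval \<alpha> \<tau> L (Y i)} \<in> sets (obs_law n \<theta>)"
      by (simp add: pred_def)
  qed auto
  ultimately show ?thesis
    unfolding coverage_def by (cases "A = {}") simp_all
qed

text \<open>What is counted are coordinates with large noise instead of missed ones: by
  \<open>cover\<close> every missed coordinate is among them, and they are independent events of the
  same known probability. Markov's inequality needs nothing about the number of coordinates; in the
  second claim the mean takes half of \<gamma> and the other half is the deviation for Hoeffding's
  inequality.\<close>

lemma coverage_prob:
  assumes "0 < \<tau>" "0 < \<alpha>" "\<alpha> < 1" and A: "A \<subseteq> {1..n}" and \<gamma>: "0 < \<gamma>" and x: "0 \<le> x"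
    and cover: "\<And>i y. i \<in> A \<Longrightarrow> \<bar>y - \<theta> i\<bar> \<le> x \<Longrightarrow> \<theta> i \<in> credible_interval \<alpha> \<tau> L y"
  defines "p \<equiv> measure (obs_law n \<theta>) {Y \<in> space (obs_law n \<theta>). coverage \<alpha> \<tau> L \<theta> A Y \<ge> 1 - \<gamma>}"
  shows "1 - 2 * upper_tail x / \<gamma> \<le> p"
    and "2 * upper_tail x \<le> \<gamma> / 2 \<Longrightarrow> 1 - exp (- (\<gamma>\<^sup>2 / 2 * card A)) \<le> p"
proof -
  interpret P: prob_space "obs_law n \<theta>" by (rule prob_space_obs_law)
  note [measurable] = coverage_measurable[OF assms(1-3) A]
  define q where "q = 2 * upper_tail x"
  have q: "0 \<le> q" by (simp add: q_def upper_tail_def)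
  have fin: "finite A" using A finite_subset by blast
  define X where "X i Y = indicat_real {z. x < \<bar>z\<bar>} (Y i - \<theta> i)" for i and Y :: "nat \<Rightarrow> real"
  have X01: "0 \<le> X i Y" "X i Y \<le> 1" for i Y by (auto simp: X_def indicator_def)
  have Xm: "X i \<in> borel_measurable (obs_law n \<theta>)" if "i \<in> A" for i
  proof -
    have [measurable]: "(\<lambda>Y. Y i) \<in> borel_measurable (obs_law n \<theta>)"
      using that A by (intro obs_component_measurable) auto
    show ?thesis unfolding X_def[abs_def] by measurable
  qed
  have Xi: "integrable (obs_law n \<theta>) (X i)" if "i \<in> A" for i
    using X01 Xm[OF that] by (intro P.integrable_const_bound[where B = 1]) auto
  have EX: "P.expectation (X i) = q" if "i \<in> A" for i
  proof -
    have "P.expectation (X i) = P.expectation (indicat_real {Y \<in> space (obs_law n \<theta>). x < \<bar>Y i - \<theta> i\<bar>})"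
      by (intro Bochner_Integration.integral_cong) (auto simp: X_def indicator_def)
    also have "\<dots> = P.prob {Y \<in> space (obs_law n \<theta>). x < \<bar>Y i - \<theta> i\<bar>}"
      by (simp add: Int_def) (rule arg_cong[where f = P.prob], auto)
    also have "\<dots> = measure (normal 0 1) {z. x < \<bar>z\<bar>}"
      using that A by (intro obs_component_prob) auto
    also have "\<dots> = q" using normal_two_sided(1)[OF x] by (simp add: q_def)
    finally show ?thesis .
  qed
  define N where "N Y = (\<Sum>i\<in>A. X i Y)" for Y
  have [measurable]: "N \<in> borel_measurable (obs_law n \<theta>)"
    unfolding N_def[abs_def] using Xm by measurable
  have bad: "p \<ge> 1 - P.prob {Y \<in> space (obs_law n \<theta>). \<gamma> * card A \<le> N Y}" if ne: "A \<noteq> {}"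
  proof -
    have cA: "0 < card A" using ne fin by (simp add: card_gt_0_iff)
    have "coverage \<alpha> \<tau> L \<theta> A Y \<ge> 1 - \<gamma>" if "N Y < \<gamma> * card A" for Y
    proof -
      have "real (card A) = N Y + (\<Sum>i\<in>A. 1 - X i Y)"
        by (simp add: N_def sum_subtractf)
      also have "(\<Sum>i\<in>A. 1 - X i Y) \<le> (\<Sum>i\<in>A. if \<theta> i \<in> credible_interval \<alpha> \<tau> L (Y i) then 1 else 0)"
        using cover by (intro sum_mono) (auto simp: X_def indicator_def)
      also have "\<dots> = real (card {i \<in> A. \<theta> i \<in> credible_interval \<alpha> \<tau> L (Y i)})"
        using fin by (simp add: sum.If_cases Int_def)
      finally have "(1 - \<gamma>) * card A \<le> real (card {i \<in> A. \<theta> i \<in> credible_interval \<alpha> \<tau> L (Y i)})"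
        using that by (simp add: algebra_simps)
      then show ?thesis
        using ne cA by (simp add: coverage_def pos_le_divide_eq)
    qed
    then have "P.prob (space (obs_law n \<theta>) - {Y \<in> space (obs_law n \<theta>). \<gamma> * card A \<le> N Y}) \<le> p"
      unfolding p_def by (intro P.finite_measure_mono) auto
    then show ?thesis
      by (subst (asm) P.prob_compl) auto
  qed
  have empty: "p = 1" if "A = {}"
    unfolding p_def using that \<gamma> by (simp add: coverage_def P.prob_space)
  show "1 - 2 * upper_tail x / \<gamma> \<le> p"
  proof (cases "A = {}")
    case True
    then show ?thesis using empty q \<gamma> by (simp add: q_def)
  next
    case False
    then have cA: "0 < card A" using fin by (simp add: card_gt_0_iff)
    have "P.prob {Y \<in> space (obs_law n \<theta>). \<gamma> * card A \<le> N Y} \<le> P.expectation N / (\<gamma> * card A)"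
      using \<gamma> cA X01 Xi
      by (intro integral_Markov_inequality_measure[where A = "{}"])
        (auto simp: N_def[abs_def] intro!: sum_nonneg Bochner_Integration.integrable_sum mult_pos_pos)
    also have "P.expectation N = card A * q"
      unfolding N_def[abs_def] using Xi EX by (subst Bochner_Integration.integral_sum) auto
    also have "card A * q / (\<gamma> * card A) = q / \<gamma>" using cA by simp
    finally show ?thesis using bad[OF False] by (simp add: q_def)
  qed
  assume half: "2 * upper_tail x \<le> \<gamma> / 2"
  show "1 - exp (- (\<gamma>\<^sup>2 / 2 * card A)) \<le> p"
  proof (cases "A = {}")
    case True
    then show ?thesis using empty by simp
  next
    case False
    then have cA: "0 < card A" using fin by (simp add: card_gt_0_iff)
    interpret H: Hoeffding_ineq "obs_law n \<theta>" A X "\<lambda>_. 0" "\<lambda>_. 1" "\<Sum>i\<in>A. P.expectation (X i)"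
    proof unfold_locales
      show "P.indep_vars (\<lambda>_. borel) X A"
        unfolding X_def[abs_def]
        by (rule P.indep_vars_compose2[OF obs_indep[OF A False]]) measurable
    qed (use fin X01 in auto)
    have "P.prob {Y \<in> space (obs_law n \<theta>). \<gamma> * card A \<le> N Y}
        \<le> P.prob {Y \<in> space (obs_law n \<theta>). (\<Sum>i\<in>A. X i Y) \<ge> (\<Sum>i\<in>A. P.expectation (X i)) + \<gamma> / 2 * card A}"
    proof (intro P.finite_measure_mono subsetI CollectI conjI)
      fix Y assume Y: "Y \<in> {Y \<in> space (obs_law n \<theta>). \<gamma> * card A \<le> N Y}"
      have "(\<Sum>i\<in>A. P.expectation (X i)) = q * card A" using EX by simp
      also have "\<dots> \<le> \<gamma> / 2 * card A"
        using half by (intro mult_right_mono) (auto simp: q_def)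
      finally show "(\<Sum>i\<in>A. P.expectation (X i)) + \<gamma> / 2 * card A \<le> (\<Sum>i\<in>A. X i Y)"
        using Y by (simp add: N_def)
    next
      have [measurable]: "(\<lambda>Y. \<Sum>i\<in>A. X i Y) \<in> borel_measurable (obs_law n \<theta>)"
        using Xm by measurable
      show "{Y \<in> space (obs_law n \<theta>). (\<Sum>i\<in>A. X i Y) \<ge> (\<Sum>i\<in>A. P.expectation (X i)) + \<gamma> / 2 * card A} \<in> P.events"
        by measurable
    qed auto
    also have "\<dots> \<le> exp (- 2 * (\<gamma> / 2 * card A)\<^sup>2 / (\<Sum>i\<in>A. (1 - 0)\<^sup>2))"
      using \<gamma> cA by (intro H.Hoeffding_ineq_ge) auto
    also have "\<dots> = exp (- (\<gamma>\<^sup>2 / 2 * card A))"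
      using cA by (simp add: power2_eq_square)
    finally show ?thesis using bad[OF False] by simp
  qed
qed

section \<open>The theorem\<close>

lemma mem_credible_interval:
  "\<theta> \<in> credible_interval \<alpha> \<tau> (ereal L) y \<longleftrightarrow> \<bar>\<theta> - post_mean \<tau> y\<bar> \<le> L * radius \<alpha> \<tau> y"
  by (simp add: credible_interval_def)

text \<open>Positivity of the radius matters, because \<open>\<infinity> * 0\<close> is 0 in the
  extended reals.\<close>

lemma credible_interval_infinite:
  assumes "0 < \<tau>" "0 < \<alpha>" "\<alpha> < 1"
  shows "credible_interval \<alpha> \<tau> \<infinity> y = UNIV"
  using radius_pos[OF assms, of y] by (auto simp: credible_interval_def)

lemma L_S_eq: "z_upper \<alpha> \<noteq> 0 \<Longrightarrow>
    L_S \<alpha> kS \<gamma> = ereal (2.1 / z_upper \<alpha> * (kS + 2 / \<gamma> * zeta (\<gamma> / 2)))"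
  by (simp add: L_S_def)

lemma L_L_eq: "z_upper \<alpha> \<noteq> 0 \<Longrightarrow> L_L \<alpha> \<gamma> = ereal (1.1 / z_upper \<alpha> * zeta (\<gamma> / 2))"
  by (simp add: L_L_def)

lemma L_S_half: "0 < kS + 2 / \<gamma> * zeta (\<gamma> / 2) \<Longrightarrow> L_S (1 / 2) kS \<gamma> = \<infinity>"
  by (simp add: L_S_def z_upper_half divide_ereal_def zero_ereal_def[symmetric])

lemma L_L_half: "0 < zeta (\<gamma> / 2) \<Longrightarrow> L_L (1 / 2) \<gamma> = \<infinity>"
  by (simp add: L_L_def z_upper_half divide_ereal_def zero_ereal_def[symmetric])

text \<open>The bound 3/5 lies above the largest possible limit 1/2 of \<gamma> and still gives
  \<open>2 / \<gamma> \<ge> 3 \<ge> exp 1\<close>. The divisor \<open>zeta (\<gamma> / 2)\<close> in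
  the last claim is the gain from Mills' inequality.\<close>

lemma zeta_half_ge_one:
  assumes "0 < \<gamma>" "\<gamma> < 3 / 5"
  shows "1 \<le> zeta (\<gamma> / 2)" "exp ((zeta (\<gamma> / 2))\<^sup>2 / 2) = 2 / \<gamma>"
    "2 * upper_tail (zeta (\<gamma> / 2)) \<le> \<gamma> / 2 / zeta (\<gamma> / 2)"
proof -
  show e: "exp ((zeta (\<gamma> / 2))\<^sup>2 / 2) = 2 / \<gamma>"
    using assms by (simp add: exp_half_zeta_square)
  have "3 \<le> 2 / \<gamma>" using assms by (simp add: pos_le_divide_eq)
  then have "exp 1 \<le> exp (ln (2 / \<gamma>))"
    using exp_le assms by simp
  then have "1 \<le> ln (2 / \<gamma>)" by (simp only: exp_le_cancel_iff)
  then show z: "1 \<le> zeta (\<gamma> / 2)" by (simp add: zeta_def)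
  have "exp (- (zeta (\<gamma> / 2))\<^sup>2 / 2) = inverse (exp ((zeta (\<gamma> / 2))\<^sup>2 / 2))"
    by (simp add: exp_minus[symmetric])
  also have "\<dots> = \<gamma> / 2"
    unfolding e by simp
  finally have "exp (- (zeta (\<gamma> / 2))\<^sup>2 / 2) = \<gamma> / 2" .
  then show "2 * upper_tail (zeta (\<gamma> / 2)) \<le> \<gamma> / 2 / zeta (\<gamma> / 2)"
    using mills[of "zeta (\<gamma> / 2)"] z by (simp only: less_le_trans[OF zero_less_one])
qed

text \<open>For \<open>c = 0\<close> Markov's bound \<open>1 / (2 * zeta (\<gamma> / 2))\<close> on
  the failure probability vanishes, while the exponent \<open>\<gamma>\<^sup>2 / 2 * card\<close> in
  Hoeffding's inequality need not diverge. For \<open>c > 0\<close> it is the other way round: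
  \<open>zeta (\<gamma> / 2)\<close> converges, but the exponent diverges if the sets grow.\<close>

lemma coverage_tendsto_1:
  fixes \<theta> :: "nat \<Rightarrow> nat \<Rightarrow> real"
  assumes \<tau>: "\<And>n. 0 < \<tau> n" and \<alpha>: "0 < \<alpha>" "\<alpha> < 1"
    and \<gamma>: "\<And>n. 0 < \<gamma> n" "\<gamma> \<longlonglongrightarrow> c" "0 \<le> c" "c \<le> 1 / 2"
    and A: "\<And>n. A n \<subseteq> {1..n}"
    and large: "c = 0 \<or> filterlim (\<lambda>n. card (A n)) at_top sequentially"
    and cover: "eventually (\<lambda>n. \<forall>i\<in>A n. \<forall>y. \<bar>y - \<theta> n i\<bar> \<le> zeta (\<gamma> n / 2) \<longrightarrow>
      \<theta> n i \<in> credible_interval \<alpha> (\<tau> n) (L n) y) sequentially"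
  shows "(\<lambda>n. measure (obs_law n (\<theta> n)) {Y \<in> space (obs_law n (\<theta> n)).
      coverage \<alpha> (\<tau> n) (L n) (\<theta> n) (A n) Y \<ge> 1 - \<gamma> n}) \<longlonglongrightarrow> 1"
    (is "?p \<longlonglongrightarrow> 1")
proof -
  have le1: "?p n \<le> 1" for n
    by (rule prob_space.prob_le_1[OF prob_space_obs_law])
  have small: "eventually (\<lambda>n. \<gamma> n < 3 / 5) sequentially"
    using \<gamma>(4) by (intro order_tendstoD(2)[OF \<gamma>(2)]) simp
  show ?thesis
  proof (cases "c = 0")
    case True
    have lim0: "filterlim \<gamma> (at_right 0) sequentially"
      using \<gamma>(1,2) True by (intro tendsto_imp_filterlim_at_right) auto
    have "((\<lambda>g::real. 1 - 1 / 2 / sqrt (2 * ln (1 / (g / 2)))) \<longlongrightarrow> 1) (at_right 0)"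
      by real_asymp
    from filterlim_compose[OF this lim0]
    have lim: "(\<lambda>n. 1 - 1 / 2 / zeta (\<gamma> n / 2)) \<longlonglongrightarrow> 1"
      by (simp add: zeta_def)
    have "eventually (\<lambda>n. 1 - 1 / 2 / zeta (\<gamma> n / 2) \<le> ?p n) sequentially"
      using small cover
    proof eventually_elim
      case (elim n)
      have z: "1 \<le> zeta (\<gamma> n / 2)" "2 * upper_tail (zeta (\<gamma> n / 2)) \<le> \<gamma> n / 2 / zeta (\<gamma> n / 2)"
        using zeta_half_ge_one[OF \<gamma>(1) elim(1)] by auto
      have "2 * upper_tail (zeta (\<gamma> n / 2)) / \<gamma> n \<le> (\<gamma> n / 2 / zeta (\<gamma> n / 2)) / \<gamma> n"
        using z \<gamma>(1)[of n] by (intro divide_right_mono) auto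
      also have "\<dots> = 1 / 2 / zeta (\<gamma> n / 2)" using \<gamma>(1)[of n] by simp
      finally have "1 - 1 / 2 / zeta (\<gamma> n / 2) \<le> 1 - 2 * upper_tail (zeta (\<gamma> n / 2)) / \<gamma> n"
        by simp
      also have "\<dots> \<le> ?p n"
        using elim(2) z(1) by (intro coverage_prob(1) \<tau> \<alpha> A \<gamma>(1)) auto
      finally show ?case .
    qed
    then show ?thesis
      by (rule tendsto_sandwich[OF _ _ lim tendsto_const]) (simp add: le1)
  next
    case False
    then have c: "0 < c" and card: "filterlim (\<lambda>n. card (A n)) at_top sequentially"
      using \<gamma>(3) large by auto
    have "filterlim (\<lambda>n. (\<gamma> n)\<^sup>2 / 2 * real (card (A n))) at_top sequentially"
    proof (rule filterlim_tendsto_pos_mult_at_top)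
      show "(\<lambda>n. (\<gamma> n)\<^sup>2 / 2) \<longlonglongrightarrow> c\<^sup>2 / 2"
        using \<gamma>(2) by (intro tendsto_intros) auto
      show "filterlim (\<lambda>n. real (card (A n))) at_top sequentially"
        by (rule filterlim_compose[OF filterlim_real_sequentially card])
    qed (use c in simp)
    then have "(\<lambda>n. exp (- ((\<gamma> n)\<^sup>2 / 2 * real (card (A n))))) \<longlonglongrightarrow> 0"
      by (intro filterlim_compose[OF exp_at_bot]) (simp add: filterlim_uminus_at_top[symmetric])
    then have lim: "(\<lambda>n. 1 - exp (- ((\<gamma> n)\<^sup>2 / 2 * real (card (A n))))) \<longlonglongrightarrow> 1"
      using tendsto_diff[OF tendsto_const[of 1]] by fastforce
    have "eventually (\<lambda>n. 1 - exp (- ((\<gamma> n)\<^sup>2 / 2 * real (card (A n)))) \<le> ?p n) sequentially"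
      using small cover
    proof eventually_elim
      case (elim n)
      have z: "1 \<le> zeta (\<gamma> n / 2)" "2 * upper_tail (zeta (\<gamma> n / 2)) \<le> \<gamma> n / 2 / zeta (\<gamma> n / 2)"
        using zeta_half_ge_one[OF \<gamma>(1) elim(1)] by auto
      note z(2)
      also have "\<gamma> n / 2 / zeta (\<gamma> n / 2) \<le> \<gamma> n / 2 / 1"
        using z(1) \<gamma>(1)[of n] by (intro divide_left_mono) auto
      finally have "2 * upper_tail (zeta (\<gamma> n / 2)) \<le> \<gamma> n / 2" by simp
      then show ?case
        using elim(2) z(1) by (intro coverage_prob(2)[where x = "zeta (\<gamma> n / 2)"] \<tau> \<alpha> A \<gamma>(1)) auto
    qed
    then show ?thesis
      by (rule tendsto_sandwich[OF _ _ lim tendsto_const]) (simp add: le1)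
  qed
qed

text \<open>The claim on \<open>set_M\<close> is uniform in the coordinate, so it applies to any
  choice of coordinates along the sequence. For \<open>c > 0\<close> the claim on
  \<open>set_L\<close> asks for a growing set, since the fraction of failures in a set of bounded
  size does not concentrate. For \<open>set_S\<close> growth follows from sparsity.\<close>

theorem theorem2p1:
  fixes \<theta>0 :: "nat \<Rightarrow> nat \<Rightarrow> real"
    and \<tau> \<gamma> :: "nat \<Rightarrow> real"
    and f :: "real \<Rightarrow> real"
    and \<alpha> kS kM kL c :: real
  assumes sparse: "filterlim (\<lambda>n. card {i \<in> {1..n}. \<theta>0 n i \<noteq> 0}) at_top sequentially"
      "(\<lambda>n. real (card {i \<in> {1..n}. \<theta>0 n i \<noteq> 0}) / real n) \<longlonglongrightarrow> 0"
    and \<alpha>: "0 < \<alpha>" "\<alpha> \<le> 1/2"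
    and \<tau>: "\<And>n. 0 < \<tau> n \<and> \<tau> n < 1" "\<tau> \<longlonglongrightarrow> 0"
    and kS: "0 < kS"
    and kM: "0 < kM" "kM < 1"
    and kL: "1 < kL"
    and f: "antimono_on {0<..<1} f" "filterlim f at_top (at_right 0)"
    and \<gamma>: "\<And>n. 0 < \<gamma> n" "\<gamma> \<longlonglongrightarrow> c" "0 \<le> c" "c \<le> 1/2"
      "(\<lambda>n. zeta (\<gamma> n) / zeta (\<tau> n)) \<longlonglongrightarrow> 0"
  shows "((\<lambda>n. measure (obs_law n (\<theta>0 n))
              {Y \<in> space (obs_law n (\<theta>0 n)).
                coverage \<alpha> (\<tau> n) (L_S \<alpha> kS (\<gamma> n)) (\<theta>0 n) (set_S kS (\<tau> n) n (\<theta>0 n)) Y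
                  \<ge> 1 - \<gamma> n}) \<longlonglongrightarrow> 1)
    \<and> (\<forall>L::real. 0 < L \<longrightarrow>
          (\<forall>e>0. \<forall>\<^sub>F n in sequentially. \<forall>i \<in> set_M f kM (\<tau> n) n (\<theta>0 n).
             measure (obs_law n (\<theta>0 n))
               {Y \<in> space (obs_law n (\<theta>0 n)).
                 \<theta>0 n i \<notin> credible_interval \<alpha> (\<tau> n) (ereal L) (Y i)} \<ge> 1 - e))
    \<and> (c = 0 \<or> filterlim (\<lambda>n. card (set_L kL (\<tau> n) n (\<theta>0 n))) at_top sequentially \<longrightarrow>
        (\<lambda>n. measure (obs_law n (\<theta>0 n))
              {Y \<in> space (obs_law n (\<theta>0 n)).
                coverage \<alpha> (\<tau> n) (L_L \<alpha> (\<gamma> n)) (\<theta>0 n) (set_L kL (\<tau> n) n (\<theta>0 n)) Y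
                  \<ge> 1 - \<gamma> n}) \<longlonglongrightarrow> 1)"
proof -
  have \<tau>0: "0 < \<tau> n" "\<tau> n < 1" for n using \<tau>(1) by auto
  have \<alpha>1: "\<alpha> < 1" using \<alpha> by simp
  have \<tau>lim: "filterlim \<tau> (at_right 0) sequentially"
    using \<tau> by (intro tendsto_imp_filterlim_at_right) auto
  define Z where "Z n = zeta (\<gamma> n / 2)" for n
  have small: "eventually (\<lambda>n. \<gamma> n < 3 / 5) sequentially"
    using \<gamma>(4) by (intro order_tendstoD(2)[OF \<gamma>(2)]) simp
  have "filterlim (\<lambda>t::real. sqrt (2 * ln (1 / t))) at_top (at_right 0)"
    by real_asymp
  from filterlim_compose[OF this \<tau>lim]
  have \<zeta>lim: "filterlim (\<lambda>n. zeta (\<tau> n)) at_top sequentially"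
    by (simp add: zeta_def)
  have \<zeta>large: "eventually (\<lambda>n. b < zeta (\<tau> n)) sequentially" for b
    using \<zeta>lim by (auto simp: filterlim_at_top_dense)
  have "((\<lambda>t::real. t * sqrt (2 * ln (1 / t))) \<longlongrightarrow> 0) (at_right 0)"
    by real_asymp
  from filterlim_compose[OF this \<tau>lim]
  have \<tau>\<zeta>: "(\<lambda>n. \<tau> n * zeta (\<tau> n)) \<longlonglongrightarrow> 0"
    by (simp add: zeta_def)
  \<comment> \<open>Halving \<gamma> adds \<open>2 * ln 2\<close> under the root, hence at most 2 to
    \<open>zeta (\<gamma> n)\<close>, which is negligible against
    \<open>zeta (\<tau> n)\<close>.\<close>
  have Zsmall: "eventually (\<lambda>n. Z n \<le> b * zeta (\<tau> n)) sequentially" if b: "0 < b" for b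
  proof -
    have "eventually (\<lambda>n. zeta (\<gamma> n) / zeta (\<tau> n) < b / 2) sequentially"
      using b by (intro order_tendstoD(2)[OF \<gamma>(5)]) simp
    then show ?thesis
      using small \<zeta>large[of 0] \<zeta>large[of "4 / b"]
    proof eventually_elim
      case (elim n)
      have g: "0 < \<gamma> n" "\<gamma> n < 1" using \<gamma>(1)[of n] elim by auto
      have "ln (1 / (\<gamma> n / 2)) = ln 2 + ln (1 / \<gamma> n)"
        using g by (simp add: ln_div)
      then have "Z n = sqrt (2 * ln (1 / \<gamma> n) + 2 * ln 2)"
        by (simp add: Z_def zeta_def)
      also have "\<dots> \<le> zeta (\<gamma> n) + sqrt (2 * ln 2)"
        unfolding zeta_def using g by (intro sqrt_add_le_add_sqrt) auto
      also have "sqrt (2 * ln 2) \<le> sqrt (2\<^sup>2)"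
        using ln_le_minus_one[of "2::real"] by (intro real_sqrt_le_mono) simp
      finally have "Z n \<le> zeta (\<gamma> n) + 2" by simp
      moreover have "zeta (\<gamma> n) < b / 2 * zeta (\<tau> n)"
        using elim by (simp add: pos_divide_less_eq)
      moreover have "2 < b / 2 * zeta (\<tau> n)"
        using elim b by (simp add: pos_divide_less_eq mult.commute)
      moreover have "b * zeta (\<tau> n) = b / 2 * zeta (\<tau> n) + b / 2 * zeta (\<tau> n)" by simp
      ultimately show ?case by linarith
    qed
  qed
  show ?thesis
  proof (intro conjI impI allI)
    \<comment> \<open>All zero coordinates belong to \<open>set_S\<close>, and by sparsity they
      eventually make up more than half.\<close>
    have "eventually (\<lambda>n. real (card {i \<in> {1..n}. \<theta>0 n i \<noteq> 0}) / real n < 1 / 2) sequentially"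
      by (intro order_tendstoD(2)[OF sparse(2)]) simp
    then have "eventually (\<lambda>n. n div 2 \<le> card (set_S kS (\<tau> n) n (\<theta>0 n))) sequentially"
      using eventually_gt_at_top[of 0]
    proof eventually_elim
      case (elim n)
      let ?P = "{i \<in> {1..n}. \<theta>0 n i \<noteq> 0}"
      have "real (card ?P) < real n / 2"
        using elim by (simp add: pos_divide_less_eq)
      moreover have "card ({1..n} - ?P) = card {1..n} - card ?P"
        by (rule card_Diff_subset) auto
      moreover have "card ({1..n} - ?P) \<le> card (set_S kS (\<tau> n) n (\<theta>0 n))"
        using kS \<tau>0[of n] by (intro card_mono) (auto simp: set_S_def)
      ultimately show ?case by simp
    qed
    moreover have "filterlim (\<lambda>n::nat. n div 2) at_top sequentially"
      by (rule filterlim_at_top_div_const_nat) simp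
    ultimately have "filterlim (\<lambda>n. card (set_S kS (\<tau> n) n (\<theta>0 n))) at_top sequentially"
      by (rule filterlim_at_top_mono[rotated])
    then show "(\<lambda>n. measure (obs_law n (\<theta>0 n)) {Y \<in> space (obs_law n (\<theta>0 n)).
        coverage \<alpha> (\<tau> n) (L_S \<alpha> kS (\<gamma> n)) (\<theta>0 n) (set_S kS (\<tau> n) n (\<theta>0 n)) Y \<ge> 1 - \<gamma> n}) \<longlonglongrightarrow> 1"
    proof (intro coverage_tendsto_1[where c = c] \<tau>0 \<alpha> \<alpha>1 \<gamma> disjI2)
      show "set_S kS (\<tau> n) n (\<theta>0 n) \<subseteq> {1..n}" for n
        by (auto simp: set_S_def)
      show "eventually (\<lambda>n. \<forall>i\<in>set_S kS (\<tau> n) n (\<theta>0 n). \<forall>y. \<bar>y - \<theta>0 n i\<bar> \<le> zeta (\<gamma> n / 2) \<longrightarrow>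
          \<theta>0 n i \<in> credible_interval \<alpha> (\<tau> n) (L_S \<alpha> kS (\<gamma> n)) y) sequentially"
      proof (cases "\<alpha> = 1 / 2")
        case True
        show ?thesis
          using small
        proof eventually_elim
          case (elim n)
          have "0 < kS + 2 / \<gamma> n * zeta (\<gamma> n / 2)"
            using kS \<gamma>(1)[of n] zeta_half_ge_one(1)[OF \<gamma>(1) elim] by (intro add_pos_nonneg) auto
          then have "L_S \<alpha> kS (\<gamma> n) = \<infinity>"
            unfolding True by (rule L_S_half)
          then show ?case
            by (simp add: credible_interval_infinite \<tau>0 \<alpha> \<alpha>1)
        qed
      next
        case False
        then have \<alpha>2: "\<alpha> < 1 / 2" using \<alpha> by simp
        obtain \<eta> where \<eta>: "0 < \<eta>"
          and cov: "eventually (\<lambda>\<tau>. \<forall>\<theta> y Z. 1 \<le> Z \<longrightarrow> \<tau> * Z < \<eta> \<longrightarrow> \<bar>\<theta>\<bar> \<le> kS * \<tau> \<longrightarrow> \<bar>y - \<theta>\<bar> \<le> Z \<longrightarrow>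
            \<bar>\<theta> - post_mean \<tau> y\<bar> \<le> 2.1 / z_upper \<alpha> * (kS + exp (Z\<^sup>2 / 2) * Z) * radius \<alpha> \<tau> y) (at_right 0)"
          using small_signal_covered[OF \<alpha>(1) \<alpha>2 kS] by blast
        have "eventually (\<lambda>n. \<tau> n * zeta (\<tau> n) < \<eta>) sequentially"
          using \<eta> by (intro order_tendstoD(2)[OF \<tau>\<zeta>])
        with small Zsmall[OF zero_less_one] eventually_compose_filterlim[OF cov \<tau>lim] show ?thesis
        proof eventually_elim
          case (elim n)
          have "\<tau> n * Z n \<le> \<tau> n * zeta (\<tau> n)"
            using elim(2) \<tau>0[of n] by (intro mult_left_mono) auto
          then have "\<tau> n * Z n < \<eta>" using elim by linarith
          moreover note Z1 = zeta_half_ge_one(1,2)[OF \<gamma>(1) elim(1)]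
          ultimately have "\<bar>\<theta> - post_mean (\<tau> n) y\<bar>
              \<le> 2.1 / z_upper \<alpha> * (kS + 2 / \<gamma> n * zeta (\<gamma> n / 2)) * radius \<alpha> (\<tau> n) y"
            if "\<bar>\<theta>\<bar> \<le> kS * \<tau> n" "\<bar>y - \<theta>\<bar> \<le> zeta (\<gamma> n / 2)" for \<theta> y
            using that elim(3) unfolding Z1(2)[symmetric] by (auto simp only: Z_def)
          then show ?case
            using z_upper_pos[OF \<alpha>(1) \<alpha>2] by (simp add: L_S_eq mem_credible_interval set_S_def)
        qed
      qed
    qed
  next
    fix L e :: real
    assume L: "0 < L" and e: "0 < e"
    \<comment> \<open>By Mills' inequality the noise exceeds \<open>B\<close> with probability at
      most \<open>1 / B \<le> e\<close>.\<close>
    define B where "B = max 1 (1 / e)"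
    have B: "1 \<le> B" "1 / B \<le> e"
      using e by (auto simp: B_def divide_le_eq max_def mult.commute split: if_splits)
    have "exp (- B\<^sup>2 / 2) / B \<le> 1 / B"
      using B by (intro divide_right_mono) auto
    then have tail: "2 * upper_tail B \<le> e"
      using mills[of B] B by linarith
    obtain C where C: "0 < C"
      and bounded: "eventually (\<lambda>\<tau>. \<forall>y. \<bar>y\<bar> \<le> 1 + B \<longrightarrow>
        \<bar>post_mean \<tau> y\<bar> \<le> C * \<tau> \<and> radius \<alpha> \<tau> y \<le> C * \<tau>) (at_right 0)"
      using posterior_scale_bounded_obs[OF \<alpha>(1) \<alpha>1, of "1 + B"] B by auto
    \<comment> \<open>Room between \<open>kM\<close> and 1 absorbs the bounded noise:
      \<open>kM * zeta \<tau> + B\<close> is eventually below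
      \<open>k * zeta \<tau>\<close>.\<close>
    define k where "k = (1 + kM) / 2"
    have k: "0 < k" "k < 1" "0 < k - kM" using kM by (auto simp: k_def)
    have sub: "eventually (\<lambda>\<tau>. \<forall>y. \<bar>y\<bar> \<le> k * zeta \<tau> \<longrightarrow>
        \<bar>post_mean \<tau> y\<bar> \<le> 1 / (2 * (1 + L)) \<and> radius \<alpha> \<tau> y \<le> 1 / (2 * (1 + L))) (at_right 0)"
      using L by (intro posterior_scale_subthreshold \<alpha> \<alpha>1 k) simp
    have "eventually (\<lambda>n. C * (1 + L) < f (\<tau> n)) sequentially"
      using filterlim_compose[OF f(2) \<tau>lim] by (auto simp: filterlim_at_top_dense)
    with eventually_compose_filterlim[OF bounded \<tau>lim] eventually_compose_filterlim[OF sub \<tau>lim]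
      \<zeta>large[of "B / (k - kM)"]
    show "\<forall>\<^sub>F n in sequentially. \<forall>i \<in> set_M f kM (\<tau> n) n (\<theta>0 n).
        measure (obs_law n (\<theta>0 n)) {Y \<in> space (obs_law n (\<theta>0 n)).
          \<theta>0 n i \<notin> credible_interval \<alpha> (\<tau> n) (ereal L) (Y i)} \<ge> 1 - e"
    proof eventually_elim
      case (elim n)
      show ?case
      proof
        fix i assume i: "i \<in> set_M f kM (\<tau> n) n (\<theta>0 n)"
        define \<theta> where "\<theta> = \<theta>0 n i"
        have in1: "i \<in> {1..n}" and \<theta>: "f (\<tau> n) * \<tau> n \<le> \<bar>\<theta>\<bar>" "\<bar>\<theta>\<bar> \<le> kM * zeta (\<tau> n)"
          using i by (auto simp: set_M_def \<theta>_def)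
        interpret P: prob_space "obs_law n (\<theta>0 n)" by (rule prob_space_obs_law)
        have miss: "\<theta> \<notin> credible_interval \<alpha> (\<tau> n) (ereal L) y" if y: "\<bar>y - \<theta>\<bar> \<le> B" for y
        proof -
          have "\<bar>post_mean (\<tau> n) y\<bar> + L * radius \<alpha> (\<tau> n) y < \<bar>\<theta>\<bar>"
          \<comment> \<open>Since \<open>f\<close> may grow slowly, small signals need mean and
            radius of exact order \<tau>, which holds because the observation is then bounded.
            Larger signals only need the mean plus \<open>L\<close> times the radius to be at most
            1/2.\<close>
          proof (cases "\<bar>\<theta>\<bar> \<le> 1")
            case True
            then have "\<bar>y\<bar> \<le> 1 + B" using y by linarith
            then have m: "\<bar>post_mean (\<tau> n) y\<bar> \<le> C * \<tau> n" "radius \<alpha> (\<tau> n) y \<le> C * \<tau> n"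
              using elim by auto
            have "L * radius \<alpha> (\<tau> n) y \<le> L * (C * \<tau> n)"
              using m L by (intro mult_left_mono) auto
            then have "\<bar>post_mean (\<tau> n) y\<bar> + L * radius \<alpha> (\<tau> n) y \<le> C * (1 + L) * \<tau> n"
              using m by (simp add: algebra_simps)
            also have "\<dots> < f (\<tau> n) * \<tau> n"
              using elim \<tau>0[of n] by (intro mult_strict_right_mono) auto
            finally show ?thesis using \<theta> by linarith
          next
            case False
            have "B < (k - kM) * zeta (\<tau> n)"
              using elim k by (simp add: pos_divide_less_eq mult.commute)
            then have "\<bar>y\<bar> \<le> k * zeta (\<tau> n)"
              using y \<theta> by (simp add: left_diff_distrib)
            then have m: "\<bar>post_mean (\<tau> n) y\<bar> \<le> 1 / (2 * (1 + L))" "radius \<alpha> (\<tau> n) y \<le> 1 / (2 * (1 + L))"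
              using elim by auto
            have "L * radius \<alpha> (\<tau> n) y \<le> L * (1 / (2 * (1 + L)))"
              using m L by (intro mult_left_mono) auto
            then have "\<bar>post_mean (\<tau> n) y\<bar> + L * radius \<alpha> (\<tau> n) y \<le> (1 + L) * (1 / (2 * (1 + L)))"
              using m(1) by (simp only: distrib_right mult_1_left)
            also have "\<dots> = 1 / 2" using L by simp
            finally show ?thesis using False by simp
          qed
          then show ?thesis
            by (simp add: mem_credible_interval)
        qed
        have "1 - e \<le> measure (normal 0 1) {z. \<bar>z\<bar> \<le> B}"
          using normal_two_sided(2)[of B] B tail by simp
        also have "\<dots> = P.prob {Y \<in> space (obs_law n (\<theta>0 n)). \<bar>Y i - \<theta>0 n i\<bar> \<le> B}"
          by (rule obs_component_prob[OF in1, symmetric]) measurable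
        also have "\<dots> \<le> P.prob {Y \<in> space (obs_law n (\<theta>0 n)). \<theta>0 n i \<notin> credible_interval \<alpha> (\<tau> n) (ereal L) (Y i)}"
        proof (rule P.finite_measure_mono)
          have [measurable]: "Measurable.pred (obs_law n (\<theta>0 n)) (\<lambda>Y. \<theta>0 n i \<in> credible_interval \<alpha> (\<tau> n) (ereal L) (Y i))"
            by (intro obs_pred_measurable in1 credible_interval_pred \<tau>0 \<alpha> \<alpha>1)
          show "{Y \<in> space (obs_law n (\<theta>0 n)). \<theta>0 n i \<notin> credible_interval \<alpha> (\<tau> n) (ereal L) (Y i)} \<in> P.events"
            by measurable
        qed (use miss in \<open>auto simp: \<theta>_def\<close>)
        finally show "1 - e \<le> P.prob {Y \<in> space (obs_law n (\<theta>0 n)). \<theta>0 n i \<notin> credible_interval \<alpha> (\<tau> n) (ereal L) (Y i)}" .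
      qed
    qed
  next
    assume large: "c = 0 \<or> filterlim (\<lambda>n. card (set_L kL (\<tau> n) n (\<theta>0 n))) at_top sequentially"
    show "(\<lambda>n. measure (obs_law n (\<theta>0 n)) {Y \<in> space (obs_law n (\<theta>0 n)).
        coverage \<alpha> (\<tau> n) (L_L \<alpha> (\<gamma> n)) (\<theta>0 n) (set_L kL (\<tau> n) n (\<theta>0 n)) Y \<ge> 1 - \<gamma> n}) \<longlonglongrightarrow> 1"
    proof (intro coverage_tendsto_1[where c = c] \<tau>0 \<alpha> \<alpha>1 \<gamma> large)
      show "set_L kL (\<tau> n) n (\<theta>0 n) \<subseteq> {1..n}" for n
        by (auto simp: set_L_def)
      show "eventually (\<lambda>n. \<forall>i\<in>set_L kL (\<tau> n) n (\<theta>0 n). \<forall>y. \<bar>y - \<theta>0 n i\<bar> \<le> zeta (\<gamma> n / 2) \<longrightarrow>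
          \<theta>0 n i \<in> credible_interval \<alpha> (\<tau> n) (L_L \<alpha> (\<gamma> n)) y) sequentially"
      proof (cases "\<alpha> = 1 / 2")
        case True
        show ?thesis
          using small
        proof eventually_elim
          case (elim n)
          have "0 < zeta (\<gamma> n / 2)"
            using zeta_half_ge_one(1)[OF \<gamma>(1) elim] by simp
          then have "L_L \<alpha> (\<gamma> n) = \<infinity>"
            unfolding True by (rule L_L_half)
          then show ?case
            by (simp add: credible_interval_infinite \<tau>0 \<alpha> \<alpha>1)
        qed
      next
        case False
        then have \<alpha>2: "\<alpha> < 1 / 2" using \<alpha> by simp
        \<comment> \<open>Noise is at most \<open>(kL - k) * zeta \<tau>\<close> eventually, so the
          observation itself stays beyond \<open>k * zeta \<tau>\<close> with
          \<open>k > 1\<close>.\<close>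
        define k where "k = (1 + kL) / 2"
        have k: "1 < k" "0 < kL - k" using kL by (auto simp: k_def)
        obtain T where T: "\<And>\<tau> \<theta> y Z. 0 < \<tau> \<Longrightarrow> \<tau> < 1 \<Longrightarrow> T \<le> \<bar>y\<bar> \<Longrightarrow> k * zeta \<tau> \<le> \<bar>y\<bar> \<Longrightarrow> 1 \<le> Z \<Longrightarrow>
            \<bar>y - \<theta>\<bar> \<le> Z \<Longrightarrow> \<bar>\<theta> - post_mean \<tau> y\<bar> \<le> 1.1 / z_upper \<alpha> * Z * radius \<alpha> \<tau> y"
          using large_signal_covered[OF \<alpha>(1) \<alpha>2 k(1)] by blast
        show ?thesis
          using small Zsmall[OF k(2)] \<zeta>large[of "max 0 T"]
        proof eventually_elim
          case (elim n)
          show ?case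
          proof (intro ballI allI impI)
            fix i y assume i: "i \<in> set_L kL (\<tau> n) n (\<theta>0 n)" and y: "\<bar>y - \<theta>0 n i\<bar> \<le> zeta (\<gamma> n / 2)"
            have "kL * zeta (\<tau> n) \<le> \<bar>\<theta>0 n i\<bar>" using i by (simp add: set_L_def)
            then have ky: "k * zeta (\<tau> n) \<le> \<bar>y\<bar>"
              using elim(2) y by (simp add: Z_def left_diff_distrib)
            have "1 * zeta (\<tau> n) \<le> k * zeta (\<tau> n)"
              using k elim by (intro mult_right_mono) auto
            moreover have "T < zeta (\<tau> n)" using elim by simp
            ultimately have "T \<le> \<bar>y\<bar>" using ky by linarith
            then show "\<theta>0 n i \<in> credible_interval \<alpha> (\<tau> n) (L_L \<alpha> (\<gamma> n)) y"
              using T[OF \<tau>0[of n] _ ky zeta_half_ge_one(1)[OF \<gamma>(1) elim(1)] y] z_upper_pos[OF \<alpha>(1) \<alpha>2]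
              by (simp add: L_L_eq mem_credible_interval)
          qed
        qed
      qed
    qed
  qed
qed

end
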